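(* Let $(\mathcal C,\circ,I,\bullet,J)$ be a duoidal category. (a) Let $i:K\to A$ and $j:H\to A$ be morphisms in $\mathrm{Bimon}(\mathcal C,\circ,\bullet)$ such that $\varphi:=m_A(i\circ j):K\circ H\to A$ is invertible in $\mathcal C$. Set $\psi:=\varphi^{-1}m_A(j\circ i):H\circ K\to K\circ H$. Then $K\circ H$ inherits a unique bimonoid structure, denoted $K\circ_\psi H$, such that $\varphi$ is a morphism of bimonoids, namely $$m_{K\circ_\psi H}=(m_K\circ m_H)(K\circ\psi\circ H),\qquad u_{K\circ_\psi H}=(u_K\circ u_H)(m_I)^{-1},$$ $$\Delta_{K\circ_\psi H}=\zeta_{K,K,H,H}(\Delta_K\circ\Delta_H),\qquad \varepsilon_{K\circ_\psi H}=m_J(\varepsilon_K\circ\varepsilon_H).$$ (b) Given $H,K$ in $\mathrm{Bimon}(\mathcal C,\circ,\bullet)$ and a morphism $\psi:H\circ K\to K\circ H$ in $\mathcal C$, the object $K\circ H$ with the four structure morphisms displayed above (denoted $K\circ_\psi H$) is a bimonoid if and only if the following conditions hold: $$\psi(m_H\circ K)=(K\circ m_H)(\psi\circ H)(H\circ\psi),\qquad \psi(u_H\circ K)(l^\circ_K)^{-1}=(K\circ u_H)(r^\circ_K)^{-1},$$ $$\psi(H\circ m_K)=(m_K\circ H)(K\circ\psi)(\psi\circ K),\qquad \psi(H\circ u_K)(r^\circ_H)^{-1}=(u_K\circ H)(l^\circ_H)^{-1},$$ $$\psi\ \text{is a morphism of comonoids in } (\mathcal C,\bullet,J).$$ Thus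 $K\circ_\psi H$ is a twisted tensor product of the monoids $H,K$ in $(\mathrm{Comon}(\mathcal C^\bullet),\circ)$ with twisting morphism $\psi$.
   Context: Conventions: composition is juxtaposition (right to left), an object also denotes its identity morphism, associativity constraints are suppressed. Duoidal category $(\mathcal C,\circ,I,\bullet,J)$: a category with monoidal structures $(\mathcal C,\circ,I)$, $(\mathcal C,\bullet,J)$ (left/right unit constraints $l^\circ,r^\circ$, resp. $l^\bullet,r^\bullet$), a natural transformation $\zeta_{A,B,C,D}:(A\bullet B)\circ(C\bullet D)\to(A\circ C)\bullet(B\circ D)$ and morphisms $\Delta_I:I\to I\bullet I$, $m_J:J\circ J\to J$, $\varepsilon_I=u_J:I\to J$ such that $(J,m_J,u_J)$ is a monoid in $(\mathcal C,\circ,I)$, $(I,\Delta_I,\varepsilon_I)$ is a comonoid in $(\mathcal C,\bullet,J)$, and $\zeta_{A,B,C\circ E,D\circ F}((A\bullet B)\circ\zeta_{C,D,E,F})=\zeta_{A\circ C,B\circ D,E,F}(\zeta_{A,B,C,D}\circ(E\bullet F))$, $((A\circ D)\bullet\zeta_{B,C,E,F})\zeta_{A,B\bullet C,D,E\bullet F}=(\zeta_{A,B,D,E}\bullet(C\circ F))\zeta_{A\bullet B,C,D\bullet E,F}$, $(l^\circ_A\bullet l^\circ_B)\zeta_{I,I,A,B}(\Delta_I\circ(A\bullet B))=l^\circ_{A\bullet B}$, $(r^\circ_A\bullet r^\circ_B)\zeta_{A,B,I,I}((A\bullet B)\circ\Delta_I)=r^\circ_{A\bullet B}$, $l^\bullet_{A\circ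 B}(m_J\bullet(A\circ B))\zeta_{J,A,J,B}=l^\bullet_A\circ l^\bullet_B$, $r^\bullet_{A\circ B}((A\circ B)\bullet m_J)\zeta_{A,J,B,J}=r^\bullet_A\circ r^\bullet_B$. $m_I:I\circ I\to I$ is the canonical isomorphism $l^\circ_I=r^\circ_I$. Bimonoid: $(H,m_H,u_H,\Delta_H,\varepsilon_H)$ with $(H,m_H,u_H)$ a monoid in $(\mathcal C,\circ,I)$, $(H,\Delta_H,\varepsilon_H)$ a comonoid in $(\mathcal C,\bullet,J)$ and $\Delta_Hm_H=(m_H\bullet m_H)\zeta_{H,H,H,H}(\Delta_H\circ\Delta_H)$, $\varepsilon_Hm_H=m_J(\varepsilon_H\circ\varepsilon_H)$, $\Delta_Hu_H=(u_H\bullet u_H)\Delta_I$, $\varepsilon_Hu_H=\varepsilon_I$. Morphisms of bimonoids are morphisms of monoids and of comonoids; $\mathrm{Bimon}(\mathcal C,\circ,\bullet)$ is the resulting category. $\mathrm{Comon}(\mathcal C^\bullet)$ is the category of comonoids in $(\mathcal C,\bullet,J)$; it is monoidal under $\circ$, with unit $I$, where $C\circ D$ has comultiplication $\zeta_{C,C,D,D}(\Delta_C\circ\Delta_D)$ and counit $m_J(\varepsilon_C\circ\varepsilon_D)$; bimonoids are the monoids in it. A twisted tensor product of monoids $H,K$ in a monoidal category with tensor $\circ$, with twisting morphism $\psi:H\circ K\to K\circ H$ in that category obeying the four multiplication/unit conditions above, is $K\circ H$ with multiplication $(m_K\circ m_H)(K\circ\psi\circ H)$ and unit $(u_K\circ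 u_H)(m_I)^{-1}$. *)

theory Defs
  imports Main
begin

section \<open>Categories and monoidal categories\<close>

text \<open>A category is given by a set of objects and a family of hom-sets. The hom-sets need not be
  disjoint, so that the same underlying arrow may serve as a morphism between several structured
  objects (for example comonoids); any category can be presented in this way.
  Composition is written right to left.\<close>

record ('o, 'm) category_data =
  obj :: "'o set"
  hom :: "'o \<Rightarrow> 'o \<Rightarrow> 'm set"
  ident :: "'o \<Rightarrow> 'm"
  arrcomp :: "'m \<Rightarrow> 'm \<Rightarrow> 'm"  (infixr "\<cdot>\<index>" 55)

locale category =
  fixes C :: "('o, 'm, 'z) category_data_scheme" (structure)
  assumes hom_obj: "f \<in> hom C X Y \<Longrightarrow> X \<in> obj C \<and> Y \<in> obj C"
    and ident_hom: "X \<in> obj C \<Longrightarrow> ident C X \<in> hom C X X"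
    and comp_hom: "\<lbrakk>f \<in> hom C X Y; g \<in> hom C Y Z\<rbrakk> \<Longrightarrow> g \<cdot> f \<in> hom C X Z"
    and comp_ident_right: "f \<in> hom C X Y \<Longrightarrow> f \<cdot> ident C X = f"
    and comp_ident_left: "f \<in> hom C X Y \<Longrightarrow> ident C Y \<cdot> f = f"
    and comp_assoc: "\<lbrakk>f \<in> hom C W X; g \<in> hom C X Y; h \<in> hom C Y Z\<rbrakk>
      \<Longrightarrow> (h \<cdot> g) \<cdot> f = h \<cdot> (g \<cdot> f)"

definition inverse_arrows ::
  "('o, 'm, 'z) category_data_scheme \<Rightarrow> 'o \<Rightarrow> 'o \<Rightarrow> 'm \<Rightarrow> 'm \<Rightarrow> bool" where
  "inverse_arrows C X Y f g \<longleftrightarrow> f \<in> hom C X Y \<and> g \<in> hom C Y X \<and>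
     g \<cdot>\<^bsub>C\<^esub> f = ident C X \<and> f \<cdot>\<^bsub>C\<^esub> g = ident C Y"

definition invertible :: "('o, 'm, 'z) category_data_scheme \<Rightarrow> 'o \<Rightarrow> 'o \<Rightarrow> 'm \<Rightarrow> bool" where
  "invertible C X Y f \<longleftrightarrow> (\<exists>g. inverse_arrows C X Y f g)"

definition inv_arr :: "('o, 'm, 'z) category_data_scheme \<Rightarrow> 'o \<Rightarrow> 'o \<Rightarrow> 'm \<Rightarrow> 'm" where
  "inv_arr C X Y f = (THE g. inverse_arrows C X Y f g)"

text \<open>The associativity constraint \<open>associator M X Y Z\<close> goes from \<open>(X \<otimes> Y) \<otimes> Z\<close> to
  \<open>X \<otimes> (Y \<otimes> Z)\<close>; it is always written explicitly. The tensor product of arrows is written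
  \<open>f \<boxtimes> g\<close>.\<close>

record ('o, 'm) monoidal_data = "('o, 'm) category_data" +
  tensor :: "'o \<Rightarrow> 'o \<Rightarrow> 'o"  (infixr "\<otimes>\<index>" 70)
  tensor_arr :: "'m \<Rightarrow> 'm \<Rightarrow> 'm"  (infixr "\<boxtimes>\<index>" 70)
  tunit :: 'o
  associator :: "'o \<Rightarrow> 'o \<Rightarrow> 'o \<Rightarrow> 'm"
  lunit :: "'o \<Rightarrow> 'm"
  runit :: "'o \<Rightarrow> 'm"

abbreviation associator_inv ::
  "('o, 'm, 'z) monoidal_data_scheme \<Rightarrow> 'o \<Rightarrow> 'o \<Rightarrow> 'o \<Rightarrow> 'm" where
  "associator_inv M X Y Z \<equiv>
     inv_arr M ((X \<otimes>\<^bsub>M\<^esub> Y) \<otimes>\<^bsub>M\<^esub> Z) (X \<otimes>\<^bsub>M\<^esub> (Y \<otimes>\<^bsub>M\<^esub> Z)) (associator M X Y Z)"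

abbreviation lunit_inv :: "('o, 'm, 'z) monoidal_data_scheme \<Rightarrow> 'o \<Rightarrow> 'm" where
  "lunit_inv M X \<equiv> inv_arr M (tunit M \<otimes>\<^bsub>M\<^esub> X) X (lunit M X)"

abbreviation runit_inv :: "('o, 'm, 'z) monoidal_data_scheme \<Rightarrow> 'o \<Rightarrow> 'm" where
  "runit_inv M X \<equiv> inv_arr M (X \<otimes>\<^bsub>M\<^esub> tunit M) X (runit M X)"

locale monoidal_category = category M
  for M :: "('o, 'm, 'z) monoidal_data_scheme" (structure) +
  assumes tensor_obj: "\<lbrakk>X \<in> obj M; Y \<in> obj M\<rbrakk> \<Longrightarrow> X \<otimes> Y \<in> obj M"
    and tunit_obj: "tunit M \<in> obj M"
    and tensor_hom: "\<lbrakk>f \<in> hom M X X'; g \<in> hom M Y Y'\<rbrakk> \<Longrightarrow> f \<boxtimes> g \<in> hom M (X \<otimes> Y) (X' \<otimes> Y')"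
    and tensor_ident: "\<lbrakk>X \<in> obj M; Y \<in> obj M\<rbrakk> \<Longrightarrow> ident M X \<boxtimes> ident M Y = ident M (X \<otimes> Y)"
    and interchange: "\<lbrakk>f \<in> hom M X X'; f' \<in> hom M X' X''; g \<in> hom M Y Y'; g' \<in> hom M Y' Y''\<rbrakk>
      \<Longrightarrow> (f' \<cdot> f) \<boxtimes> (g' \<cdot> g) = (f' \<boxtimes> g') \<cdot> (f \<boxtimes> g)"
    and associator_iso: "\<lbrakk>X \<in> obj M; Y \<in> obj M; Z \<in> obj M\<rbrakk>
      \<Longrightarrow> invertible M ((X \<otimes> Y) \<otimes> Z) (X \<otimes> (Y \<otimes> Z)) (associator M X Y Z)"
    and associator_natural:
      "\<lbrakk>f \<in> hom M X X'; g \<in> hom M Y Y'; h \<in> hom M Z Z'\<rbrakk>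
      \<Longrightarrow> associator M X' Y' Z' \<cdot> ((f \<boxtimes> g) \<boxtimes> h) = (f \<boxtimes> (g \<boxtimes> h)) \<cdot> associator M X Y Z"
    and lunit_iso: "X \<in> obj M \<Longrightarrow> invertible M (tunit M \<otimes> X) X (lunit M X)"
    and lunit_natural: "f \<in> hom M X Y \<Longrightarrow> lunit M Y \<cdot> (ident M (tunit M) \<boxtimes> f) = f \<cdot> lunit M X"
    and runit_iso: "X \<in> obj M \<Longrightarrow> invertible M (X \<otimes> tunit M) X (runit M X)"
    and runit_natural: "f \<in> hom M X Y \<Longrightarrow> runit M Y \<cdot> (f \<boxtimes> ident M (tunit M)) = f \<cdot> runit M X"
    and pentagon: "\<lbrakk>W \<in> obj M; X \<in> obj M; Y \<in> obj M; Z \<in> obj M\<rbrakk>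
      \<Longrightarrow> (ident M W \<boxtimes> associator M X Y Z) \<cdot> associator M W (X \<otimes> Y) Z \<cdot>
            (associator M W X Y \<boxtimes> ident M Z)
          = associator M W X (Y \<otimes> Z) \<cdot> associator M (W \<otimes> X) Y Z"
    and triangle: "\<lbrakk>X \<in> obj M; Y \<in> obj M\<rbrakk>
      \<Longrightarrow> (ident M X \<boxtimes> lunit M Y) \<cdot> associator M X (tunit M) Y = runit M X \<boxtimes> ident M Y"


section \<open>Monoids, comonoids and twisted tensor products\<close>

record ('o, 'm) monoid_data =
  mcar :: 'o
  mmul :: 'm
  muni :: 'm

record ('o, 'm) comonoid_data =
  ccar :: 'o
  ccomul :: 'm
  ccounit :: 'm

context
  fixes M :: "('o, 'm, 'z) monoidal_data_scheme" (structure)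
begin

definition is_monoid :: "('o, 'm) monoid_data \<Rightarrow> bool" where
  "is_monoid A \<longleftrightarrow> (let X = mcar A; m = mmul A; u = muni A in
     X \<in> obj M \<and> m \<in> hom M (X \<otimes> X) X \<and> u \<in> hom M (tunit M) X \<and>
     m \<cdot> (m \<boxtimes> ident M X) = m \<cdot> (ident M X \<boxtimes> m) \<cdot> associator M X X X \<and>
     m \<cdot> (u \<boxtimes> ident M X) = lunit M X \<and>
     m \<cdot> (ident M X \<boxtimes> u) = runit M X)"

definition monoid_hom :: "('o, 'm) monoid_data \<Rightarrow> ('o, 'm) monoid_data \<Rightarrow> 'm \<Rightarrow> bool" where
  "monoid_hom A B f \<longleftrightarrow> is_monoid A \<and> is_monoid B \<and> f \<in> hom M (mcar A) (mcar B) \<and>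
     f \<cdot> mmul A = mmul B \<cdot> (f \<boxtimes> f) \<and> f \<cdot> muni A = muni B"

definition is_comonoid :: "('o, 'm) comonoid_data \<Rightarrow> bool" where
  "is_comonoid A \<longleftrightarrow> (let X = ccar A; d = ccomul A; e = ccounit A in
     X \<in> obj M \<and> d \<in> hom M X (X \<otimes> X) \<and> e \<in> hom M X (tunit M) \<and>
     associator M X X X \<cdot> (d \<boxtimes> ident M X) \<cdot> d = (ident M X \<boxtimes> d) \<cdot> d \<and>
     lunit M X \<cdot> (e \<boxtimes> ident M X) \<cdot> d = ident M X \<and>
     runit M X \<cdot> (ident M X \<boxtimes> e) \<cdot> d = ident M X)"

definition comonoid_hom :: "('o, 'm) comonoid_data \<Rightarrow> ('o, 'm) comonoid_data \<Rightarrow> 'm \<Rightarrow> bool" where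
  "comonoid_hom A B f \<longleftrightarrow> is_comonoid A \<and> is_comonoid B \<and> f \<in> hom M (ccar A) (ccar B) \<and>
     ccomul B \<cdot> f = (f \<boxtimes> f) \<cdot> ccomul A \<and> ccounit B \<cdot> f = ccounit A"

text \<open>\<open>twist_mul K H \<psi>\<close> is \<open>(m\<^sub>K \<otimes> m\<^sub>H) (K \<otimes> \<psi> \<otimes> H)\<close>, where the domain is bracketed as
  \<open>(K \<otimes> H) \<otimes> (K \<otimes> H)\<close> and the codomain of the second factor as \<open>(K \<otimes> K) \<otimes> (H \<otimes> H)\<close>.
  In \<open>twist_uni\<close>, \<open>lunit M (tunit M)\<close> is the canonical isomorphism of \<open>I \<otimes> I\<close> with \<open>I\<close>.\<close>

definition twist_mul :: "('o, 'm) monoid_data \<Rightarrow> ('o, 'm) monoid_data \<Rightarrow> 'm \<Rightarrow> 'm" where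
  "twist_mul K H \<psi> = (let X = mcar K; Y = mcar H in
     (mmul K \<boxtimes> mmul H) \<cdot>
     associator_inv M X X (Y \<otimes> Y) \<cdot>
     (ident M X \<boxtimes> associator M X Y Y) \<cdot>
     (ident M X \<boxtimes> (\<psi> \<boxtimes> ident M Y)) \<cdot>
     (ident M X \<boxtimes> associator_inv M Y X Y) \<cdot>
     associator M X Y (X \<otimes> Y))"

definition twist_uni :: "('o, 'm) monoid_data \<Rightarrow> ('o, 'm) monoid_data \<Rightarrow> 'm" where
  "twist_uni K H = (muni K \<boxtimes> muni H) \<cdot> lunit_inv M (tunit M)"

text \<open>\<open>twisting_equations H K \<psi>\<close>: compatibility of \<open>\<psi> : H \<otimes> K \<rightarrow> K \<otimes> H\<close> with \<open>m\<^sub>H\<close>, \<open>u\<^sub>H\<close>,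
  \<open>m\<^sub>K\<close> and \<open>u\<^sub>K\<close>, in this order.\<close>

definition twisting_equations ::
  "('o, 'm) monoid_data \<Rightarrow> ('o, 'm) monoid_data \<Rightarrow> 'm \<Rightarrow> bool" where
  "twisting_equations H K \<psi> \<longleftrightarrow> (let X = mcar K; Y = mcar H in
     \<psi> \<cdot> (mmul H \<boxtimes> ident M X)
       = (ident M X \<boxtimes> mmul H) \<cdot> associator M X Y Y \<cdot> (\<psi> \<boxtimes> ident M Y) \<cdot>
         associator_inv M Y X Y \<cdot> (ident M Y \<boxtimes> \<psi>) \<cdot> associator M Y Y X \<and>
     \<psi> \<cdot> (muni H \<boxtimes> ident M X) \<cdot> lunit_inv M X = (ident M X \<boxtimes> muni H) \<cdot> runit_inv M X \<and>
     \<psi> \<cdot> (ident M Y \<boxtimes> mmul K)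
       = (mmul K \<boxtimes> ident M Y) \<cdot> associator_inv M X X Y \<cdot> (ident M X \<boxtimes> \<psi>) \<cdot>
         associator M X Y X \<cdot> (\<psi> \<boxtimes> ident M X) \<cdot> associator_inv M Y X X \<and>
     \<psi> \<cdot> (ident M Y \<boxtimes> muni K) \<cdot> runit_inv M Y = (muni K \<boxtimes> ident M Y) \<cdot> lunit_inv M Y)"

definition twisting_morphism ::
  "('o, 'm) monoid_data \<Rightarrow> ('o, 'm) monoid_data \<Rightarrow> 'm \<Rightarrow> bool" where
  "twisting_morphism H K \<psi> \<longleftrightarrow>
     \<psi> \<in> hom M (mcar H \<otimes> mcar K) (mcar K \<otimes> mcar H) \<and> twisting_equations H K \<psi>"

definition is_twisted_tensor_product ::
  "('o, 'm) monoid_data \<Rightarrow> ('o, 'm) monoid_data \<Rightarrow> 'm \<Rightarrow> ('o, 'm) monoid_data \<Rightarrow> bool" where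
  "is_twisted_tensor_product H K \<psi> T \<longleftrightarrow>
     monoidal_category M \<and> is_monoid H \<and> is_monoid K \<and> twisting_morphism H K \<psi> \<and>
     T = \<lparr>mcar = mcar K \<otimes> mcar H, mmul = twist_mul K H \<psi>, muni = twist_uni K H\<rparr>"

end


section \<open>Duoidal categories\<close>

text \<open>The fields inherited from \<^typ>\<open>('o, 'm) monoidal_data\<close> describe the monoidal structure
  \<open>\<circ>\<close> with unit \<open>I\<close>; the fields added here describe the monoidal structure \<open>\<bullet>\<close> with unit \<open>J\<close>
  and the compatibility data. The tensor product \<open>\<bullet>\<close> of arrows is written \<open>f \<odot> g\<close>. The single
  field \<open>iota\<close> is the morphism \<open>\<epsilon>\<^sub>I = u\<^sub>J\<close> from \<open>I\<close> to \<open>J\<close>.\<close>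

record ('o, 'm) duoidal_data = "('o, 'm) monoidal_data" +
  btensor :: "'o \<Rightarrow> 'o \<Rightarrow> 'o"  (infixr "\<bullet>\<index>" 70)
  btensor_arr :: "'m \<Rightarrow> 'm \<Rightarrow> 'm"  (infixr "\<odot>\<index>" 70)
  bunit :: 'o
  bassociator :: "'o \<Rightarrow> 'o \<Rightarrow> 'o \<Rightarrow> 'm"
  blunit :: "'o \<Rightarrow> 'm"
  brunit :: "'o \<Rightarrow> 'm"
  zeta :: "'o \<Rightarrow> 'o \<Rightarrow> 'o \<Rightarrow> 'o \<Rightarrow> 'm"
  comulI :: 'm
  mulJ :: 'm
  iota :: 'm

definition bullet :: "('o, 'm, 'z) duoidal_data_scheme \<Rightarrow> ('o, 'm) monoidal_data" where
  "bullet D = \<lparr>obj = obj D, hom = hom D, ident = ident D, arrcomp = arrcomp D,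
     tensor = btensor D, tensor_arr = btensor_arr D, tunit = bunit D,
     associator = bassociator D, lunit = blunit D, runit = brunit D\<rparr>"

locale duoidal_category = monoidal_category D + bullet: monoidal_category "bullet D"
  for D :: "('o, 'm, 'z) duoidal_data_scheme" (structure) +
  assumes zeta_hom: "\<lbrakk>A \<in> obj D; B \<in> obj D; C \<in> obj D; E \<in> obj D\<rbrakk>
      \<Longrightarrow> zeta D A B C E \<in> hom D ((A \<bullet> B) \<otimes> (C \<bullet> E)) ((A \<otimes> C) \<bullet> (B \<otimes> E))"
    and zeta_natural:
      "\<lbrakk>f \<in> hom D A A'; g \<in> hom D B B'; h \<in> hom D C C'; k \<in> hom D E E'\<rbrakk>
      \<Longrightarrow> zeta D A' B' C' E' \<cdot> ((f \<odot> g) \<boxtimes> (h \<odot> k))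
          = ((f \<boxtimes> h) \<odot> (g \<boxtimes> k)) \<cdot> zeta D A B C E"
    and monoid_J: "is_monoid D \<lparr>mcar = bunit D, mmul = mulJ D, muni = iota D\<rparr>"
    and comonoid_I: "is_comonoid (bullet D) \<lparr>ccar = tunit D, ccomul = comulI D, ccounit = iota D\<rparr>"
    and zeta_assoc_circ:
      "\<lbrakk>A \<in> obj D; B \<in> obj D; C \<in> obj D; E \<in> obj D; F \<in> obj D; G \<in> obj D\<rbrakk>
      \<Longrightarrow> zeta D A B (C \<otimes> F) (E \<otimes> G) \<cdot> (ident D (A \<bullet> B) \<boxtimes> zeta D C E F G) \<cdot>
            associator D (A \<bullet> B) (C \<bullet> E) (F \<bullet> G)
          = (associator D A C F \<odot> associator D B E G) \<cdot>
            zeta D (A \<otimes> C) (B \<otimes> E) F G \<cdot> (zeta D A B C E \<boxtimes> ident D (F \<bullet> G))"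
    and zeta_assoc_bullet:
      "\<lbrakk>A \<in> obj D; B \<in> obj D; C \<in> obj D; E \<in> obj D; F \<in> obj D; G \<in> obj D\<rbrakk>
      \<Longrightarrow> (ident D (A \<otimes> E) \<odot> zeta D B C F G) \<cdot> zeta D A (B \<bullet> C) E (F \<bullet> G) \<cdot>
            (bassociator D A B C \<boxtimes> bassociator D E F G)
          = bassociator D (A \<otimes> E) (B \<otimes> F) (C \<otimes> G) \<cdot>
            (zeta D A B E F \<odot> ident D (C \<otimes> G)) \<cdot> zeta D (A \<bullet> B) C (E \<bullet> F) G"
    and zeta_lunit_circ: "\<lbrakk>A \<in> obj D; B \<in> obj D\<rbrakk>
      \<Longrightarrow> (lunit D A \<odot> lunit D B) \<cdot> zeta D (tunit D) (tunit D) A B \<cdot>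
            (comulI D \<boxtimes> ident D (A \<bullet> B)) = lunit D (A \<bullet> B)"
    and zeta_runit_circ: "\<lbrakk>A \<in> obj D; B \<in> obj D\<rbrakk>
      \<Longrightarrow> (runit D A \<odot> runit D B) \<cdot> zeta D A B (tunit D) (tunit D) \<cdot>
            (ident D (A \<bullet> B) \<boxtimes> comulI D) = runit D (A \<bullet> B)"
    and zeta_lunit_bullet: "\<lbrakk>A \<in> obj D; B \<in> obj D\<rbrakk>
      \<Longrightarrow> blunit D (A \<otimes> B) \<cdot> (mulJ D \<odot> ident D (A \<otimes> B)) \<cdot> zeta D (bunit D) A (bunit D) B
          = blunit D A \<boxtimes> blunit D B"
    and zeta_runit_bullet: "\<lbrakk>A \<in> obj D; B \<in> obj D\<rbrakk>
      \<Longrightarrow> brunit D (A \<otimes> B) \<cdot> (ident D (A \<otimes> B) \<odot> mulJ D) \<cdot> zeta D A (bunit D) B (bunit D)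
          = brunit D A \<boxtimes> brunit D B"


section \<open>Bimonoids and the category of comonoids\<close>

record ('o, 'm) bimonoid_data =
  car :: 'o
  mul :: 'm
  uni :: 'm
  comul :: 'm
  counit :: 'm

definition monoid_of :: "('o, 'm) bimonoid_data \<Rightarrow> ('o, 'm) monoid_data" where
  "monoid_of B = \<lparr>mcar = car B, mmul = mul B, muni = uni B\<rparr>"

definition comonoid_of :: "('o, 'm) bimonoid_data \<Rightarrow> ('o, 'm) comonoid_data" where
  "comonoid_of B = \<lparr>ccar = car B, ccomul = comul B, ccounit = counit B\<rparr>"

text \<open>The data of a bimonoid regarded as a monoid whose carrier is its underlying comonoid.\<close>

definition comon_monoid_of ::
  "('o, 'm) bimonoid_data \<Rightarrow> (('o, 'm) comonoid_data, 'm) monoid_data" where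
  "comon_monoid_of B = \<lparr>mcar = comonoid_of B, mmul = mul B, muni = uni B\<rparr>"

context
  fixes D :: "('o, 'm, 'z) duoidal_data_scheme" (structure)
begin

definition is_bimonoid :: "('o, 'm) bimonoid_data \<Rightarrow> bool" where
  "is_bimonoid B \<longleftrightarrow> (let H = car B in
     is_monoid D (monoid_of B) \<and> is_comonoid (bullet D) (comonoid_of B) \<and>
     comul B \<cdot> mul B = (mul B \<odot> mul B) \<cdot> zeta D H H H H \<cdot> (comul B \<boxtimes> comul B) \<and>
     counit B \<cdot> mul B = mulJ D \<cdot> (counit B \<boxtimes> counit B) \<and>
     comul B \<cdot> uni B = (uni B \<odot> uni B) \<cdot> comulI D \<and>
     counit B \<cdot> uni B = iota D)"

definition bimonoid_hom :: "('o, 'm) bimonoid_data \<Rightarrow> ('o, 'm) bimonoid_data \<Rightarrow> 'm \<Rightarrow> bool" where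
  "bimonoid_hom A B f \<longleftrightarrow> is_bimonoid A \<and> is_bimonoid B \<and>
     monoid_hom D (monoid_of A) (monoid_of B) f \<and>
     comonoid_hom (bullet D) (comonoid_of A) (comonoid_of B) f"

definition Bimon :: "(('o, 'm) bimonoid_data, 'm) category_data" where
  "Bimon = \<lparr>obj = {B. is_bimonoid B}, hom = (\<lambda>A B. {f. bimonoid_hom A B f}),
     ident = (\<lambda>B. ident D (car B)), arrcomp = arrcomp D\<rparr>"

definition comonoid_tensor ::
  "('o, 'm) comonoid_data \<Rightarrow> ('o, 'm) comonoid_data \<Rightarrow> ('o, 'm) comonoid_data" where
  "comonoid_tensor A B = \<lparr>ccar = ccar A \<otimes> ccar B,
     ccomul = zeta D (ccar A) (ccar A) (ccar B) (ccar B) \<cdot> (ccomul A \<boxtimes> ccomul B),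
     ccounit = mulJ D \<cdot> (ccounit A \<boxtimes> ccounit B)\<rparr>"

definition Comon :: "(('o, 'm) comonoid_data, 'm) monoidal_data" where
  "Comon = \<lparr>obj = {A. is_comonoid (bullet D) A},
     hom = (\<lambda>A B. {f. comonoid_hom (bullet D) A B f}),
     ident = (\<lambda>A. ident D (ccar A)), arrcomp = arrcomp D,
     tensor = comonoid_tensor, tensor_arr = tensor_arr D,
     tunit = \<lparr>ccar = tunit D, ccomul = comulI D, ccounit = iota D\<rparr>,
     associator = (\<lambda>A B C. associator D (ccar A) (ccar B) (ccar C)),
     lunit = (\<lambda>A. lunit D (ccar A)), runit = (\<lambda>A. runit D (ccar A))\<rparr>"

definition twisted_bimonoid ::
  "('o, 'm) bimonoid_data \<Rightarrow> ('o, 'm) bimonoid_data \<Rightarrow> 'm \<Rightarrow> ('o, 'm) bimonoid_data" where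
  "twisted_bimonoid K H \<psi> = \<lparr>car = car K \<otimes> car H,
     mul = twist_mul D (monoid_of K) (monoid_of H) \<psi>,
     uni = twist_uni D (monoid_of K) (monoid_of H),
     comul = zeta D (car K) (car K) (car H) (car H) \<cdot> (comul K \<boxtimes> comul H),
     counit = mulJ D \<cdot> (counit K \<boxtimes> counit H)\<rparr>"

end

end

theory Submission
  imports Defs
begin

text \<open>A bimonoid is a monoid in the monoidal category of comonoids in \<open>(C, \<bullet>, J)\<close>, so both parts reduce
  to statements about monoids in an arbitrary monoidal category: \<open>m\<^sub>A (i \<otimes> j)\<close> transports the
  multiplication of \<open>A\<close> to the twisted one, and the twisted multiplication is associative and unital
  iff \<open>\<psi>\<close> obeys the four twisting equations. That \<open>\<psi>\<close> is then a morphism of comonoids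
  holds because \<open>\<psi> = m (u\<^sub>K \<otimes> H \<otimes> K \<otimes> u\<^sub>H)\<close> is a composite of such morphisms.

  The monoidal arguments are string diagram computations. Coherence is disposed of once by letting
  an arrow \<open>f : X \<rightarrow> Y\<close> act as the natural transformation \<open>X \<otimes> _ \<rightarrow> Y \<otimes> _\<close>: composites of the functors
  \<open>X \<otimes> _\<close> are strictly associative, and evaluation at \<open>I\<close> recovers the arrow.\<close>

section \<open>Isomorphisms and Kelly's unit lemma\<close>

text \<open>The obstacle is that associators and unit constraints are explicit arrows, while the
  identities to be proved involve up to six tensor factors. Once bracketed words are normalised in
  front of an arbitrary tail object, each constraint and its inverse act trivially. They are
  represented by the empty diagram, and an equation of arrows becomes an equation between lists of
  boxes, rewritten by the monoid laws and by exchanging adjacent boxes on disjoint strings. The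
  passage between arrows and lists has to be an equivalence, because hypotheses are translated as
  well as conclusions.

  For equations, passing to comonoids is cheap: \<open>Comon D\<close> has the arrows and
  composition of \<open>D\<close>. The price is membership: the constraints, their inverses and the
  inverse of \<open>\<phi>\<close> must be comonoid morphisms, and \<open>inv_arr\<close> must give
  the same arrow in both categories. In part (b) \<open>\<psi>\<close> is at first only an arrow of
  \<open>D\<close>, so it is expressed through the multiplication there before the result on monoids
  can be applied in \<open>Comon D\<close>.\<close>

context category
begin

lemma inverse_arrows_unique:
  assumes "inverse_arrows C X Y f g" "inverse_arrows C X Y f g'"
  shows "g = g'"
proof -
  have f: "f \<in> hom C X Y" and g: "g \<in> hom C Y X" and g': "g' \<in> hom C Y X"
    and gf: "g \<cdot> f = ident C X" and fg: "f \<cdot> g' = ident C Y"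
    using assms by (auto simp: inverse_arrows_def)
  have "g = g \<cdot> f \<cdot> g'" using comp_ident_right[OF g] fg by simp
  also have "\<dots> = g'" using comp_assoc[OF g' f g] gf comp_ident_left[OF g'] by simp
  finally show ?thesis .
qed

lemma inv_arr_eqI: "inverse_arrows C X Y f g \<Longrightarrow> inv_arr C X Y f = g"
  unfolding inv_arr_def by (rule the_equality) (auto dest: inverse_arrows_unique)

lemma inverse_arrows_inv_arr:
  "invertible C X Y f \<Longrightarrow> inverse_arrows C X Y f (inv_arr C X Y f)"
  using inv_arr_eqI by (auto simp: invertible_def)

lemma invertible_hom: "invertible C X Y f \<Longrightarrow> f \<in> hom C X Y"
  by (auto simp: invertible_def inverse_arrows_def)

lemma inv_arr_hom: "invertible C X Y f \<Longrightarrow> inv_arr C X Y f \<in> hom C Y X"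
  and inv_arr_left: "invertible C X Y f \<Longrightarrow> inv_arr C X Y f \<cdot> f = ident C X"
  and inv_arr_right: "invertible C X Y f \<Longrightarrow> f \<cdot> inv_arr C X Y f = ident C Y"
  using inverse_arrows_inv_arr by (auto simp: inverse_arrows_def)

lemma inv_arr_left_comp:
  assumes f: "invertible C X Y f" and h: "h \<in> hom C W X"
  shows "inv_arr C X Y f \<cdot> f \<cdot> h = h"
  using comp_assoc[OF h invertible_hom[OF f] inv_arr_hom[OF f]] inv_arr_left[OF f]
    comp_ident_left[OF h] by metis

lemma inv_arr_right_comp:
  assumes f: "invertible C X Y f" and h: "h \<in> hom C W Y"
  shows "f \<cdot> inv_arr C X Y f \<cdot> h = h"
  using comp_assoc[OF h inv_arr_hom[OF f] invertible_hom[OF f]] inv_arr_right[OF f]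
    comp_ident_left[OF h] by metis

lemma invertible_cancel_left:
  "\<lbrakk>invertible C X Y f; a \<in> hom C W X; b \<in> hom C W X; f \<cdot> a = f \<cdot> b\<rbrakk> \<Longrightarrow> a = b"
  by (metis inv_arr_left_comp)

lemma invertible_cancel_right:
  assumes f: "invertible C X Y f" and a: "a \<in> hom C Y Z" and b: "b \<in> hom C Y Z"
    and eq: "a \<cdot> f = b \<cdot> f"
  shows "a = b"
  using comp_assoc[OF inv_arr_hom[OF f] invertible_hom[OF f] a]
    comp_assoc[OF inv_arr_hom[OF f] invertible_hom[OF f] b]
    inv_arr_right[OF f] comp_ident_right[OF a] comp_ident_right[OF b] eq by metis

lemma invertibleI:
  "\<lbrakk>f \<in> hom C X Y; g \<in> hom C Y X; g \<cdot> f = ident C X; f \<cdot> g = ident C Y\<rbrakk> \<Longrightarrow> invertible C X Y f"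
  by (auto simp: invertible_def inverse_arrows_def)

lemma invertible_ident: "X \<in> obj C \<Longrightarrow> invertible C X X (ident C X)"
  using invertibleI ident_hom comp_ident_left by blast

lemma invertible_comp:
  assumes f: "invertible C X Y f" and g: "invertible C Y Z g"
  shows "invertible C X Z (g \<cdot> f)"
proof -
  let ?f = "inv_arr C X Y f" and ?g = "inv_arr C Y Z g"
  note h = invertible_hom[OF f] invertible_hom[OF g] inv_arr_hom[OF f] inv_arr_hom[OF g]
  show ?thesis
  proof (rule invertibleI)
    show "g \<cdot> f \<in> hom C X Z" "?f \<cdot> ?g \<in> hom C Z X" using h comp_hom by blast+
    show "(?f \<cdot> ?g) \<cdot> g \<cdot> f = ident C X"
      using comp_assoc[OF comp_hom[OF h(1,2)] h(4,3)] inv_arr_left_comp[OF g h(1)] inv_arr_left[OF f]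
      by simp
    show "(g \<cdot> f) \<cdot> ?f \<cdot> ?g = ident C Z"
      using comp_assoc[OF comp_hom[OF h(4,3)] h(1,2)] inv_arr_right_comp[OF f h(4)] inv_arr_right[OF g]
      by simp
  qed
qed

text \<open>Equations between composites, extended by a generalised element, so that chains of arrows
  can always be kept bracketed to the right.\<close>

lemma comp_extend:
  assumes "g \<cdot> f = k" "f \<in> hom C X Y" "g \<in> hom C Y Z" "x \<in> hom C W X"
  shows "g \<cdot> f \<cdot> x = k \<cdot> x"
  using comp_assoc[OF assms(4,2,3)] assms(1) by simp

lemma comp_extend2:
  assumes "g \<cdot> f = k \<cdot> h" "f \<in> hom C X Y" "g \<in> hom C Y Z" "h \<in> hom C X Y'" "k \<in> hom C Y' Z"
    "x \<in> hom C W X"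
  shows "g \<cdot> f \<cdot> x = k \<cdot> h \<cdot> x"
  using comp_assoc[OF assms(6,2,3)] comp_assoc[OF assms(6,4,5)] assms(1) by simp

end


section \<open>Tensor calculus and the left unit constraint of a tensor product\<close>

context monoidal_category
begin

lemmas homs = comp_hom tensor_hom ident_hom tensor_obj tunit_obj
  invertible_hom[OF associator_iso] invertible_hom[OF lunit_iso] invertible_hom[OF runit_iso]

lemma hom_objs: "f \<in> hom M X Y \<Longrightarrow> X \<in> obj M" "f \<in> hom M X Y \<Longrightarrow> Y \<in> obj M"
  using hom_obj by auto

lemma invertible_tensor:
  assumes f: "invertible M X X' f" and g: "invertible M Y Y' g"
  shows "invertible M (X \<otimes> Y) (X' \<otimes> Y') (f \<boxtimes> g)"
proof -
  let ?f = "inv_arr M X X' f" and ?g = "inv_arr M Y Y' g"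
  note h = invertible_hom[OF f] invertible_hom[OF g] inv_arr_hom[OF f] inv_arr_hom[OF g]
  show ?thesis
    using h hom_objs[OF h(1)] hom_objs[OF h(2)]
    by (intro invertibleI[of _ _ _ "?f \<boxtimes> ?g"])
      (auto intro: tensor_hom simp: interchange[symmetric] tensor_ident inv_arr_left[OF f]
        inv_arr_left[OF g] inv_arr_right[OF f] inv_arr_right[OF g])
qed

lemma tensor_comp_left:
  assumes X: "X \<in> obj M" and "f \<in> hom M Y Y'" "g \<in> hom M Y' Y''"
  shows "ident M X \<boxtimes> (g \<cdot> f) = (ident M X \<boxtimes> g) \<cdot> (ident M X \<boxtimes> f)"
  using interchange[OF ident_hom[OF X] ident_hom[OF X] assms(2,3)] comp_ident_left[OF ident_hom[OF X]]
  by simp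

lemma tensor_comp_right:
  assumes X: "X \<in> obj M" and "f \<in> hom M Y Y'" "g \<in> hom M Y' Y''"
  shows "(g \<cdot> f) \<boxtimes> ident M X = (g \<boxtimes> ident M X) \<cdot> (f \<boxtimes> ident M X)"
  using interchange[OF assms(2,3) ident_hom[OF X] ident_hom[OF X]] comp_ident_left[OF ident_hom[OF X]]
  by simp

lemma tensor_split:
  assumes "f \<in> hom M X X'" "g \<in> hom M Y Y'"
  shows "(ident M X' \<boxtimes> g) \<cdot> (f \<boxtimes> ident M Y) = f \<boxtimes> g"
    and "(f \<boxtimes> ident M Y') \<cdot> (ident M X \<boxtimes> g) = f \<boxtimes> g"
proof -
  note o = hom_objs[OF assms(1)] hom_objs[OF assms(2)]
  show "(ident M X' \<boxtimes> g) \<cdot> (f \<boxtimes> ident M Y) = f \<boxtimes> g"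
    using interchange[OF assms(1) ident_hom ident_hom assms(2)] o
      comp_ident_left[OF assms(1)] comp_ident_right[OF assms(2)] by simp
  show "(f \<boxtimes> ident M Y') \<cdot> (ident M X \<boxtimes> g) = f \<boxtimes> g"
    using interchange[OF ident_hom assms(1) assms(2) ident_hom] o
      comp_ident_right[OF assms(1)] comp_ident_left[OF assms(2)] by simp
qed

text \<open>\<open>lunit\<close> is a natural isomorphism from tensoring with I to the identity
  functor, so tensoring with I is faithful.\<close>

lemma tensor_unit_left_cancel:
  assumes f: "f \<in> hom M X Y" and g: "g \<in> hom M X Y"
    and eq: "ident M (tunit M) \<boxtimes> f = ident M (tunit M) \<boxtimes> g"
  shows "f = g"
  using invertible_cancel_right[OF lunit_iso f g] lunit_natural[OF f] lunit_natural[OF g] eq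
    hom_objs[OF f] by simp

lemma tensor_unit_right_cancel:
  assumes f: "f \<in> hom M X Y" and g: "g \<in> hom M X Y"
    and eq: "f \<boxtimes> ident M (tunit M) = g \<boxtimes> ident M (tunit M)"
  shows "f = g"
  using invertible_cancel_right[OF runit_iso f g] runit_natural[OF f] runit_natural[OF g] eq
    hom_objs[OF f] by simp

text \<open>Kelly's redundancy of this unit axiom: tensor with \<open>I\<close> on the left and use the pentagon.\<close>

lemma lunit_tensor:
  assumes X: "X \<in> obj M" and Y: "Y \<in> obj M"
  shows "lunit M (X \<otimes> Y) \<cdot> associator M (tunit M) X Y = lunit M X \<boxtimes> ident M Y"
proof -
  let ?I = "tunit M" and ?a = "associator M"
  note I = tunit_obj
  note hs = homs I X Y
  \<comment> \<open>Two edges of the pentagon for I, I, X, Y. Precomposition with them makes the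
    pentagon and the triangle applicable; being invertible, they are cancelled at the end.\<close>
  let ?e = "?a ?I (?I \<otimes> X) Y \<cdot> (?a ?I ?I X \<boxtimes> ident M Y)"
  have e: "invertible M (((?I \<otimes> ?I) \<otimes> X) \<otimes> Y) (?I \<otimes> ((?I \<otimes> X) \<otimes> Y)) ?e"
    by (rule invertible_comp[OF invertible_tensor associator_iso])
      (rule associator_iso invertible_ident hs)+
  have l: "lunit M (X \<otimes> Y) \<cdot> ?a ?I X Y \<in> hom M ((?I \<otimes> X) \<otimes> Y) (X \<otimes> Y)" by (rule hs)+
  have l': "lunit M X \<boxtimes> ident M Y \<in> hom M ((?I \<otimes> X) \<otimes> Y) (X \<otimes> Y)" by (rule hs)+
  have "(ident M ?I \<boxtimes> (lunit M (X \<otimes> Y) \<cdot> ?a ?I X Y)) \<cdot> ?e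
      = (ident M ?I \<boxtimes> lunit M (X \<otimes> Y)) \<cdot> (ident M ?I \<boxtimes> ?a ?I X Y) \<cdot> ?e"
    by (subst tensor_comp_left) (rule comp_assoc hs)+
  also have "\<dots> = (ident M ?I \<boxtimes> lunit M (X \<otimes> Y)) \<cdot> ?a ?I ?I (X \<otimes> Y) \<cdot> ?a (?I \<otimes> ?I) X Y"
    using pentagon[OF I I X Y] by simp
  also have "\<dots> = (runit M ?I \<boxtimes> ident M (X \<otimes> Y)) \<cdot> ?a (?I \<otimes> ?I) X Y"
    by (rule comp_extend[OF triangle]) (rule hs)+
  also have "\<dots> = ?a ?I X Y \<cdot> ((runit M ?I \<boxtimes> ident M X) \<boxtimes> ident M Y)"
    using associator_natural[OF invertible_hom[OF runit_iso[OF I]] ident_hom[OF X] ident_hom[OF Y]]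
    by (simp add: tensor_ident X Y)
  also have "\<dots> = ?a ?I X Y \<cdot> (((ident M ?I \<boxtimes> lunit M X) \<cdot> ?a ?I ?I X) \<boxtimes> ident M Y)"
    using triangle[OF I X] by simp
  also have "\<dots> = ?a ?I X Y \<cdot> ((ident M ?I \<boxtimes> lunit M X) \<boxtimes> ident M Y) \<cdot> (?a ?I ?I X \<boxtimes> ident M Y)"
    by (subst tensor_comp_right) (rule refl hs)+
  also have "\<dots> = (ident M ?I \<boxtimes> (lunit M X \<boxtimes> ident M Y)) \<cdot> ?e"
    by (rule comp_extend2[OF associator_natural]) (rule hs)+
  finally have "ident M ?I \<boxtimes> (lunit M (X \<otimes> Y) \<cdot> ?a ?I X Y) = ident M ?I \<boxtimes> (lunit M X \<boxtimes> ident M Y)"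
    by (rule invertible_cancel_right[OF e, rotated 2]) (rule hs)+
  then show ?thesis by (rule tensor_unit_left_cancel[OF l l'])
qed

end


section \<open>String diagrams in a monoidal category\<close>

text \<open>Formal tensor words. An object does not determine how it is to be split into strings, so
  the reading of the domain and codomain of an arrow is recorded separately, with its brackets and
  units.\<close>

datatype 'o bracketing = One | Var 'o | Prod "'o bracketing" "'o bracketing"

primrec leaves :: "'o bracketing \<Rightarrow> 'o list" where
  "leaves One = []"
| "leaves (Var X) = [X]"
| "leaves (Prod s t) = leaves s @ leaves t"

text \<open>A box with several input and output strings. It holds one arrow for each tail object,
  because diagrams act on right-nested products and a box must be applicable whatever stands to its
  right.\<close>

datatype ('o, 'm) cell = Cell (fam: "'o \<Rightarrow> 'm") (src: "'o list") (tgt: "'o list")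

text \<open>A layer \<open>(l, c, r)\<close> is the cell \<open>c\<close> with the identities of \<open>l\<close> on its left and of \<open>r\<close> on its
  right; the layers of a diagram are listed in order of application.\<close>

type_synonym ('o, 'm) diagram = "('o list \<times> ('o, 'm) cell \<times> 'o list) list"

definition within :: "'o list \<Rightarrow> ('o, 'm) diagram \<Rightarrow> 'o list \<Rightarrow> ('o, 'm) diagram" where
  "within l d r = map (\<lambda>(l', c, r'). (l @ l', c, r' @ r)) d"

lemma within_simps [simp]:
  "within l [] r = []"
  "within l ((l', c, r') # d) r = (l @ l', c, r' @ r) # within l d r"
  "within l (d @ e) r = within l d r @ within l e r"
  by (simp_all add: within_def)

text \<open>Separates the two extensions, which behave differently under the action on nested
  products: extension on the right only changes the tail object, extension on the left tensors with
  identities.\<close>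

lemma within_split: "within l d r = within l (within [] d r) []"
  by (induction d) auto

section \<open>Normalisation of tensor words, and the action of diagrams on nested products\<close>

context monoidal_category
begin

primrec tensor_of :: "'o bracketing \<Rightarrow> 'o" where
  "tensor_of One = tunit M"
| "tensor_of (Var X) = X"
| "tensor_of (Prod s t) = tensor_of s \<otimes> tensor_of t"

primrec nest :: "'o list \<Rightarrow> 'o \<Rightarrow> 'o" where
  "nest [] Z = Z"
| "nest (X # xs) Z = X \<otimes> nest xs Z"

primrec whisker :: "'o list \<Rightarrow> 'm \<Rightarrow> 'm" where
  "whisker [] f = f"
| "whisker (X # xs) f = ident M X \<boxtimes> whisker xs f"

text \<open>The canonical isomorphism from \<open>tensor_of s \<otimes> Z\<close> to
  \<open>nest (leaves s) Z\<close> that removes units and brackets. Carrying the tail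
  \<open>Z\<close> makes the clause for \<open>Prod\<close> a plain composite: the normal form of
  the right factor is the tail for the left one.\<close>

primrec nf :: "'o bracketing \<Rightarrow> 'o \<Rightarrow> 'm" where
  "nf One Z = lunit M Z"
| "nf (Var X) Z = ident M (X \<otimes> Z)"
| "nf (Prod s t) Z = nf s (nest (leaves t) Z) \<cdot> (ident M (tensor_of s) \<boxtimes> nf t Z) \<cdot>
     associator M (tensor_of s) (tensor_of t) Z"

lemma nest_append: "nest (xs @ ys) Z = nest xs (nest ys Z)"
  by (induction xs) auto

lemma whisker_append: "whisker (xs @ ys) f = whisker xs (whisker ys f)"
  by (induction xs) auto

lemma nest_obj: "\<lbrakk>set xs \<subseteq> obj M; Z \<in> obj M\<rbrakk> \<Longrightarrow> nest xs Z \<in> obj M"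
  by (induction xs) (auto intro: tensor_obj)

lemma whisker_hom:
  "\<lbrakk>set xs \<subseteq> obj M; f \<in> hom M Y Z\<rbrakk> \<Longrightarrow> whisker xs f \<in> hom M (nest xs Y) (nest xs Z)"
  by (induction xs) (auto intro: tensor_hom ident_hom)

lemma whisker_ident:
  "\<lbrakk>set xs \<subseteq> obj M; Z \<in> obj M\<rbrakk> \<Longrightarrow> whisker xs (ident M Z) = ident M (nest xs Z)"
  by (induction xs) (auto simp: tensor_ident nest_obj)

lemma whisker_comp:
  assumes "f \<in> hom M X Y" "g \<in> hom M Y Z"
  shows "set xs \<subseteq> obj M \<Longrightarrow> whisker xs (g \<cdot> f) = whisker xs g \<cdot> whisker xs f"
proof (induction xs)
  case (Cons W xs)
  then have "W \<in> obj M" "set xs \<subseteq> obj M" by auto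
  then show ?case
    using tensor_comp_left[OF _ whisker_hom[OF _ assms(1)] whisker_hom[OF _ assms(2)]] Cons.IH
    by simp
qed simp

lemma tensor_of_obj: "set (leaves s) \<subseteq> obj M \<Longrightarrow> tensor_of s \<in> obj M"
  by (induction s) (auto intro: tensor_obj tunit_obj)

lemma invertible_nf:
  "\<lbrakk>set (leaves s) \<subseteq> obj M; Z \<in> obj M\<rbrakk> \<Longrightarrow> invertible M (tensor_of s \<otimes> Z) (nest (leaves s) Z) (nf s Z)"
proof (induction s arbitrary: Z)
  case (Prod s t)
  then have o: "tensor_of s \<in> obj M" "tensor_of t \<in> obj M" "nest (leaves t) Z \<in> obj M"
    by (auto intro: tensor_of_obj nest_obj)
  have A: "invertible M (tensor_of s \<otimes> (tensor_of t \<otimes> Z)) (tensor_of s \<otimes> nest (leaves t) Z)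
     (ident M (tensor_of s) \<boxtimes> nf t Z)"
    using Prod o by (auto intro: invertible_tensor invertible_ident)
  then show ?case
    using Prod o invertible_comp[OF invertible_comp[OF associator_iso A]] by (auto simp: nest_append)
qed (auto intro: lunit_iso invertible_ident tensor_obj)

lemmas nf_hom = invertible_hom[OF invertible_nf]

lemma nf_natural:
  "\<lbrakk>set (leaves s) \<subseteq> obj M; k \<in> hom M Z Z'\<rbrakk>
    \<Longrightarrow> nf s Z' \<cdot> (ident M (tensor_of s) \<boxtimes> k) = whisker (leaves s) k \<cdot> nf s Z"
proof (induction s arbitrary: Z Z' k)
  case One
  then show ?case by (simp add: lunit_natural)
next
  case (Var X)
  then have "ident M X \<boxtimes> k \<in> hom M (X \<otimes> Z) (X \<otimes> Z')" by (auto intro: tensor_hom ident_hom)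
  then show ?case using comp_ident_left comp_ident_right by simp
next
  case (Prod s t)
  let ?S = "tensor_of s" and ?T = "tensor_of t" and ?t = "leaves t"
  have ls: "set (leaves s) \<subseteq> obj M" and lt: "set (leaves t) \<subseteq> obj M" using Prod.prems by auto
  note k = Prod.prems(2)
  note o = tensor_of_obj[OF ls] tensor_of_obj[OF lt] hom_objs[OF k] nest_obj[OF lt hom_objs(1)[OF k]]
    nest_obj[OF lt hom_objs(2)[OF k]]
  note hs = homs o k nf_hom[OF lt] nf_hom[OF ls] whisker_hom[OF lt] whisker_hom[OF ls]
  have "nf (Prod s t) Z' \<cdot> (ident M (?S \<otimes> ?T) \<boxtimes> k)
      = nf s (nest ?t Z') \<cdot> ((ident M ?S \<boxtimes> nf t Z') \<cdot> associator M ?S ?T Z') \<cdot> ((ident M ?S \<boxtimes> ident M ?T)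
        \<boxtimes> k)"
    by (simp add: tensor_ident o, rule comp_assoc) (rule hs)+
  also have "((ident M ?S \<boxtimes> nf t Z') \<cdot> associator M ?S ?T Z') \<cdot> ((ident M ?S \<boxtimes> ident M ?T) \<boxtimes> k)
     = (ident M ?S \<boxtimes> nf t Z') \<cdot> associator M ?S ?T Z' \<cdot> ((ident M ?S \<boxtimes> ident M ?T) \<boxtimes> k)"
    by (rule comp_assoc) (rule hs)+
  also have "associator M ?S ?T Z' \<cdot> ((ident M ?S \<boxtimes> ident M ?T) \<boxtimes> k)
     = (ident M ?S \<boxtimes> (ident M ?T \<boxtimes> k)) \<cdot> associator M ?S ?T Z"
    by (rule associator_natural) (rule hs)+
  also have "(ident M ?S \<boxtimes> nf t Z') \<cdot> (ident M ?S \<boxtimes> (ident M ?T \<boxtimes> k)) \<cdot> associator M ?S ?T Z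
     = (ident M ?S \<boxtimes> (whisker ?t k \<cdot> nf t Z)) \<cdot> associator M ?S ?T Z"
    unfolding Prod.IH(2)[OF lt k, symmetric]
    by (rule comp_extend[OF tensor_comp_left[symmetric]]) (rule hs)+
  also have "\<dots> = ((ident M ?S \<boxtimes> whisker ?t k) \<cdot> (ident M ?S \<boxtimes> nf t Z)) \<cdot> associator M ?S ?T Z"
    by (subst tensor_comp_left) (rule refl hs)+
  also have "\<dots> = (ident M ?S \<boxtimes> whisker ?t k) \<cdot> (ident M ?S \<boxtimes> nf t Z) \<cdot> associator M ?S ?T Z"
    by (rule comp_assoc) (rule hs)+
  also have "nf s (nest ?t Z') \<cdot> \<dots>
      = whisker (leaves s) (whisker ?t k) \<cdot> nf s (nest ?t Z) \<cdot> (ident M ?S \<boxtimes> nf t Z) \<cdot> associator M ?S ?T Z"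
    by (rule comp_extend2[OF Prod.IH(1)]) (rule hs ls)+
  finally show ?case by (simp add: whisker_append)
qed

text \<open>Naturality in the tail expresses that the box leaves the strings to its right alone; it
  is the source of the interchange law for diagrams.\<close>

definition valid_cell :: "('o, 'm) cell \<Rightarrow> bool" where
  "valid_cell c \<longleftrightarrow> set (src c) \<subseteq> obj M \<and> set (tgt c) \<subseteq> obj M \<and>
     (\<forall>Z \<in> obj M. fam c Z \<in> hom M (nest (src c) Z) (nest (tgt c) Z)) \<and>
     (\<forall>Z Z' k. k \<in> hom M Z Z' \<longrightarrow> fam c Z' \<cdot> whisker (src c) k = whisker (tgt c) k \<cdot> fam c Z)"

text \<open>Typing is kept apart from the data: diagrams are raw lists that can be rearranged by
  computation, and on concrete lists simplification decides whether they are well formed.\<close>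

fun path :: "('o, 'm) diagram \<Rightarrow> 'o list \<Rightarrow> 'o list \<Rightarrow> bool" where
  "path [] xs ys \<longleftrightarrow> xs = ys \<and> set xs \<subseteq> obj M"
| "path ((l, c, r) # d) xs ys \<longleftrightarrow>
     valid_cell c \<and> set (l @ r) \<subseteq> obj M \<and> xs = l @ src c @ r \<and> path d (l @ tgt c @ r) ys"

text \<open>\<open>act Z d h\<close> is the composite of the layers of \<open>d\<close>, tensored with \<open>Z\<close> on the right, applied to
  the generalised element \<open>h\<close>.\<close>

fun act :: "'o \<Rightarrow> ('o, 'm) diagram \<Rightarrow> 'm \<Rightarrow> 'm" where
  "act Z [] h = h"
| "act Z ((l, c, r) # d) h = act Z d (whisker l (fam c (nest r Z)) \<cdot> h)"

text \<open>Testing on the identity suffices, since the action commutes with precomposition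
  (\<open>act_comp\<close>); \<open>diag_eq_act\<close> extends the equation to every generalised
  element. All tails are needed, since extending a diagram on the right changes the tail.\<close>

definition diag_eq where
  "diag_eq xs ys d e \<longleftrightarrow> path d xs ys \<and> path e xs ys \<and>
     (\<forall>Z \<in> obj M. act Z d (ident M (nest xs Z)) = act Z e (ident M (nest xs Z)))"

lemma path_objs: "path d xs ys \<Longrightarrow> set xs \<subseteq> obj M \<and> set ys \<subseteq> obj M"
  by (induction d xs ys rule: path.induct) (auto simp: valid_cell_def)

lemma path_append: "\<lbrakk>path d xs ys; path e ys zs\<rbrakk> \<Longrightarrow> path (d @ e) xs zs"
  by (induction d xs ys rule: path.induct) auto

lemma path_within:
  "\<lbrakk>path d xs ys; set l \<subseteq> obj M; set r \<subseteq> obj M\<rbrakk> \<Longrightarrow> path (within l d r) (l @ xs @ r) (l @ ys @ r)"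
  by (induction d xs ys rule: path.induct) auto

lemma layer_hom:
  "\<lbrakk>valid_cell c; set l \<subseteq> obj M; set r \<subseteq> obj M; Z \<in> obj M\<rbrakk>
    \<Longrightarrow> whisker l (fam c (nest r Z)) \<in> hom M (nest (l @ src c @ r) Z) (nest (l @ tgt c @ r) Z)"
  by (auto simp: valid_cell_def nest_append intro!: whisker_hom nest_obj)

lemma act_hom:
  "\<lbrakk>path d xs ys; Z \<in> obj M; h \<in> hom M W (nest xs Z)\<rbrakk> \<Longrightarrow> act Z d h \<in> hom M W (nest ys Z)"
proof (induction d xs ys arbitrary: h rule: path.induct)
  case (2 l c r d xs ys)
  then show ?case using comp_hom[OF _ layer_hom, of h W l c r Z] by simp
qed simp

lemma act_append: "act Z (d @ e) h = act Z e (act Z d h)"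
  by (induction Z d h rule: act.induct) auto

lemma act_comp:
  "\<lbrakk>path d xs ys; Z \<in> obj M; a \<in> hom M W (nest xs Z); b \<in> hom M V W\<rbrakk>
    \<Longrightarrow> act Z d (a \<cdot> b) = act Z d a \<cdot> b"
proof (induction d xs ys arbitrary: a rule: path.induct)
  case (2 l c r d xs ys)
  let ?f = "whisker l (fam c (nest r Z))"
  have f: "?f \<in> hom M (nest xs Z) (nest (l @ tgt c @ r) Z)" using 2 layer_hom[of c l r Z] by simp
  have "act Z ((l, c, r) # d) (a \<cdot> b) = act Z d ((?f \<cdot> a) \<cdot> b)"
    using comp_assoc[OF 2(5,4) f] by simp
  also have "\<dots> = act Z d (?f \<cdot> a) \<cdot> b" using 2 comp_hom[OF 2(4) f] by simp
  finally show ?case by simp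
qed simp

lemma diag_eq_act:
  assumes "diag_eq xs ys d e" "Z \<in> obj M" "h \<in> hom M W (nest xs Z)"
  shows "act Z d h = act Z e h"
proof -
  have d: "path d xs ys" and e: "path e xs ys"
    and eq: "act Z d (ident M (nest xs Z)) = act Z e (ident M (nest xs Z))"
    using assms by (auto simp: diag_eq_def)
  note i = ident_hom[OF hom_objs(2)[OF assms(3)]]
  show ?thesis
    using act_comp[OF d assms(2) i assms(3)] act_comp[OF e assms(2) i assms(3)] eq
      comp_ident_left[OF assms(3)] by simp
qed

lemma diag_eqI:
  assumes "path d xs ys" "path e xs ys"
    and "\<And>Z W h. \<lbrakk>Z \<in> obj M; h \<in> hom M W (nest xs Z)\<rbrakk> \<Longrightarrow> act Z d h = act Z e h"
  shows "diag_eq xs ys d e"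
  using assms(1,2) assms(3)[OF _ ident_hom[OF nest_obj]] path_objs[OF assms(1)]
  by (simp add: diag_eq_def)

lemma diag_eq_sym: "diag_eq xs ys d e \<Longrightarrow> diag_eq xs ys e d"
  by (simp add: diag_eq_def)

lemma diag_eq_trans [trans]: "\<lbrakk>diag_eq xs ys d e; diag_eq xs ys e f\<rbrakk> \<Longrightarrow> diag_eq xs ys d f"
  by (simp add: diag_eq_def)

lemma act_within_right: "act Z (within [] d r) h = act (nest r Z) d h"
  by (induction d arbitrary: h) (auto simp: nest_append)

text \<open>The accumulated arrow \<open>a\<close> is part of the statement so that the induction
  can absorb one layer at a time into it, by functoriality of \<open>whisker\<close>.\<close>

lemma act_within_left:
  "\<lbrakk>path d xs ys; set l \<subseteq> obj M; Z \<in> obj M; a \<in> hom M W (nest xs Z); h \<in> hom M V (nest l W)\<rbrakk>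
    \<Longrightarrow> act Z (within l d []) (whisker l a \<cdot> h) = whisker l (act Z d a) \<cdot> h"
proof (induction d xs ys arbitrary: a rule: path.induct)
  case (2 l' c r d xs ys)
  let ?f = "whisker l' (fam c (nest r Z))"
  have f: "?f \<in> hom M (nest xs Z) (nest (l' @ tgt c @ r) Z)" using 2 layer_hom[of c l' r Z] by simp
  have "act Z (within l ((l', c, r) # d) []) (whisker l a \<cdot> h)
      = act Z (within l d []) (whisker l ?f \<cdot> whisker l a \<cdot> h)"
    by (simp add: whisker_append)
  also have "whisker l ?f \<cdot> whisker l a \<cdot> h = whisker l (?f \<cdot> a) \<cdot> h"
    by (rule comp_extend[OF whisker_comp[symmetric]]) (rule 2 f whisker_hom)+
  also have "act Z (within l d []) \<dots> = whisker l (act Z d (?f \<cdot> a)) \<cdot> h"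
    using 2 comp_hom[OF 2(5) f] by simp
  finally show ?case by simp
qed simp

text \<open>Strings on the right are dealt with by taking the given equation at the tail
  \<open>nest r Z\<close>, strings on the left by functoriality of \<open>whisker\<close>.\<close>

lemma diag_eq_within:
  assumes de: "diag_eq xs ys d e" and l: "set l \<subseteq> obj M" and r: "set r \<subseteq> obj M"
  shows "diag_eq (l @ xs @ r) (l @ ys @ r) (within l d r) (within l e r)"
proof (rule diag_eqI)
  have p: "path d xs ys" "path e xs ys" using de by (auto simp: diag_eq_def)
  show "path (within l d r) (l @ xs @ r) (l @ ys @ r)" "path (within l e r) (l @ xs @ r) (l @ ys @ r)"
    using p l r by (auto intro: path_within)
  have p': "path (within [] d r) (xs @ r) (ys @ r)" "path (within [] e r) (xs @ r) (ys @ r)"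
    using p r path_within[of _ xs ys "[]" r] by auto
  fix Z W h assume Z: "Z \<in> obj M" and h: "h \<in> hom M W (nest (l @ xs @ r) Z)"
  let ?i = "ident M (nest (xs @ r) Z)"
  have o: "set (xs @ r) \<subseteq> obj M" using path_objs[OF p'(1)] by simp
  have i: "?i \<in> hom M (nest (xs @ r) Z) (nest (xs @ r) Z)" using o Z by (auto intro!: ident_hom nest_obj)
  have h': "h \<in> hom M W (nest l (nest (xs @ r) Z))" using h by (simp add: nest_append)
  have wi: "whisker l ?i \<cdot> h = h"
    using whisker_ident[OF l nest_obj[OF o Z]] comp_ident_left[OF h'] by (simp only:)
  have "act Z (within l d r) h = whisker l (act Z (within [] d r) ?i) \<cdot> h"
    using act_within_left[OF p'(1) l Z i h'] wi within_split[of l d r] by metis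
  also have "act Z (within [] d r) ?i = act Z (within [] e r) ?i"
    using diag_eq_act[OF de nest_obj[OF r Z]] i by (simp add: act_within_right nest_append)
  also have "whisker l \<dots> \<cdot> h = act Z (within l e r) h"
    using act_within_left[OF p'(2) l Z i h'] wi within_split[of l e r] by metis
  finally show "act Z (within l d r) h = act Z (within l e r) h" .
qed

text \<open>The rewriting rule of the calculus: a subdiagram may be replaced between other layers
  and other strings.\<close>

lemma diag_eq_step:
  assumes de: "diag_eq xs ys d e" and a: "path a zs (l @ xs @ r)" and b: "path b (l @ ys @ r) ws"
  shows "diag_eq zs ws (a @ within l d r @ b) (a @ within l e r @ b)"
proof (rule diag_eqI)
  have lr: "set l \<subseteq> obj M" "set r \<subseteq> obj M" using path_objs[OF a] by auto
  note w = diag_eq_within[OF de lr]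
  show "path (a @ within l d r @ b) zs ws" "path (a @ within l e r @ b) zs ws"
    using w a b by (auto simp: diag_eq_def intro: path_append)
  fix Z W h assume Z: "Z \<in> obj M" and h: "h \<in> hom M W (nest zs Z)"
  show "act Z (a @ within l d r @ b) h = act Z (a @ within l e r @ b) h"
    using diag_eq_act[OF w Z act_hom[OF a Z h]] by (simp add: act_append)
qed

text \<open>This is the naturality of the left box \<open>a\<close> in its tail, taken at the arrow
  given by the strings \<open>m\<close> followed by the box \<open>b\<close>.\<close>

lemma diag_eq_interchange:
  assumes a: "valid_cell a" and b: "valid_cell b" and m: "set m \<subseteq> obj M"
  shows "diag_eq (src a @ m @ src b) (tgt a @ m @ tgt b)
    [([], a, m @ src b), (tgt a @ m, b, [])] [(src a @ m, b, []), ([], a, m @ tgt b)]"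
proof (rule diag_eqI)
  have o: "set (src a) \<subseteq> obj M" "set (tgt a) \<subseteq> obj M" "set (src b) \<subseteq> obj M" "set (tgt b) \<subseteq> obj M"
    using a b by (auto simp: valid_cell_def)
  then show "path [([], a, m @ src b), (tgt a @ m, b, [])] (src a @ m @ src b) (tgt a @ m @ tgt b)"
    "path [(src a @ m, b, []), ([], a, m @ tgt b)] (src a @ m @ src b) (tgt a @ m @ tgt b)"
    using a b m by auto
  fix Z W h assume Z: "Z \<in> obj M" and h: "h \<in> hom M W (nest (src a @ m @ src b) Z)"
  have fb: "fam b Z \<in> hom M (nest (src b) Z) (nest (tgt b) Z)" using b Z by (auto simp: valid_cell_def)
  have k: "whisker m (fam b Z) \<in> hom M (nest (m @ src b) Z) (nest (m @ tgt b) Z)"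
    using whisker_hom[OF m fb] by (simp add: nest_append)
  have fa: "fam a X \<in> hom M (nest (src a) X) (nest (tgt a) X)" if "X \<in> obj M" for X
    using a that by (auto simp: valid_cell_def)
  have nat: "whisker (tgt a) (whisker m (fam b Z)) \<cdot> fam a (nest (m @ src b) Z)
      = fam a (nest (m @ tgt b) Z) \<cdot> whisker (src a) (whisker m (fam b Z))"
    using a k by (auto simp: valid_cell_def)
  have h': "h \<in> hom M W (nest (src a) (nest (m @ src b) Z))" using h by (simp add: nest_append)
  have "whisker (tgt a) (whisker m (fam b Z)) \<cdot> fam a (nest (m @ src b) Z) \<cdot> h
      = fam a (nest (m @ tgt b) Z) \<cdot> whisker (src a) (whisker m (fam b Z)) \<cdot> h"
    by (rule comp_extend2[OF nat fa _ _ fa h']) (rule hom_objs[OF k] whisker_hom o k)+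
  then show "act Z [([], a, m @ src b), (tgt a @ m, b, [])] h
      = act Z [(src a @ m, b, []), ([], a, m @ tgt b)] h"
    by (simp add: whisker_append)
qed

text \<open>Up to normalisation of source and target, \<open>f\<close> acts on every tail as the
  diagram \<open>d\<close>. It is a relation, since one arrow can be read with respect to several
  tensor words.\<close>

definition denotes where
  "denotes f s t d \<longleftrightarrow> f \<in> hom M (tensor_of s) (tensor_of t) \<and> path d (leaves s) (leaves t) \<and>
     (\<forall>Z \<in> obj M. nf t Z \<cdot> (f \<boxtimes> ident M Z) = act Z d (nf s Z))"

lemma denotes_comp:
  assumes f: "denotes f s t d" and g: "denotes g t u e"
  shows "denotes (g \<cdot> f) s u (d @ e)"
  unfolding denotes_def
proof (intro conjI ballI)
  have h: "f \<in> hom M (tensor_of s) (tensor_of t)" "g \<in> hom M (tensor_of t) (tensor_of u)"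
    and p: "path d (leaves s) (leaves t)" "path e (leaves t) (leaves u)"
    using f g by (auto simp: denotes_def)
  show "g \<cdot> f \<in> hom M (tensor_of s) (tensor_of u)" by (rule comp_hom[OF h])
  show "path (d @ e) (leaves s) (leaves u)" by (rule path_append[OF p])
  fix Z assume Z: "Z \<in> obj M"
  have l: "set (leaves t) \<subseteq> obj M" "set (leaves u) \<subseteq> obj M" using path_objs[OF p(2)] by auto
  have fZ: "f \<boxtimes> ident M Z \<in> hom M (tensor_of s \<otimes> Z) (tensor_of t \<otimes> Z)"
    using h Z by (auto intro: tensor_hom ident_hom)
  have "nf u Z \<cdot> ((g \<cdot> f) \<boxtimes> ident M Z) = nf u Z \<cdot> (g \<boxtimes> ident M Z) \<cdot> (f \<boxtimes> ident M Z)"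
    by (subst tensor_comp_right) (rule refl h Z)+
  also have "\<dots> = act Z e (nf t Z) \<cdot> (f \<boxtimes> ident M Z)"
    using g Z by (intro comp_extend[OF _ tensor_hom[OF h(2) ident_hom[OF Z]] nf_hom[OF l(2) Z] fZ])
      (simp add: denotes_def)
  also have "\<dots> = act Z e (nf t Z \<cdot> (f \<boxtimes> ident M Z))"
    by (rule act_comp[symmetric, OF p(2) Z nf_hom[OF l(1) Z] fZ])
  also have "nf t Z \<cdot> (f \<boxtimes> ident M Z) = act Z d (nf s Z)" using f Z by (simp add: denotes_def)
  finally show "nf u Z \<cdot> ((g \<cdot> f) \<boxtimes> ident M Z) = act Z (d @ e) (nf s Z)" by (simp add: act_append)
qed

text \<open>Convention: all layers of the left factor come before those of the right factor. The
  opposite order would differ by interchange; this choice fixes the shape of the lists in the later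
  diagram equations.\<close>

lemma denotes_tensor:
  assumes f: "denotes f s t d" and g: "denotes g s' t' e"
  shows "denotes (f \<boxtimes> g) (Prod s s') (Prod t t') (within [] d (leaves s') @ within (leaves t) e [])"
  unfolding denotes_def
proof (intro conjI ballI)
  have hf: "f \<in> hom M (tensor_of s) (tensor_of t)" and hg: "g \<in> hom M (tensor_of s') (tensor_of t')"
    and pd: "path d (leaves s) (leaves t)" and pe: "path e (leaves s') (leaves t')"
    using f g by (auto simp: denotes_def)
  show "f \<boxtimes> g \<in> hom M (tensor_of (Prod s s')) (tensor_of (Prod t t'))"
    using tensor_hom[OF hf hg] by simp
  have ls: "set (leaves s) \<subseteq> obj M" "set (leaves t) \<subseteq> obj M" "set (leaves s') \<subseteq> obj M" "set (leaves t') \<subseteq>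
    obj M"
    using path_objs[OF pd] path_objs[OF pe] by auto
  show "path (within [] d (leaves s') @ within (leaves t) e []) (leaves (Prod s s')) (leaves (Prod t t'))"
    using path_within[OF pd _ ls(3), of "[]"] path_within[OF pe ls(2), of "[]"]
    by (auto intro: path_append)
  fix Z assume Z: "Z \<in> obj M"
  let ?S = "tensor_of s" and ?T = "tensor_of t" and ?S' = "tensor_of s'" and ?T' = "tensor_of t'"
  let ?N = "nest (leaves s') Z" and ?N' = "nest (leaves t') Z" and ?a = "associator M ?S ?S' Z"
  have o: "?S \<in> obj M" "?T \<in> obj M" "?S' \<in> obj M" "?T' \<in> obj M" "?N \<in> obj M" "?N' \<in> obj M"
    using hom_objs[OF hf] hom_objs[OF hg] nest_obj ls Z by auto
  \<comment> \<open>\<open>E\<close> is the effect of the whole of \<open>e\<close> as a single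
    arrow between tails, so naturality of \<open>nf\<close> can move it past the normalisation of
    \<open>t\<close>.\<close>
  define E where "E = act Z e (ident M ?N)"
  have hE: "E \<in> hom M ?N ?N'" unfolding E_def by (rule act_hom[OF pe Z ident_hom[OF o(5)]])
  have eE: "act Z e h = E \<cdot> h" if "h \<in> hom M W ?N" for h W
    using act_comp[OF pe Z ident_hom[OF o(5)] that] comp_ident_left[OF that] by (simp add: E_def)
  note nfs = nf_hom[OF ls(1)] nf_hom[OF ls(2)] nf_hom[OF ls(3)] nf_hom[OF ls(4)]
  note hs = homs o Z hf hg hE nfs whisker_hom[OF ls(2)]
  have "(ident M ?T \<boxtimes> nf t' Z) \<cdot> associator M ?T ?T' Z \<cdot> ((f \<boxtimes> g) \<boxtimes> ident M Z)
     = (ident M ?T \<boxtimes> nf t' Z) \<cdot> (f \<boxtimes> (g \<boxtimes> ident M Z)) \<cdot> ?a"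
    by (subst associator_natural) (rule refl hs)+
  also have "\<dots> = (f \<boxtimes> (nf t' Z \<cdot> (g \<boxtimes> ident M Z))) \<cdot> ?a"
    by (rule comp_extend, subst interchange[symmetric])
      (rule hs refl | simp only: comp_ident_left[OF hf])+
  also have "nf t' Z \<cdot> (g \<boxtimes> ident M Z) = E \<cdot> nf s' Z"
    using g Z eE[OF nf_hom[OF ls(3) Z]] by (simp add: denotes_def)
  also have "(f \<boxtimes> (E \<cdot> nf s' Z)) \<cdot> ?a = (ident M ?T \<boxtimes> E) \<cdot> (f \<boxtimes> nf s' Z) \<cdot> ?a"
    by (rule comp_extend[symmetric], subst interchange[symmetric])
      (rule hs refl | simp only: comp_ident_left[OF hf])+
  finally have 1: "(ident M ?T \<boxtimes> nf t' Z) \<cdot> associator M ?T ?T' Z \<cdot> ((f \<boxtimes> g) \<boxtimes> ident M Z)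
      = (ident M ?T \<boxtimes> E) \<cdot> (f \<boxtimes> nf s' Z) \<cdot> ?a" .
  have x: "(f \<boxtimes> nf s' Z) \<cdot> ?a \<in> hom M ((?S \<otimes> ?S') \<otimes> Z) (?T \<otimes> ?N)" by (rule hs)+
  have "nf (Prod t t') Z \<cdot> ((f \<boxtimes> g) \<boxtimes> ident M Z)
      = nf t ?N' \<cdot> (ident M ?T \<boxtimes> nf t' Z) \<cdot> associator M ?T ?T' Z \<cdot> ((f \<boxtimes> g) \<boxtimes> ident M Z)"
    using comp_assoc[OF tensor_hom[OF tensor_hom[OF hf hg] ident_hom[OF Z]]
        invertible_hom[OF associator_iso[OF o(2,4) Z]] tensor_hom[OF ident_hom[OF o(2)] nf_hom[OF ls(4) Z]]]
      comp_assoc[OF tensor_hom[OF tensor_hom[OF hf hg] ident_hom[OF Z]]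
        comp_hom[OF invertible_hom[OF associator_iso[OF o(2,4) Z]] tensor_hom[OF ident_hom[OF o(2)]
          nf_hom[OF ls(4) Z]]]
        nf_hom[OF ls(2) o(6)]] by simp
  also have "\<dots> = nf t ?N' \<cdot> (ident M ?T \<boxtimes> E) \<cdot> (f \<boxtimes> nf s' Z) \<cdot> ?a" unfolding 1 ..
  also have "\<dots> = whisker (leaves t) E \<cdot> nf t ?N \<cdot> (f \<boxtimes> nf s' Z) \<cdot> ?a"
    by (rule comp_extend2[OF nf_natural[OF ls(2) hE] _ _ _ _ x]) (rule hs)+
  also have "(f \<boxtimes> nf s' Z) \<cdot> ?a = (f \<boxtimes> ident M ?N) \<cdot> (ident M ?S \<boxtimes> nf s' Z) \<cdot> ?a"
    by (rule comp_extend[OF tensor_split(2), symmetric]) (rule hs)+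
  also have "nf t ?N \<cdot> (f \<boxtimes> ident M ?N) \<cdot> (ident M ?S \<boxtimes> nf s' Z) \<cdot> ?a
      = act ?N d (nf s ?N) \<cdot> (ident M ?S \<boxtimes> nf s' Z) \<cdot> ?a"
    using f o by (intro comp_extend[of "nf t ?N"]) (simp add: denotes_def, (rule hs)+)
  also have "\<dots> = act ?N d (nf s ?N \<cdot> (ident M ?S \<boxtimes> nf s' Z) \<cdot> ?a)"
    by (rule act_comp[symmetric, OF pd]) (rule hs)+
  also have "\<dots> = act Z (within [] d (leaves s')) (nf (Prod s s') Z)"
    by (simp add: act_within_right)
  also have "whisker (leaves t) E \<cdot> \<dots> = act Z (within (leaves t) e []) \<dots>"
  proof -
    have n: "nf (Prod s s') Z \<in> hom M ((?S \<otimes> ?S') \<otimes> Z) (nest (leaves s) ?N)"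
      using nf_hom[of "Prod s s'" Z] ls Z by (simp add: nest_append)
    have y: "act Z (within [] d (leaves s')) (nf (Prod s s') Z) \<in> hom M ((?S \<otimes> ?S') \<otimes> Z) (nest (leaves t) ?N)"
      unfolding act_within_right by (rule act_hom[OF pd o(5) n])
    show ?thesis
      using act_within_left[OF pe ls(2) Z ident_hom[OF o(5)] y] comp_ident_left[OF y]
      by (simp add: E_def whisker_ident[OF ls(2) o(5)])
  qed
  finally show "nf (Prod t t') Z \<cdot> ((f \<boxtimes> g) \<boxtimes> ident M Z)
      = act Z (within [] d (leaves s') @ within (leaves t) e []) (nf (Prod s s') Z)"
    by (simp add: act_append)
qed

lemma denotes_ident:
  assumes s: "set (leaves s) \<subseteq> obj M" and X: "X = tensor_of s"
  shows "denotes (ident M X) s s []"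
  using s tensor_of_obj[OF s] ident_hom comp_ident_right[OF nf_hom[OF s]]
  by (simp add: denotes_def X tensor_ident)

text \<open>Here coherence disappears: the two normalisations differ by the pentagon for X, Y, Z and
  the tail, so the associator is the empty diagram.\<close>

lemma denotes_associator:
  assumes x: "set (leaves x) \<subseteq> obj M" and y: "set (leaves y) \<subseteq> obj M" and z: "set (leaves z) \<subseteq> obj M"
    and X: "X = tensor_of x" and Y: "Y = tensor_of y" and Z: "Z = tensor_of z"
  shows "denotes (associator M X Y Z) (Prod (Prod x y) z) (Prod x (Prod y z)) []"
  unfolding denotes_def
proof (intro conjI ballI)
  have o: "X \<in> obj M" "Y \<in> obj M" "Z \<in> obj M" using x y z by (auto simp: X Y Z intro: tensor_of_obj)
  show "associator M X Y Z \<in> hom M (tensor_of (Prod (Prod x y) z)) (tensor_of (Prod x (Prod y z)))"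
    using invertible_hom[OF associator_iso[OF o]] by (simp add: X Y Z)
  show "path [] (leaves (Prod (Prod x y) z)) (leaves (Prod x (Prod y z)))" using x y z by auto
  fix W assume W: "W \<in> obj M"
  let ?a = "associator M" and ?z = "nest (leaves z) W"
  let ?y = "nest (leaves y) ?z"
  have o': "?z \<in> obj M" "?y \<in> obj M" using W x y z by (auto intro!: nest_obj)
  note nfs = nf_hom[OF x, folded X] nf_hom[OF y, folded Y] nf_hom[OF z, folded Z]
  note hs = homs o W o' nfs
  let ?A = "ident M X \<boxtimes> nf y ?z" and ?B = "ident M Y \<boxtimes> nf z W"
  have B: "?B \<in> hom M (Y \<otimes> (Z \<otimes> W)) (Y \<otimes> ?z)" by (rule hs)+
  have "(ident M X \<boxtimes> (nf y ?z \<cdot> ?B \<cdot> ?a Y Z W)) \<cdot> ?a X (Y \<otimes> Z) W \<cdot> (?a X Y Z \<boxtimes> ident M W)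
     = ?A \<cdot> (ident M X \<boxtimes> ?B) \<cdot> (ident M X \<boxtimes> ?a Y Z W) \<cdot> ?a X (Y \<otimes> Z) W \<cdot> (?a X Y Z \<boxtimes> ident M W)"
    (is "_ = _ \<cdot> ?C \<cdot> ?P \<cdot> ?Q")
  proof -
    have "ident M X \<boxtimes> (nf y ?z \<cdot> ?B \<cdot> ?a Y Z W) = ?A \<cdot> (ident M X \<boxtimes> (?B \<cdot> ?a Y Z W))"
      by (rule tensor_comp_left) (rule hs)+
    also have "ident M X \<boxtimes> (?B \<cdot> ?a Y Z W) = ?C \<cdot> ?P"
      by (rule tensor_comp_left) (rule hs)+
    finally have "(ident M X \<boxtimes> (nf y ?z \<cdot> ?B \<cdot> ?a Y Z W)) \<cdot> ?Q = (?A \<cdot> ?C \<cdot> ?P) \<cdot> ?Q" by simp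
    also have "\<dots> = ?A \<cdot> (?C \<cdot> ?P) \<cdot> ?Q" by (rule comp_assoc) (rule hs)+
    also have "(?C \<cdot> ?P) \<cdot> ?Q = ?C \<cdot> ?P \<cdot> ?Q" by (rule comp_assoc) (rule hs)+
    finally show ?thesis .
  qed
  also have "?P \<cdot> ?Q = ?a X Y (Z \<otimes> W) \<cdot> ?a (X \<otimes> Y) Z W"
    using pentagon[OF o W] .
  also have "?C \<cdot> \<dots> = ?a X Y ?z \<cdot> ((ident M X \<boxtimes> ident M Y) \<boxtimes> nf z W) \<cdot> ?a (X \<otimes> Y) Z W"
    by (rule comp_extend2[OF associator_natural[symmetric]]) (rule hs)+
  finally have 1: "(ident M X \<boxtimes> (nf y ?z \<cdot> ?B \<cdot> ?a Y Z W)) \<cdot> ?a X (Y \<otimes> Z) W \<cdot> (?a X Y Z \<boxtimes> ident M W)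
     = ?A \<cdot> ?a X Y ?z \<cdot> ((ident M X \<boxtimes> ident M Y) \<boxtimes> nf z W) \<cdot> ?a (X \<otimes> Y) Z W" .
  have "nf (Prod x (Prod y z)) W \<cdot> (?a X Y Z \<boxtimes> ident M W)
     = nf x ?y \<cdot> (ident M X \<boxtimes> (nf y ?z \<cdot> ?B \<cdot> ?a Y Z W)) \<cdot> ?a X (Y \<otimes> Z) W \<cdot> (?a X Y Z \<boxtimes> ident M W)"
    (is "_ = _ \<cdot> ?D \<cdot> ?E \<cdot> ?F")
  proof -
    have "nf (Prod x (Prod y z)) W \<cdot> (?a X Y Z \<boxtimes> ident M W) = (nf x ?y \<cdot> ?D \<cdot> ?E) \<cdot> ?F"
      by (simp add: X Y Z nest_append)
    also have "\<dots> = nf x ?y \<cdot> (?D \<cdot> ?E) \<cdot> ?F" by (rule comp_assoc) (rule hs)+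
    also have "(?D \<cdot> ?E) \<cdot> ?F = ?D \<cdot> ?E \<cdot> ?F" by (rule comp_assoc) (rule hs)+
    finally show ?thesis .
  qed
  also note 1
  also have "nf x ?y \<cdot> ?A \<cdot> ?a X Y ?z \<cdot> ((ident M X \<boxtimes> ident M Y) \<boxtimes> nf z W) \<cdot> ?a (X \<otimes> Y) Z W
     = nf (Prod (Prod x y) z) W"
    (is "_ \<cdot> _ \<cdot> _ \<cdot> ?G = _")
  proof -
    have "(nf x ?y \<cdot> ?A \<cdot> ?a X Y ?z) \<cdot> ?G = nf x ?y \<cdot> (?A \<cdot> ?a X Y ?z) \<cdot> ?G"
      by (rule comp_assoc) (rule hs)+
    also have "(?A \<cdot> ?a X Y ?z) \<cdot> ?G = ?A \<cdot> ?a X Y ?z \<cdot> ?G" by (rule comp_assoc) (rule hs)+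
    finally show ?thesis using o by (simp add: X[symmetric] Y[symmetric] Z[symmetric] tensor_ident)
  qed
  finally show "nf (Prod x (Prod y z)) W \<cdot> (?a X Y Z \<boxtimes> ident M W)
      = act W [] (nf (Prod (Prod x y) z) W)" by simp
qed

text \<open>Normalising the source leads to \<open>lunit\<close> at the product of X with the tail,
  whereas the arrow at hand is \<open>lunit\<close> at X tensored with the tail. Kelly's lemma
  \<open>lunit_tensor\<close> identifies the two; on the right side the triangle axiom does.\<close>

lemma denotes_lunit:
  assumes s: "set (leaves s) \<subseteq> obj M" and X: "X = tensor_of s"
  shows "denotes (lunit M X) (Prod One s) s []"
  unfolding denotes_def
proof (intro conjI ballI)
  have o: "X \<in> obj M" using tensor_of_obj[OF s] by (simp add: X)
  show "lunit M X \<in> hom M (tensor_of (Prod One s)) (tensor_of s)"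
    using invertible_hom[OF lunit_iso[OF o]] by (simp add: X)
  show "path [] (leaves (Prod One s)) (leaves s)" using s by simp
  fix Z assume Z: "Z \<in> obj M"
  note hs = homs o Z nf_hom[OF s Z, folded X]
  have "nf s Z \<cdot> (lunit M X \<boxtimes> ident M Z) = nf s Z \<cdot> lunit M (X \<otimes> Z) \<cdot> associator M (tunit M) X Z"
    using lunit_tensor[OF o Z] by simp
  also have "\<dots> = lunit M (nest (leaves s) Z) \<cdot> (ident M (tunit M) \<boxtimes> nf s Z) \<cdot> associator M (tunit M) X Z"
    by (rule comp_extend2[OF lunit_natural[symmetric]]) (rule hs nest_obj s)+
  finally show "nf s Z \<cdot> (lunit M X \<boxtimes> ident M Z) = act Z [] (nf (Prod One s) Z)"
    by (simp add: X)
qed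

lemma denotes_runit:
  assumes s: "set (leaves s) \<subseteq> obj M" and X: "X = tensor_of s"
  shows "denotes (runit M X) (Prod s One) s []"
  unfolding denotes_def
proof (intro conjI ballI)
  have o: "X \<in> obj M" using tensor_of_obj[OF s] by (simp add: X)
  show "runit M X \<in> hom M (tensor_of (Prod s One)) (tensor_of s)"
    using invertible_hom[OF runit_iso[OF o]] by (simp add: X)
  show "path [] (leaves (Prod s One)) (leaves s)" using s by simp
  fix Z assume Z: "Z \<in> obj M"
  show "nf s Z \<cdot> (runit M X \<boxtimes> ident M Z) = act Z [] (nf (Prod s One) Z)"
    using triangle[OF o Z] by (simp add: X)
qed

text \<open>Meant for the constraints: an empty diagram is its own inverse, whereas a list of boxes
  has no formal inverse.\<close>

lemma denotes_inv:
  assumes f: "denotes f s t []" and inv: "invertible M X Y f" and X: "X = tensor_of s" and Y: "Y =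
    tensor_of t"
  shows "denotes (inv_arr M X Y f) t s []"
  unfolding denotes_def
proof (intro conjI ballI)
  let ?g = "inv_arr M X Y f"
  have l: "leaves s = leaves t" and s: "set (leaves s) \<subseteq> obj M" and t: "set (leaves t) \<subseteq> obj M"
    using f by (auto simp: denotes_def)
  show "?g \<in> hom M (tensor_of t) (tensor_of s)" using inv_arr_hom[OF inv] by (simp add: X Y)
  show "path [] (leaves t) (leaves s)" using l s by simp
  fix Z assume Z: "Z \<in> obj M"
  note hs = homs inv_arr_hom[OF inv] invertible_hom[OF inv] Z nf_hom[OF t, folded Y] nf_hom[OF s, folded X]
    hom_objs[OF invertible_hom[OF inv]]
  have "nf s Z \<cdot> (?g \<boxtimes> ident M Z) = nf t Z \<cdot> (f \<boxtimes> ident M Z) \<cdot> (?g \<boxtimes> ident M Z)"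
    using f Z by (intro comp_extend[symmetric]) (simp add: denotes_def, (rule hs)+)
  also have "(f \<boxtimes> ident M Z) \<cdot> (?g \<boxtimes> ident M Z) = (f \<cdot> ?g) \<boxtimes> ident M Z"
    by (rule tensor_comp_right[symmetric]) (rule hs)+
  also have "\<dots> = ident M (Y \<otimes> Z)"
    using hom_objs[OF invertible_hom[OF inv]] Z by (simp add: inv_arr_right[OF inv] tensor_ident)
  also have "nf t Z \<cdot> \<dots> = nf t Z"
    by (rule comp_ident_right) (rule hs)+
  finally show "nf s Z \<cdot> (?g \<boxtimes> ident M Z) = act Z [] (nf t Z)" by simp
qed

text \<open>Turns an opaque arrow, such as a multiplication or \<open>\<psi>\<close>, into a
  generating box by conjugating it with the normalisations of its source and target words.\<close>

definition cell_of :: "'o bracketing \<Rightarrow> 'o bracketing \<Rightarrow> 'm \<Rightarrow> ('o, 'm) cell" where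
  "cell_of s t f = Cell
     (\<lambda>Z. nf t Z \<cdot> (f \<boxtimes> ident M Z) \<cdot> inv_arr M (tensor_of s \<otimes> Z) (nest (leaves s) Z) (nf s Z))
     (leaves s) (leaves t)"

lemma cell_of_simps [simp]: "src (cell_of s t f) = leaves s" "tgt (cell_of s t f) = leaves t"
  by (simp_all add: cell_of_def)

lemma valid_cell_of:
  assumes f: "f \<in> hom M (tensor_of s) (tensor_of t)"
    and s: "set (leaves s) \<subseteq> obj M" and t: "set (leaves t) \<subseteq> obj M"
  shows "valid_cell (cell_of s t f)"
  unfolding valid_cell_def cell_of_simps
proof (intro conjI ballI allI impI)
  let ?i = "\<lambda>Z. inv_arr M (tensor_of s \<otimes> Z) (nest (leaves s) Z) (nf s Z)"
  note hs = homs f nf_hom[OF s] nf_hom[OF t] inv_arr_hom[OF invertible_nf[OF s]] whisker_hom[OF s]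
    whisker_hom[OF t]
    tensor_of_obj[OF s] tensor_of_obj[OF t]
  show "fam (cell_of s t f) Z \<in> hom M (nest (leaves s) Z) (nest (leaves t) Z)" if "Z \<in> obj M" for Z
    unfolding cell_of_def cell.sel by (rule hs that)+
  fix Z Z' k assume k: "k \<in> hom M Z Z'"
  note o = hom_objs[OF k]
  note hs = hs o k
  have h: "?i Z' \<cdot> whisker (leaves s) k = (ident M (tensor_of s) \<boxtimes> k) \<cdot> ?i Z"
  proof (rule invertible_cancel_left[OF invertible_nf[OF s o(2)]])
    show "?i Z' \<cdot> whisker (leaves s) k \<in> hom M (nest (leaves s) Z) (tensor_of s \<otimes> Z')"
      "(ident M (tensor_of s) \<boxtimes> k) \<cdot> ?i Z \<in> hom M (nest (leaves s) Z) (tensor_of s \<otimes> Z')"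
      by (rule hs)+
    have "nf s Z' \<cdot> (ident M (tensor_of s) \<boxtimes> k) \<cdot> ?i Z = whisker (leaves s) k \<cdot> nf s Z \<cdot> ?i Z"
      by (rule comp_extend2[OF nf_natural[OF s k]]) (rule hs)+
    also have "\<dots> = whisker (leaves s) k"
      using inv_arr_right[OF invertible_nf[OF s o(1)]] comp_ident_right[OF whisker_hom[OF s k]] by simp
    finally show "nf s Z' \<cdot> ?i Z' \<cdot> whisker (leaves s) k = nf s Z' \<cdot> (ident M (tensor_of s) \<boxtimes> k) \<cdot> ?i Z"
      using inv_arr_right_comp[OF invertible_nf[OF s o(2)] whisker_hom[OF s k]] by simp
  qed
  have "(nf t Z' \<cdot> (f \<boxtimes> ident M Z') \<cdot> ?i Z') \<cdot> whisker (leaves s) k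
      = nf t Z' \<cdot> ((f \<boxtimes> ident M Z') \<cdot> ?i Z') \<cdot> whisker (leaves s) k"
    by (rule comp_assoc) (rule hs)+
  also have "((f \<boxtimes> ident M Z') \<cdot> ?i Z') \<cdot> whisker (leaves s) k
      = (f \<boxtimes> ident M Z') \<cdot> (ident M (tensor_of s) \<boxtimes> k) \<cdot> ?i Z"
    unfolding h[symmetric] by (rule comp_assoc) (rule hs)+
  also have "\<dots> = (f \<boxtimes> k) \<cdot> ?i Z"
    by (rule comp_extend[OF tensor_split(2)]) (rule hs)+
  also have "\<dots> = (ident M (tensor_of t) \<boxtimes> k) \<cdot> (f \<boxtimes> ident M Z) \<cdot> ?i Z"
    by (rule comp_extend[OF tensor_split(1), symmetric]) (rule hs)+
  also have "nf t Z' \<cdot> \<dots> = whisker (leaves t) k \<cdot> nf t Z \<cdot> (f \<boxtimes> ident M Z) \<cdot> ?i Z"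
    by (rule comp_extend2[OF nf_natural[OF t k]]) (rule hs)+
  finally show "fam (cell_of s t f) Z' \<cdot> whisker (leaves s) k = whisker (leaves t) k \<cdot> fam (cell_of s t f) Z"
    by (simp add: cell_of_def)
qed (use s t in auto)

lemma denotes_cell_of:
  assumes f: "f \<in> hom M (tensor_of s) (tensor_of t)"
    and s: "set (leaves s) \<subseteq> obj M" and t: "set (leaves t) \<subseteq> obj M"
  shows "denotes f s t [([], cell_of s t f, [])]"
  unfolding denotes_def
proof (intro conjI ballI)
  let ?i = "\<lambda>Z. inv_arr M (tensor_of s \<otimes> Z) (nest (leaves s) Z) (nf s Z)"
  show "path [([], cell_of s t f, [])] (leaves s) (leaves t)" using valid_cell_of[OF assms] t by simp
  fix Z assume Z: "Z \<in> obj M"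
  note hs = homs f nf_hom[OF s] nf_hom[OF t] inv_arr_hom[OF invertible_nf[OF s]] Z
  have "(nf t Z \<cdot> (f \<boxtimes> ident M Z) \<cdot> ?i Z) \<cdot> nf s Z = nf t Z \<cdot> ((f \<boxtimes> ident M Z) \<cdot> ?i Z) \<cdot> nf s Z"
    by (rule comp_assoc) (rule hs)+
  also have "((f \<boxtimes> ident M Z) \<cdot> ?i Z) \<cdot> nf s Z = (f \<boxtimes> ident M Z) \<cdot> ?i Z \<cdot> nf s Z"
    by (rule comp_assoc) (rule hs)+
  also have "\<dots> = f \<boxtimes> ident M Z"
    using inv_arr_left[OF invertible_nf[OF s Z]] comp_ident_right[OF tensor_hom[OF f ident_hom[OF Z]]] by simp
  finally show "nf t Z \<cdot> (f \<boxtimes> ident M Z) = act Z [([], cell_of s t f, [])] (nf s Z)"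
    by (simp add: cell_of_def)
qed (rule f)

text \<open>The bridge in both directions: assumed equations of arrows enter the calculus from left
  to right, and derived ones leave it from right to left. Leaving it uses the tail I, on which
  tensoring is faithful.\<close>

lemma denotes_eq_iff:
  assumes f: "denotes f s t d" and g: "denotes g s t e"
  shows "f = g \<longleftrightarrow> diag_eq (leaves s) (leaves t) d e"
proof
  have h: "f \<in> hom M (tensor_of s) (tensor_of t)" "g \<in> hom M (tensor_of s) (tensor_of t)"
    and p: "path d (leaves s) (leaves t)" "path e (leaves s) (leaves t)"
    using f g by (auto simp: denotes_def)
  have s: "set (leaves s) \<subseteq> obj M" and t: "set (leaves t) \<subseteq> obj M" using path_objs[OF p(1)] by auto
  show "diag_eq (leaves s) (leaves t) d e" if "f = g"
  proof (rule diag_eqI[OF p])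
    fix Z W h assume Z: "Z \<in> obj M" and h: "h \<in> hom M W (nest (leaves s) Z)"
    \<comment> \<open>Every \<open>h\<close> into the nested product factors through the isomorphism
      \<open>nf s Z\<close>, so agreement on \<open>nf s Z\<close> is agreement on
      \<open>h\<close>.\<close>
    let ?h = "inv_arr M (tensor_of s \<otimes> Z) (nest (leaves s) Z) (nf s Z) \<cdot> h"
    have h': "?h \<in> hom M W (tensor_of s \<otimes> Z)" by (rule comp_hom[OF h inv_arr_hom[OF invertible_nf[OF s Z]]])
    have e: "act Z d (nf s Z) = act Z e (nf s Z)"
      using f g Z that by (auto simp: denotes_def)
    show "act Z d h = act Z e h"
      using act_comp[OF p(1) Z nf_hom[OF s Z] h'] act_comp[OF p(2) Z nf_hom[OF s Z] h'] e
        inv_arr_right_comp[OF invertible_nf[OF s Z] h] by simp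
  qed
  show "f = g" if de: "diag_eq (leaves s) (leaves t) d e"
  proof (rule tensor_unit_right_cancel[OF h], rule invertible_cancel_left[OF invertible_nf[OF t tunit_obj]])
    show "nf t (tunit M) \<cdot> (f \<boxtimes> ident M (tunit M)) = nf t (tunit M) \<cdot> (g \<boxtimes> ident M (tunit M))"
      using f g diag_eq_act[OF de tunit_obj nf_hom[OF s tunit_obj]] tunit_obj by (auto simp: denotes_def)
  qed (rule homs h)+
qed

end


section \<open>Diagram calculus of twisted products\<close>

text \<open>The dropped prefix leaves exactly the strings lying between the two boxes. The tests
  decide whether the second box is to the right or to the left of the first; if the boxes share a
  string the diagram is returned unchanged, so soundness needs typing only.\<close>

fun swap :: "('o, 'm) diagram \<Rightarrow> ('o, 'm) diagram" where
  "swap ((l, a, r) # (l', b, r') # d) =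
    (if length l + length (tgt a) \<le> length l' then
       (l @ src a @ drop (length l + length (tgt a)) l', b, r') #
         (l, a, drop (length l + length (tgt a)) l' @ tgt b @ r') # d
     else if length l' + length (src b) \<le> length l then
       (l', b, drop (length l' + length (src b)) l @ src a @ r) #
         (l' @ tgt b @ drop (length l' + length (src b)) l, a, r) # d
     else (l, a, r) # (l', b, r') # d)"
| "swap d = d"

definition swap_at :: "nat \<Rightarrow> ('o, 'm) diagram \<Rightarrow> ('o, 'm) diagram" where
  "swap_at n d = take n d @ swap (drop n d)"

lemma append_eq_split:
  assumes "xs @ ys = zs @ ws" "length xs \<le> length zs"
  shows "zs = xs @ drop (length xs) zs" "ys = drop (length xs) zs @ ws"
  using assms by (metis append_eq_append_conv_if append_take_drop_id)+

section \<open>Rewriting a diagram at a given position\<close>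

context monoidal_category
begin

lemma path_appendE:
  assumes "path (d @ e) xs zs"
  obtains ys where "path d xs ys" "path e ys zs"
  using assms
proof (induction d arbitrary: xs thesis)
  case Nil
  then show ?case using path_objs[of e xs zs] by simp
next
  case (Cons x d)
  obtain l c r where x: "x = (l, c, r)" by (cases x)
  with Cons.prems have "path (d @ e) (l @ tgt c @ r) zs" by simp
  with Cons.IH obtain ys where "path d (l @ tgt c @ r) ys" "path e ys zs" by metis
  with Cons.prems show ?case by (simp add: x)
qed

lemma diag_eq_refl: "path d xs ys \<Longrightarrow> diag_eq xs ys d d"
  by (simp add: diag_eq_def)

text \<open>A form of \<open>diag_eq_step\<close> in which the redex is found by its layer index
  \<open>n\<close>, so that on concrete diagrams all remaining premises are computations.\<close>

lemma diag_eq_at: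
  assumes "diag_eq xs ys d e" "path D zs ws"
    and "take (length d) (drop n D) = within l d r" "n \<le> length D"
    and "E = take n D @ within l e r @ drop (n + length d) D"
    and "path (take n D) zs (l @ xs @ r)" "path (drop (n + length d) D) (l @ ys @ r) ws"
  shows "diag_eq zs ws D E"
proof -
  have "D = take n D @ within l d r @ drop (n + length d) D"
    using assms(3) append_take_drop_id[of n D] append_take_drop_id[of "length d" "drop n D"]
    by (simp add: add.commute)
  then show ?thesis using diag_eq_step[OF assms(1,6,7)] assms(5) by simp
qed

lemma diag_eq_swap:
  assumes "path d xs ys"
  shows "diag_eq xs ys d (swap d)"
  using assms
proof (cases d rule: swap.cases)
  case (1 l a r l' b r' e)
  have v: "valid_cell a" "valid_cell b" and o: "set (l @ r) \<subseteq> obj M" "set (l' @ r') \<subseteq> obj M"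
    and xs: "xs = l @ src a @ r" and eq: "l @ tgt a @ r = l' @ src b @ r'"
    and e: "path e (l' @ tgt b @ r') ys"
    using assms 1 by auto
  consider (right) "length l + length (tgt a) \<le> length l'"
    | (left) "\<not> length l + length (tgt a) \<le> length l'" "length l' + length (src b) \<le> length l"
    | (none) "\<not> length l + length (tgt a) \<le> length l'" "\<not> length l' + length (src b) \<le> length l"
    by blast
  then show ?thesis
  proof cases
    case right
    define m where "m = drop (length l + length (tgt a)) l'"
    have l': "l' = l @ tgt a @ m" and r: "r = m @ src b @ r'"
      using append_eq_split[of "l @ tgt a" r l' "src b @ r'"] eq right by (simp_all add: m_def)
    have m: "set m \<subseteq> obj M" using o l' by auto
    have "diag_eq xs ys ([] @ within l [([], a, m @ src b), (tgt a @ m, b, [])] r' @ e)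
        ([] @ within l [(src a @ m, b, []), ([], a, m @ tgt b)] r' @ e)"
      by (rule diag_eq_step[OF diag_eq_interchange[OF v m]])
        (use v o xs r l' e in \<open>auto simp: valid_cell_def\<close>)
    then show ?thesis using right unfolding 1 by (simp add: m_def[symmetric]) (simp add: l' r)
  next
    case left
    define m where "m = drop (length l' + length (src b)) l"
    have l: "l = l' @ src b @ m" and r': "r' = m @ tgt a @ r"
      using append_eq_split[of "l' @ src b" r' l "tgt a @ r"] eq left by (simp_all add: m_def)
    have m: "set m \<subseteq> obj M" using o l by auto
    \<comment> \<open>The second box lies to the left, so interchange is used backwards with the
      roles of the boxes exchanged.\<close>
    have "diag_eq xs ys ([] @ within l' [(src b @ m, a, []), ([], b, m @ tgt a)] r @ e)
        ([] @ within l' [([], b, m @ src a), (tgt b @ m, a, [])] r @ e)"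
      by (rule diag_eq_step[OF diag_eq_sym[OF diag_eq_interchange[OF v(2,1) m]]])
        (use v o xs l r' e in \<open>auto simp: valid_cell_def\<close>)
    then show ?thesis using left unfolding 1 by (simp add: m_def[symmetric]) (simp add: l r')
  next
    case none
    then show ?thesis using assms unfolding 1 by (simp add: diag_eq_refl)
  qed
qed (use diag_eq_refl in auto)

lemma diag_eq_swap_at:
  assumes "path d xs ys"
  shows "diag_eq xs ys d (swap_at n d)"
proof -
  have "path (take n d @ drop n d) xs ys" using assms by simp
  then obtain zs where p: "path (take n d) xs zs" "path (drop n d) zs ys" by (rule path_appendE)
  have "diag_eq xs ys (take n d @ within [] (drop n d) [] @ []) (take n d @ within [] (swap (drop n d))
    [] @ [])"
    using diag_eq_step[OF diag_eq_swap[OF p(2)], of "take n d" xs "[]" "[]" "[]" ys] p path_objs[OF p(2)]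
    by simp
  moreover have "within [] e [] = e" for e :: "('o, 'm) diagram" by (induction e) auto
  ultimately show ?thesis by (simp add: swap_at_def)
qed

text \<open>A reordering of layers is certified by \<open>ns\<close>, the positions of the adjacent
  exchanges, counted from 0 and performed from left to right.\<close>

lemma diag_eq_swaps:
  assumes "path d xs ys" "e = fold swap_at ns d"
  shows "diag_eq xs ys d e"
  using assms
proof (induction ns arbitrary: d)
  case Nil
  then show ?case by (simp add: diag_eq_refl)
next
  case (Cons n ns)
  have "diag_eq xs ys d (swap_at n d)" by (rule diag_eq_swap_at[OF Cons.prems(1)])
  moreover from this have "diag_eq xs ys (swap_at n d) e"
    using Cons by (auto simp: diag_eq_def)
  ultimately show ?case by (rule diag_eq_trans)
qed

section \<open>From the twisting equations to the monoid axioms of the twisted product\<close>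

context
  fixes K H mk uk mh uh p
  assumes objs: "K \<in> obj M" "H \<in> obj M"
    and valid: "valid_cell mk" "valid_cell uk" "valid_cell mh" "valid_cell uh" "valid_cell p"
    and ends: "src mk = [K, K]" "tgt mk = [K]" "src uk = []" "tgt uk = [K]" "src mh = [H, H]" "tgt mh =
      [H]" "src uh = []" "tgt uh = [H]" "src p = [H, K]" "tgt p = [K, H]"
    and mk_assoc: "diag_eq [K, K, K] [K] [([], mk, [K]), ([], mk, [])] [([K], mk, []), ([], mk, [])]"
    and mk_unit_left: "diag_eq [K] [K] [([], uk, [K]), ([], mk, [])] []"
    and mk_unit_right: "diag_eq [K] [K] [([K], uk, []), ([], mk, [])] []"
    and mh_assoc: "diag_eq [H, H, H] [H] [([], mh, [H]), ([], mh, [])] [([H], mh, []), ([], mh, [])]"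
    and mh_unit_left: "diag_eq [H] [H] [([], uh, [H]), ([], mh, [])] []"
    and mh_unit_right: "diag_eq [H] [H] [([H], uh, []), ([], mh, [])] []"
    and twist_mh: "diag_eq [H, H, K] [K, H] [([], mh, [K]), ([], p, [])] [([H], p, []), ([], p, [H]),
      ([K], mh, [])]"
    and twist_uh: "diag_eq [K] [K, H] [([], uh, [K]), ([], p, [])] [([K], uh, [])]"
    and twist_mk: "diag_eq [H, K, K] [K, H] [([H], mk, []), ([], p, [])] [([], p, [K]), ([K], p, []),
      ([], mk, [H])]"
    and twist_uk: "diag_eq [H] [K, H] [([H], uk, []), ([], p, [])] [([], uk, [H])]"
begin

text \<open>\<open>p\<close> carries the inserted unit of H past K; after that both units stand
  beside the multiplications of their own monoids.\<close>

lemma twisted_unit_left: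
  "diag_eq [K, H] [K, H]
    [([], uk, [K, H]), ([K], uh, [K, H]), ([K], p, [H]), ([], mk, [H, H]), ([K], mh, [])]
    []"
proof -
  note [simp] = objs valid ends
  have "diag_eq [K, H] [K, H]
        [([], uk, [K, H]), ([K], uh, [K, H]), ([K], p, [H]), ([], mk, [H, H]), ([K], mh, [])]
        [([], uh, [K, H]), ([], p, [H]), ([], uk, [K, H, H]), ([], mk, [H, H]), ([K], mh, [])]"
    by (rule diag_eq_swaps[where ns = "[0, 1]"]) (simp_all add: swap_at_def)
  also have "diag_eq [K, H] [K, H] \<dots>
        [([], uh, [K, H]), ([], p, [H]), ([K], mh, [])]"
    by (rule diag_eq_at[OF mk_unit_left, where n = 2 and l = "[]" and r = "[H, H]"]) simp_all
  also have "diag_eq [K, H] [K, H] \<dots>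
        [([K], uh, [H]), ([K], mh, [])]"
    by (rule diag_eq_at[OF twist_uh, where n = 0 and l = "[]" and r = "[H]"]) simp_all
  also have "diag_eq [K, H] [K, H] \<dots>
        []"
    by (rule diag_eq_at[OF mh_unit_left, where n = 0 and l = "[K]" and r = "[]"]) simp_all
  finally show ?thesis .
qed

lemma twisted_unit_right:
  "diag_eq [K, H] [K, H]
    [([K, H], uk, []), ([K, H, K], uh, []), ([K], p, [H]), ([], mk, [H, H]), ([K], mh, [])]
    []"
proof -
  note [simp] = objs valid ends
  have "diag_eq [K, H] [K, H]
        [([K, H], uk, []), ([K, H, K], uh, []), ([K], p, [H]), ([], mk, [H, H]), ([K], mh, [])]
        [([K, H], uk, []), ([K], p, []), ([], mk, [H]), ([K, H], uh, []), ([K], mh, [])]"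
    by (rule diag_eq_swaps[where ns = "[1, 2]"]) (simp_all add: swap_at_def)
  also have "diag_eq [K, H] [K, H] \<dots>
        [([K, H], uk, []), ([K], p, []), ([], mk, [H])]"
    by (rule diag_eq_at[OF mh_unit_right, where n = 3 and l = "[K]" and r = "[]"]) simp_all
  also have "diag_eq [K, H] [K, H] \<dots>
        [([K], uk, [H]), ([], mk, [H])]"
    by (rule diag_eq_at[OF twist_uk, where n = 0 and l = "[K]" and r = "[]"]) simp_all
  also have "diag_eq [K, H] [K, H] \<dots>
        []"
    by (rule diag_eq_at[OF mk_unit_right, where n = 0 and l = "[]" and r = "[H]"]) simp_all
  finally show ?thesis .
qed

text \<open>Both sides equal a common form: the three crossings of an H with a later K, followed by
  the triple products in K and in H. The left side reaches it by pulling \<open>mh\<close> through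
  \<open>p\<close>, the right side by pulling \<open>mk\<close> through \<open>p\<close>, and the
  triple products agree by associativity.\<close>

lemma twisted_assoc:
  "diag_eq [K, H, K, H, K, H] [K, H]
    [([K], p, [H, K, H]), ([], mk, [H, H, K, H]), ([K], mh, [K, H]), ([K], p, [H]), ([], mk, [H, H]),
      ([K], mh, [])]
    [([K, H, K], p, [H]), ([K, H], mk, [H, H]), ([K, H, K], mh, []), ([K], p, [H]), ([], mk, [H, H]),
      ([K], mh, [])]"
proof -
  note [simp] = objs valid ends
  have "diag_eq [K, H, K, H, K, H] [K, H]
        [([K], p, [H, K, H]), ([], mk, [H, H, K, H]), ([K], mh, [K, H]), ([K], p, [H]), ([], mk, [H, H]),
          ([K], mh, [])]
        [([K], p, [H, K, H]), ([], mk, [H, H, K, H]), ([K, H], p, [H]), ([K], p, [H, H]), ([K, K], mh,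
          [H]), ([], mk, [H, H]), ([K], mh, [])]"
    by (rule diag_eq_at[OF twist_mh, where n = 2 and l = "[K]" and r = "[H]"]) simp_all
  also have "diag_eq [K, H, K, H, K, H] [K, H] \<dots>
        [([K], p, [H, K, H]), ([K, K, H], p, [H]), ([K, K], p, [H, H]), ([], mk, [K, H, H, H]), ([], mk,
          [H, H, H]), ([K], mh, [H]), ([K], mh, [])]"
    by (rule diag_eq_swaps[where ns = "[1, 2, 4]"]) (simp_all add: swap_at_def)
  also have "diag_eq [K, H, K, H, K, H] [K, H] \<dots>
        [([K], p, [H, K, H]), ([K, K, H], p, [H]), ([K, K], p, [H, H]), ([K], mk, [H, H, H]), ([], mk,
          [H, H, H]), ([K], mh, [H]), ([K], mh, [])]"
    by (rule diag_eq_at[OF mk_assoc, where n = 3 and l = "[]" and r = "[H, H, H]"]) simp_all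
  also have "diag_eq [K, H, K, H, K, H] [K, H] \<dots>
        [([K], p, [H, K, H]), ([K, K, H], p, [H]), ([K, K], p, [H, H]), ([K], mk, [H, H, H]), ([], mk,
          [H, H, H]), ([K, H], mh, []), ([K], mh, [])]"
    by (rule diag_eq_at[OF mh_assoc, where n = 5 and l = "[K]" and r = "[]"]) simp_all
  also have "diag_eq [K, H, K, H, K, H] [K, H] \<dots>
        [([K, H, K], p, [H]), ([K], p, [K, H, H]), ([K, K], p, [H, H]), ([K], mk, [H, H, H]), ([K, K, H],
          mh, []), ([], mk, [H, H]), ([K], mh, [])]"
    by (rule diag_eq_swaps[where ns = "[0, 4]"]) (simp_all add: swap_at_def)
  also have "diag_eq [K, H, K, H, K, H] [K, H] \<dots>
        [([K, H, K], p, [H]), ([K, H], mk, [H, H]), ([K], p, [H, H]), ([K, K, H], mh, []), ([], mk, [H,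
          H]), ([K], mh, [])]"
    by (rule diag_eq_at[OF twist_mk[THEN diag_eq_sym], where n = 1 and l = "[K]" and r = "[H, H]"]) simp_all
  also have "diag_eq [K, H, K, H, K, H] [K, H] \<dots>
        [([K, H, K], p, [H]), ([K, H], mk, [H, H]), ([K, H, K], mh, []), ([K], p, [H]), ([], mk, [H, H]),
          ([K], mh, [])]"
    by (rule diag_eq_swaps[where ns = "[2]"]) (simp_all add: swap_at_def)
  finally show ?thesis .
qed

end


section \<open>From the monoid axioms of the twisted product to the twisting equations\<close>

context
  fixes K H mk uk mh uh p
  assumes objs: "K \<in> obj M" "H \<in> obj M"
    and valid: "valid_cell mk" "valid_cell uk" "valid_cell mh" "valid_cell uh" "valid_cell p"
    and ends: "src mk = [K, K]" "tgt mk = [K]" "src uk = []" "tgt uk = [K]" "src mh = [H, H]" "tgt mh =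
      [H]" "src uh = []" "tgt uh = [H]" "src p = [H, K]" "tgt p = [K, H]"
    and mk_unit_left: "diag_eq [K] [K] [([], uk, [K]), ([], mk, [])] []"
    and mk_unit_right: "diag_eq [K] [K] [([K], uk, []), ([], mk, [])] []"
    and mh_unit_right: "diag_eq [H] [H] [([H], uh, []), ([], mh, [])] []"
    and mul_assoc: "diag_eq [K, H, K, H, K, H] [K, H] [([K], p, [H, K, H]), ([], mk, [H, H, K, H]), ([K],
      mh, [K, H]), ([K], p, [H]), ([], mk, [H, H]), ([K], mh, [])] [([K, H, K], p, [H]), ([K, H], mk, [H,
      H]), ([K, H, K], mh, []), ([K], p, [H]), ([], mk, [H, H]), ([K], mh, [])]"
    and mul_unit_left: "diag_eq [K, H] [K, H] [([], uk, [K, H]), ([K], uh, [K, H]), ([K], p, [H]), ([],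
      mk, [H, H]), ([K], mh, [])] []"
    and mul_unit_right: "diag_eq [K, H] [K, H] [([K, H], uk, []), ([K, H, K], uh, []), ([K], p, [H]),
      ([], mk, [H, H]), ([K], mh, [])] []"
begin

text \<open>Units are inserted, by the unit laws of K and H read backwards, until the full twisted
  multiplication is visible with its unit as left argument and \<open>k \<otimes> u_H\<close> as
  right argument; the left unit law then removes it. \<open>twist_uk\<close> is the mirror image,
  with \<open>u_K \<otimes> h\<close> and the right unit law.\<close>

lemma twist_uh:
  "diag_eq [K] [K, H]
    [([], uh, [K]), ([], p, [])]
    [([K], uh, [])]"
proof -
  note [simp] = objs valid ends
  have "diag_eq [K] [K, H]
        [([], uh, [K]), ([], p, [])]
        [([], uh, [K]), ([], p, []), ([], uk, [K, H]), ([], mk, [H])]"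
    by (rule diag_eq_at[OF mk_unit_left[THEN diag_eq_sym], where n = 2 and l = "[]" and r = "[H]"]) simp_all
  also have "diag_eq [K] [K, H] \<dots>
        [([], uk, [K]), ([K], uh, [K]), ([K], p, []), ([], mk, [H])]"
    by (rule diag_eq_swaps[where ns = "[1, 0]"]) (simp_all add: swap_at_def)
  also have "diag_eq [K] [K, H] \<dots>
        [([], uk, [K]), ([K], uh, [K]), ([K], p, []), ([], mk, [H]), ([K, H], uh, []), ([K], mh, [])]"
    by (rule diag_eq_at[OF mh_unit_right[THEN diag_eq_sym], where n = 4 and l = "[K]" and r = "[]"]) simp_all
  also have "diag_eq [K] [K, H] \<dots>
        [([K], uh, []), ([], uk, [K, H]), ([K], uh, [K, H]), ([K], p, [H]), ([], mk, [H, H]), ([K], mh, [])]"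
    by (rule diag_eq_swaps[where ns = "[3, 2, 1, 0]"]) (simp_all add: swap_at_def)
  also have "diag_eq [K] [K, H] \<dots>
        [([K], uh, [])]"
    by (rule diag_eq_at[OF mul_unit_left, where n = 1 and l = "[]" and r = "[]"]) simp_all
  finally show ?thesis .
qed

lemma twist_uk:
  "diag_eq [H] [K, H]
    [([H], uk, []), ([], p, [])]
    [([], uk, [H])]"
proof -
  note [simp] = objs valid ends
  have "diag_eq [H] [K, H]
        [([H], uk, []), ([], p, [])]
        [([H], uk, []), ([], p, []), ([K, H], uh, []), ([K], mh, [])]"
    by (rule diag_eq_at[OF mh_unit_right[THEN diag_eq_sym], where n = 2 and l = "[K]" and r = "[]"]) simp_all
  also have "diag_eq [H] [K, H] \<dots>
        [([H], uk, []), ([H, K], uh, []), ([], p, [H]), ([K], mh, [])]"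
    by (rule diag_eq_swaps[where ns = "[1]"]) (simp_all add: swap_at_def)
  also have "diag_eq [H] [K, H] \<dots>
        [([H], uk, []), ([H, K], uh, []), ([], p, [H]), ([], uk, [K, H, H]), ([], mk, [H, H]), ([K], mh, [])]"
    by (rule diag_eq_at[OF mk_unit_left[THEN diag_eq_sym], where n = 3 and l = "[]" and r = "[H, H]"])
      simp_all
  also have "diag_eq [H] [K, H] \<dots>
        [([], uk, [H]), ([K, H], uk, []), ([K, H, K], uh, []), ([K], p, [H]), ([], mk, [H, H]), ([K], mh,
          [])]"
    by (rule diag_eq_swaps[where ns = "[2, 1, 0]"]) (simp_all add: swap_at_def)
  also have "diag_eq [H] [K, H] \<dots>
        [([], uk, [H])]"
    by (rule diag_eq_at[OF mul_unit_right, where n = 1 and l = "[]" and r = "[]"]) simp_all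
  finally show ?thesis .
qed

text \<open>Embed H by \<open>u_K \<otimes> h\<close> and K by \<open>k \<otimes> u_H\<close>: their
  product in this order is \<open>p\<close>. Hence the twisted multiplication determines the
  twist.\<close>

lemma incl_mul:
  "diag_eq [H, K] [K, H]
    [([], uk, [H, K]), ([K, H, K], uh, []), ([K], p, [H]), ([], mk, [H, H]), ([K], mh, [])]
    [([], p, [])]"
proof -
  note [simp] = objs valid ends
  have "diag_eq [H, K] [K, H]
        [([], uk, [H, K]), ([K, H, K], uh, []), ([K], p, [H]), ([], mk, [H, H]), ([K], mh, [])]
        [([], uk, [H, K]), ([K], p, []), ([], mk, [H]), ([K, H], uh, []), ([K], mh, [])]"
    by (rule diag_eq_swaps[where ns = "[1, 2]"]) (simp_all add: swap_at_def)
  also have "diag_eq [H, K] [K, H] \<dots>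
        [([], uk, [H, K]), ([K], p, []), ([], mk, [H])]"
    by (rule diag_eq_at[OF mh_unit_right, where n = 3 and l = "[K]" and r = "[]"]) simp_all
  also have "diag_eq [H, K] [K, H] \<dots>
        [([], p, []), ([], uk, [K, H]), ([], mk, [H])]"
    by (rule diag_eq_swaps[where ns = "[0]"]) (simp_all add: swap_at_def)
  also have "diag_eq [H, K] [K, H] \<dots>
        [([], p, [])]"
    by (rule diag_eq_at[OF mk_unit_left, where n = 1 and l = "[]" and r = "[H]"]) simp_all
  finally show ?thesis .
qed

text \<open>The embedding \<open>u_K \<otimes> _\<close> of H respects products.\<close>

lemma incl_mul_left:
  "diag_eq [H, H] [K, H]
    [([], uk, [H, H]), ([K, H], uk, [H]), ([K], p, [H]), ([], mk, [H, H]), ([K], mh, [])]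
    [([], mh, []), ([], uk, [H])]"
proof -
  note [simp] = objs valid ends
  have "diag_eq [H, H] [K, H]
        [([], uk, [H, H]), ([K, H], uk, [H]), ([K], p, [H]), ([], mk, [H, H]), ([K], mh, [])]
        [([], uk, [H, H]), ([K], uk, [H, H]), ([], mk, [H, H]), ([K], mh, [])]"
    by (rule diag_eq_at[OF twist_uk, where n = 1 and l = "[K]" and r = "[H]"]) simp_all
  also have "diag_eq [H, H] [K, H] \<dots>
        [([], uk, [H, H]), ([K], mh, [])]"
    by (rule diag_eq_at[OF mk_unit_right, where n = 1 and l = "[]" and r = "[H, H]"]) simp_all
  also have "diag_eq [H, H] [K, H] \<dots>
        [([], mh, []), ([], uk, [H])]"
    by (rule diag_eq_swaps[where ns = "[0]"]) (simp_all add: swap_at_def)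
  finally show ?thesis .
qed

text \<open>The embedding \<open>_ \<otimes> u_H\<close> of K respects products.\<close>

lemma incl_mul_right:
  "diag_eq [K, K] [K, H]
    [([K], uh, [K]), ([K, H, K], uh, []), ([K], p, [H]), ([], mk, [H, H]), ([K], mh, [])]
    [([], mk, []), ([K], uh, [])]"
proof -
  note [simp] = objs valid ends
  have "diag_eq [K, K] [K, H]
        [([K], uh, [K]), ([K, H, K], uh, []), ([K], p, [H]), ([], mk, [H, H]), ([K], mh, [])]
        [([K], uh, [K]), ([K], p, []), ([K, K, H], uh, []), ([], mk, [H, H]), ([K], mh, [])]"
    by (rule diag_eq_swaps[where ns = "[1]"]) (simp_all add: swap_at_def)
  also have "diag_eq [K, K] [K, H] \<dots>
        [([K, K], uh, []), ([K, K, H], uh, []), ([], mk, [H, H]), ([K], mh, [])]"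
    by (rule diag_eq_at[OF twist_uh, where n = 0 and l = "[K]" and r = "[]"]) simp_all
  also have "diag_eq [K, K] [K, H] \<dots>
        [([K, K], uh, []), ([], mk, [H]), ([K, H], uh, []), ([K], mh, [])]"
    by (rule diag_eq_swaps[where ns = "[1]"]) (simp_all add: swap_at_def)
  also have "diag_eq [K, K] [K, H] \<dots>
        [([K, K], uh, []), ([], mk, [H])]"
    by (rule diag_eq_at[OF mh_unit_right, where n = 2 and l = "[K]" and r = "[]"]) simp_all
  also have "diag_eq [K, K] [K, H] \<dots>
        [([], mk, []), ([K], uh, [])]"
    by (rule diag_eq_swaps[where ns = "[0]"]) (simp_all add: swap_at_def)
  finally show ?thesis .
qed

text \<open>For embedded elements this is the associativity (h h') k = h (h' k), evaluated with
  \<open>incl_mul\<close> and \<open>incl_mul_left\<close>.\<close>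

lemma twist_mh:
  "diag_eq [H, H, K] [K, H]
    [([], mh, [K]), ([], p, [])]
    [([H], p, []), ([], p, [H]), ([K], mh, [])]"
proof -
  note [simp] = objs valid ends
  have "diag_eq [H, H, K] [K, H]
        [([], mh, [K]), ([], p, [])]
        [([], mh, [K]), ([], uk, [H, K]), ([K, H, K], uh, []), ([K], p, [H]), ([], mk, [H, H]), ([K], mh,
          [])]"
    by (rule diag_eq_at[OF incl_mul[THEN diag_eq_sym], where n = 1 and l = "[]" and r = "[]"]) simp_all
  also have "diag_eq [H, H, K] [K, H] \<dots>
        [([], uk, [H, H, K]), ([K, H], uk, [H, K]), ([K], p, [H, K]), ([], mk, [H, H, K]), ([K], mh,
          [K]), ([K, H, K], uh, []), ([K], p, [H]), ([], mk, [H, H]), ([K], mh, [])]"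
    by (rule diag_eq_at[OF incl_mul_left[THEN diag_eq_sym], where n = 0 and l = "[]" and r = "[K]"]) simp_all
  also have "diag_eq [H, H, K] [K, H] \<dots>
        [([], uk, [H, H, K]), ([K, H], uk, [H, K]), ([K, H, K, H, K], uh, []), ([K], p, [H, K, H]), ([],
          mk, [H, H, K, H]), ([K], mh, [K, H]), ([K], p, [H]), ([], mk, [H, H]), ([K], mh, [])]"
    by (rule diag_eq_swaps[where ns = "[4, 3, 2]"]) (simp_all add: swap_at_def)
  also have "diag_eq [H, H, K] [K, H] \<dots>
        [([], uk, [H, H, K]), ([K, H], uk, [H, K]), ([K, H, K, H, K], uh, []), ([K, H, K], p, [H]), ([K,
          H], mk, [H, H]), ([K, H, K], mh, []), ([K], p, [H]), ([], mk, [H, H]), ([K], mh, [])]"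
    by (rule diag_eq_at[OF mul_assoc, where n = 3 and l = "[]" and r = "[]"]) simp_all
  also have "diag_eq [H, H, K] [K, H] \<dots>
        [([], uk, [H, H, K]), ([K, H], p, []), ([K], p, [H]), ([], mk, [H, H]), ([K], mh, [])]"
    by (rule diag_eq_at[OF incl_mul, where n = 1 and l = "[K, H]" and r = "[]"]) simp_all
  also have "diag_eq [H, H, K] [K, H] \<dots>
        [([H], p, []), ([], p, [H]), ([], uk, [K, H, H]), ([], mk, [H, H]), ([K], mh, [])]"
    by (rule diag_eq_swaps[where ns = "[0, 1]"]) (simp_all add: swap_at_def)
  also have "diag_eq [H, H, K] [K, H] \<dots>
        [([H], p, []), ([], p, [H]), ([K], mh, [])]"
    by (rule diag_eq_at[OF mk_unit_left, where n = 2 and l = "[]" and r = "[H, H]"]) simp_all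
  finally show ?thesis .
qed

text \<open>The companion of \<open>twist_mh\<close>: the associativity h (k k') = (h k) k' for
  embedded elements.\<close>

lemma twist_mk:
  "diag_eq [H, K, K] [K, H]
    [([H], mk, []), ([], p, [])]
    [([], p, [K]), ([K], p, []), ([], mk, [H])]"
proof -
  note [simp] = objs valid ends
  have "diag_eq [H, K, K] [K, H]
        [([H], mk, []), ([], p, [])]
        [([H], mk, []), ([], uk, [H, K]), ([K, H, K], uh, []), ([K], p, [H]), ([], mk, [H, H]), ([K], mh,
          [])]"
    by (rule diag_eq_at[OF incl_mul[THEN diag_eq_sym], where n = 1 and l = "[]" and r = "[]"]) simp_all
  also have "diag_eq [H, K, K] [K, H] \<dots>
        [([], uk, [H, K, K]), ([K, H], mk, []), ([K, H, K], uh, []), ([K], p, [H]), ([], mk, [H, H]),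
          ([K], mh, [])]"
    by (rule diag_eq_swaps[where ns = "[0]"]) (simp_all add: swap_at_def)
  also have "diag_eq [H, K, K] [K, H] \<dots>
        [([], uk, [H, K, K]), ([K, H, K], uh, [K]), ([K, H, K, H, K], uh, []), ([K, H, K], p, [H]), ([K,
          H], mk, [H, H]), ([K, H, K], mh, []), ([K], p, [H]), ([], mk, [H, H]), ([K], mh, [])]"
    by (rule diag_eq_at[OF incl_mul_right[THEN diag_eq_sym], where n = 1 and l = "[K, H]" and r = "[]"])
      simp_all
  also have "diag_eq [H, K, K] [K, H] \<dots>
        [([], uk, [H, K, K]), ([K, H, K], uh, [K]), ([K, H, K, H, K], uh, []), ([K], p, [H, K, H]), ([],
          mk, [H, H, K, H]), ([K], mh, [K, H]), ([K], p, [H]), ([], mk, [H, H]), ([K], mh, [])]"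
    by (rule diag_eq_at[OF mul_assoc[THEN diag_eq_sym], where n = 3 and l = "[]" and r = "[]"]) simp_all
  also have "diag_eq [H, K, K] [K, H] \<dots>
        [([], uk, [H, K, K]), ([K, H, K], uh, [K]), ([K], p, [H, K]), ([], mk, [H, H, K]), ([K], mh,
          [K]), ([K, H, K], uh, []), ([K], p, [H]), ([], mk, [H, H]), ([K], mh, [])]"
    by (rule diag_eq_swaps[where ns = "[2, 3, 4]"]) (simp_all add: swap_at_def)
  also have "diag_eq [H, K, K] [K, H] \<dots>
        [([], p, [K]), ([K, H, K], uh, []), ([K], p, [H]), ([], mk, [H, H]), ([K], mh, [])]"
    by (rule diag_eq_at[OF incl_mul, where n = 0 and l = "[]" and r = "[K]"]) simp_all
  also have "diag_eq [H, K, K] [K, H] \<dots>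
        [([], p, [K]), ([K], p, []), ([], mk, [H]), ([K, H], uh, []), ([K], mh, [])]"
    by (rule diag_eq_swaps[where ns = "[1, 2]"]) (simp_all add: swap_at_def)
  also have "diag_eq [H, K, K] [K, H] \<dots>
        [([], p, [K]), ([K], p, []), ([], mk, [H])]"
    by (rule diag_eq_at[OF mh_unit_right, where n = 3 and l = "[K]" and r = "[]"]) simp_all
  finally show ?thesis .
qed

end


section \<open>Compatibility of \<open>m_A (i \<otimes> j)\<close> with the twisted product\<close>

context
  fixes K H A mk uk mh uh p i j a ua
  assumes objs: "K \<in> obj M" "H \<in> obj M" "A \<in> obj M"
    and valid: "valid_cell mk" "valid_cell uk" "valid_cell mh" "valid_cell uh" "valid_cell p" "valid_cell
      i" "valid_cell j" "valid_cell a" "valid_cell ua"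
    and ends: "src mk = [K, K]" "tgt mk = [K]" "src uk = []" "tgt uk = [K]" "src mh = [H, H]" "tgt mh =
      [H]" "src uh = []" "tgt uh = [H]" "src p = [H, K]" "tgt p = [K, H]" "src i = [K]" "tgt i = [A]"
      "src j = [H]" "tgt j = [A]" "src a = [A, A]" "tgt a = [A]" "src ua = []" "tgt ua = [A]"
    and a_assoc: "diag_eq [A, A, A] [A] [([], a, [A]), ([], a, [])] [([A], a, []), ([], a, [])]"
    and a_unit_left: "diag_eq [A] [A] [([], ua, [A]), ([], a, [])] []"
    and i_mul: "diag_eq [K, K] [A] [([], mk, []), ([], i, [])] [([], i, [K]), ([A], i, []), ([], a, [])]"
    and i_uni: "diag_eq [] [A] [([], uk, []), ([], i, [])] [([], ua, [])]"
    and j_mul: "diag_eq [H, H] [A] [([], mh, []), ([], j, [])] [([], j, [H]), ([A], j, []), ([], a, [])]"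
    and j_uni: "diag_eq [] [A] [([], uh, []), ([], j, [])] [([], ua, [])]"
    and p_fact: "diag_eq [H, K] [A] [([], p, []), ([], i, [H]), ([A], j, []), ([], a, [])] [([], j, [K]),
      ([A], i, []), ([], a, [])]"
begin

lemma factorization_unit:
  "diag_eq [] [A]
    [([], uk, []), ([K], uh, []), ([], i, [H]), ([A], j, []), ([], a, [])]
    [([], ua, [])]"
proof -
  note [simp] = objs valid ends
  have "diag_eq [] [A]
        [([], uk, []), ([K], uh, []), ([], i, [H]), ([A], j, []), ([], a, [])]
        [([], uk, []), ([], i, []), ([A], uh, []), ([A], j, []), ([], a, [])]"
    by (rule diag_eq_swaps[where ns = "[1]"]) (simp_all add: swap_at_def)
  also have "diag_eq [] [A] \<dots>
        [([], ua, []), ([A], uh, []), ([A], j, []), ([], a, [])]"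
    by (rule diag_eq_at[OF i_uni, where n = 0 and l = "[]" and r = "[]"]) simp_all
  also have "diag_eq [] [A] \<dots>
        [([], ua, []), ([A], ua, []), ([], a, [])]"
    by (rule diag_eq_at[OF j_uni, where n = 1 and l = "[A]" and r = "[]"]) simp_all
  also have "diag_eq [] [A] \<dots>
        [([], ua, []), ([], ua, [A]), ([], a, [])]"
    by (rule diag_eq_swaps[where ns = "[0]"]) (simp_all add: swap_at_def)
  also have "diag_eq [] [A] \<dots>
        [([], ua, [])]"
    by (rule diag_eq_at[OF a_unit_left, where n = 1 and l = "[]" and r = "[]"]) simp_all
  finally show ?thesis .
qed

text \<open>In elements, (x y)(z j(h)) = x((y z) j(h)). It isolates the middle product y z, where
  \<open>p_fact\<close> can be applied.\<close>

lemma mul_reassoc: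
  "diag_eq [A, A, A, H] [A]
    [([], a, [A, H]), ([A, A], j, []), ([A], a, []), ([], a, [])]
    [([A], a, [H]), ([A, A], j, []), ([A], a, []), ([], a, [])]"
proof -
  note [simp] = objs valid ends
  have "diag_eq [A, A, A, H] [A]
        [([], a, [A, H]), ([A, A], j, []), ([A], a, []), ([], a, [])]
        [([A, A, A], j, []), ([A, A], a, []), ([], a, [A]), ([], a, [])]"
    by (rule diag_eq_swaps[where ns = "[0, 1]"]) (simp_all add: swap_at_def)
  also have "diag_eq [A, A, A, H] [A] \<dots>
        [([A, A, A], j, []), ([A, A], a, []), ([A], a, []), ([], a, [])]"
    by (rule diag_eq_at[OF a_assoc, where n = 2 and l = "[]" and r = "[]"]) simp_all
  also have "diag_eq [A, A, A, H] [A] \<dots>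
        [([A, A, A], j, []), ([A], a, [A]), ([A], a, []), ([], a, [])]"
    by (rule diag_eq_at[OF a_assoc[THEN diag_eq_sym], where n = 1 and l = "[A]" and r = "[]"]) simp_all
  also have "diag_eq [A, A, A, H] [A] \<dots>
        [([A], a, [H]), ([A, A], j, []), ([A], a, []), ([], a, [])]"
    by (rule diag_eq_swaps[where ns = "[0]"]) (simp_all add: swap_at_def)
  finally show ?thesis .
qed

text \<open>Write k1, h1 for the outputs of \<open>p\<close> at h, k'. Then i(k k1) j(h1 h') = i(k)
  (i(k1) j(h1)) j(h') = i(k) (j(h) i(k')) j(h'); the last step is the defining property of the
  twist.\<close>

lemma factorization_mul:
  "diag_eq [K, H, K, H] [A]
    [([K], p, [H]), ([], mk, [H, H]), ([K], mh, []), ([], i, [H]), ([A], j, []), ([], a, [])]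
    [([], i, [H, K, H]), ([A], j, [K, H]), ([], a, [K, H]), ([A], i, [H]), ([A, A], j, []), ([A], a, []),
      ([], a, [])]"
proof -
  note [simp] = objs valid ends
  have "diag_eq [K, H, K, H] [A]
        [([K], p, [H]), ([], mk, [H, H]), ([K], mh, []), ([], i, [H]), ([A], j, []), ([], a, [])]
        [([K], p, [H]), ([], mk, [H, H]), ([], i, [H, H]), ([A], mh, []), ([A], j, []), ([], a, [])]"
    by (rule diag_eq_swaps[where ns = "[2]"]) (simp_all add: swap_at_def)
  also have "diag_eq [K, H, K, H] [A] \<dots>
        [([K], p, [H]), ([], mk, [H, H]), ([], i, [H, H]), ([A], j, [H]), ([A, A], j, []), ([A], a, []),
          ([], a, [])]"
    by (rule diag_eq_at[OF j_mul, where n = 3 and l = "[A]" and r = "[]"]) simp_all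
  also have "diag_eq [K, H, K, H] [A] \<dots>
        [([K], p, [H]), ([], i, [K, H, H]), ([A], i, [H, H]), ([], a, [H, H]), ([A], j, [H]), ([A, A], j,
          []), ([A], a, []), ([], a, [])]"
    by (rule diag_eq_at[OF i_mul, where n = 1 and l = "[]" and r = "[H, H]"]) simp_all
  also have "diag_eq [K, H, K, H] [A] \<dots>
        [([], i, [H, K, H]), ([A], p, [H]), ([A], i, [H, H]), ([A, A], j, [H]), ([], a, [A, H]), ([A, A],
          j, []), ([A], a, []), ([], a, [])]"
    by (rule diag_eq_swaps[where ns = "[0, 3]"]) (simp_all add: swap_at_def)
  also have "diag_eq [K, H, K, H] [A] \<dots>
        [([], i, [H, K, H]), ([A], p, [H]), ([A], i, [H, H]), ([A, A], j, [H]), ([A], a, [H]), ([A, A],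
          j, []), ([A], a, []), ([], a, [])]"
    by (rule diag_eq_at[OF mul_reassoc, where n = 4 and l = "[]" and r = "[]"]) simp_all
  also have "diag_eq [K, H, K, H] [A] \<dots>
        [([], i, [H, K, H]), ([A], j, [K, H]), ([A, A], i, [H]), ([A], a, [H]), ([A, A], j, []), ([A], a,
          []), ([], a, [])]"
    by (rule diag_eq_at[OF p_fact, where n = 1 and l = "[A]" and r = "[H]"]) simp_all
  also have "diag_eq [K, H, K, H] [A] \<dots>
        [([], i, [H, K, H]), ([A], j, [K, H]), ([A, A], i, [H]), ([], a, [A, H]), ([A, A], j, []), ([A],
          a, []), ([], a, [])]"
    by (rule diag_eq_at[OF mul_reassoc[THEN diag_eq_sym], where n = 3 and l = "[]" and r = "[]"]) simp_all
  also have "diag_eq [K, H, K, H] [A] \<dots>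
        [([], i, [H, K, H]), ([A], j, [K, H]), ([], a, [K, H]), ([A], i, [H]), ([A, A], j, []), ([A], a,
          []), ([], a, [])]"
    by (rule diag_eq_swaps[where ns = "[2]"]) (simp_all add: swap_at_def)
  finally show ?thesis .
qed

end


section \<open>Transport of the monoid axioms along an arrow\<close>

context
  fixes A B m u f a ua
  assumes objs: "A \<in> obj M" "B \<in> obj M"
    and valid: "valid_cell m" "valid_cell u" "valid_cell f" "valid_cell a" "valid_cell ua"
    and ends: "src m = [B, B]" "tgt m = [B]" "src u = []" "tgt u = [B]" "src f = [B]" "tgt f = [A]" "src
      a = [A, A]" "tgt a = [A]" "src ua = []" "tgt ua = [A]"
    and a_assoc: "diag_eq [A, A, A] [A] [([], a, [A]), ([], a, [])] [([A], a, []), ([], a, [])]"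
    and a_unit_left: "diag_eq [A] [A] [([], ua, [A]), ([], a, [])] []"
    and a_unit_right: "diag_eq [A] [A] [([A], ua, []), ([], a, [])] []"
    and f_mul: "diag_eq [B, B] [A] [([], m, []), ([], f, [])] [([], f, [B]), ([A], f, []), ([], a, [])]"
    and f_uni: "diag_eq [] [A] [([], u, []), ([], f, [])] [([], ua, [])]"
begin

text \<open>The law is obtained only after applying \<open>f\<close>; it is cancelled later, where
  \<open>f\<close> is invertible.\<close>

lemma transport_assoc:
  "diag_eq [B, B, B] [A]
    [([], m, [B]), ([], m, []), ([], f, [])]
    [([B], m, []), ([], m, []), ([], f, [])]"
proof -
  note [simp] = objs valid ends
  have "diag_eq [B, B, B] [A]
        [([], m, [B]), ([], m, []), ([], f, [])]
        [([], m, [B]), ([], f, [B]), ([A], f, []), ([], a, [])]"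
    by (rule diag_eq_at[OF f_mul, where n = 1 and l = "[]" and r = "[]"]) simp_all
  also have "diag_eq [B, B, B] [A] \<dots>
        [([], f, [B, B]), ([A], f, [B]), ([], a, [B]), ([A], f, []), ([], a, [])]"
    by (rule diag_eq_at[OF f_mul, where n = 0 and l = "[]" and r = "[B]"]) simp_all
  also have "diag_eq [B, B, B] [A] \<dots>
        [([], f, [B, B]), ([A], f, [B]), ([A, A], f, []), ([], a, [A]), ([], a, [])]"
    by (rule diag_eq_swaps[where ns = "[2]"]) (simp_all add: swap_at_def)
  also have "diag_eq [B, B, B] [A] \<dots>
        [([], f, [B, B]), ([A], f, [B]), ([A, A], f, []), ([A], a, []), ([], a, [])]"
    by (rule diag_eq_at[OF a_assoc, where n = 3 and l = "[]" and r = "[]"]) simp_all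
  also have "diag_eq [B, B, B] [A] \<dots>
        [([], f, [B, B]), ([A], m, []), ([A], f, []), ([], a, [])]"
    by (rule diag_eq_at[OF f_mul[THEN diag_eq_sym], where n = 1 and l = "[A]" and r = "[]"]) simp_all
  also have "diag_eq [B, B, B] [A] \<dots>
        [([B], m, []), ([], f, [B]), ([A], f, []), ([], a, [])]"
    by (rule diag_eq_swaps[where ns = "[0]"]) (simp_all add: swap_at_def)
  also have "diag_eq [B, B, B] [A] \<dots>
        [([B], m, []), ([], m, []), ([], f, [])]"
    by (rule diag_eq_at[OF f_mul[THEN diag_eq_sym], where n = 1 and l = "[]" and r = "[]"]) simp_all
  finally show ?thesis .
qed

lemma transport_unit_left:
  "diag_eq [B] [A]
    [([], u, [B]), ([], m, []), ([], f, [])]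
    [([], f, [])]"
proof -
  note [simp] = objs valid ends
  have "diag_eq [B] [A]
        [([], u, [B]), ([], m, []), ([], f, [])]
        [([], u, [B]), ([], f, [B]), ([A], f, []), ([], a, [])]"
    by (rule diag_eq_at[OF f_mul, where n = 1 and l = "[]" and r = "[]"]) simp_all
  also have "diag_eq [B] [A] \<dots>
        [([], ua, [B]), ([A], f, []), ([], a, [])]"
    by (rule diag_eq_at[OF f_uni, where n = 0 and l = "[]" and r = "[B]"]) simp_all
  also have "diag_eq [B] [A] \<dots>
        [([], f, []), ([], ua, [A]), ([], a, [])]"
    by (rule diag_eq_swaps[where ns = "[0]"]) (simp_all add: swap_at_def)
  also have "diag_eq [B] [A] \<dots>
        [([], f, [])]"
    by (rule diag_eq_at[OF a_unit_left, where n = 1 and l = "[]" and r = "[]"]) simp_all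
  finally show ?thesis .
qed

lemma transport_unit_right:
  "diag_eq [B] [A]
    [([B], u, []), ([], m, []), ([], f, [])]
    [([], f, [])]"
proof -
  note [simp] = objs valid ends
  have "diag_eq [B] [A]
        [([B], u, []), ([], m, []), ([], f, [])]
        [([B], u, []), ([], f, [B]), ([A], f, []), ([], a, [])]"
    by (rule diag_eq_at[OF f_mul, where n = 1 and l = "[]" and r = "[]"]) simp_all
  also have "diag_eq [B] [A] \<dots>
        [([], f, []), ([A], u, []), ([A], f, []), ([], a, [])]"
    by (rule diag_eq_swaps[where ns = "[0]"]) (simp_all add: swap_at_def)
  also have "diag_eq [B] [A] \<dots>
        [([], f, []), ([A], ua, []), ([], a, [])]"
    by (rule diag_eq_at[OF f_uni, where n = 1 and l = "[A]" and r = "[]"]) simp_all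
  also have "diag_eq [B] [A] \<dots>
        [([], f, [])]"
    by (rule diag_eq_at[OF a_unit_right, where n = 1 and l = "[]" and r = "[]"]) simp_all
  finally show ?thesis .
qed

end

end


section \<open>Twisted tensor products of monoids\<close>

context monoidal_category
begin

text \<open>\<open>inv_arr\<close> mentions the domain and codomain, so these too are variables tied
  by equations; the rule then applies however the objects are written.\<close>

lemma denotes_associator_inv:
  assumes "set (leaves x) \<subseteq> obj M" "set (leaves y) \<subseteq> obj M" "set (leaves z) \<subseteq> obj M"
    and "X = tensor_of x" "Y = tensor_of y" "Z = tensor_of z"
    and "S = (X \<otimes> Y) \<otimes> Z" "T = X \<otimes> (Y \<otimes> Z)"
  shows "denotes (inv_arr M S T (associator M X Y Z)) (Prod x (Prod y z)) (Prod (Prod x y) z) []"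
  unfolding assms(7,8)
  by (rule denotes_inv[OF denotes_associator[OF assms(1-6)] associator_iso])
    (simp_all add: assms tensor_of_obj)

lemma denotes_lunit_inv:
  assumes "set (leaves s) \<subseteq> obj M" "X = tensor_of s" "S = tunit M \<otimes> X"
  shows "denotes (inv_arr M S X (lunit M X)) s (Prod One s) []"
  unfolding assms(3)
  by (rule denotes_inv[OF denotes_lunit[OF assms(1,2)] lunit_iso]) (simp_all add: assms tensor_of_obj)

lemma denotes_runit_inv:
  assumes "set (leaves s) \<subseteq> obj M" "X = tensor_of s" "S = X \<otimes> tunit M"
  shows "denotes (inv_arr M S X (runit M X)) s (Prod s One) []"
  unfolding assms(3)
  by (rule denotes_inv[OF denotes_runit[OF assms(1,2)] runit_iso]) (simp_all add: assms tensor_of_obj)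

lemmas denotes_intros = denotes_comp denotes_tensor denotes_associator denotes_associator_inv
  denotes_lunit denotes_lunit_inv denotes_runit denotes_runit_inv denotes_ident

text \<open>The introduction rules synthesise the lists \<open>d'\<close> and \<open>e'\<close>,
  which are compared with the wanted lists only afterwards.\<close>

lemma denotes_eq_iff_diag:
  assumes "denotes f s t d'" "denotes g s t e'" "d' = d" "e' = e"
  shows "f = g \<longleftrightarrow> diag_eq (leaves s) (leaves t) d e"
  using denotes_eq_iff assms by simp

lemma denotes_cong: "\<lbrakk>denotes f s t d'; d' = d\<rbrakk> \<Longrightarrow> denotes f s t d"
  by simp

text \<open>The carrier is an arbitrary word, so that one statement serves both an atomic carrier
  and the twisted product, whose carrier is a pair of strings.\<close>

lemma is_monoid_iff_diag:
  assumes m: "denotes (mmul A) (Prod t t) t dm" and u: "denotes (muni A) One t du"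
    and X: "mcar A = tensor_of t"
  shows "is_monoid M A \<longleftrightarrow>
    diag_eq (leaves t @ leaves t @ leaves t) (leaves t)
      (within [] dm (leaves t) @ dm) (within (leaves t) dm [] @ dm) \<and>
    diag_eq (leaves t) (leaves t) (within [] du (leaves t) @ dm) [] \<and>
    diag_eq (leaves t) (leaves t) (within (leaves t) du [] @ dm) []"
proof -
  have t: "set (leaves t) \<subseteq> obj M" using u path_objs[of du "[]" "leaves t"] by (simp add: denotes_def)
  have h: "mcar A \<in> obj M" "mmul A \<in> hom M (mcar A \<otimes> mcar A) (mcar A)"
    "muni A \<in> hom M (tunit M) (mcar A)"
    using m u tensor_of_obj[OF t] by (auto simp: denotes_def X)
  have "mmul A \<cdot> (mmul A \<boxtimes> ident M (mcar A))
        = mmul A \<cdot> (ident M (mcar A) \<boxtimes> mmul A) \<cdot> associator M (mcar A) (mcar A) (mcar A) \<longleftrightarrow>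
      diag_eq (leaves (Prod (Prod t t) t)) (leaves t)
        (within [] dm (leaves t) @ dm) (within (leaves t) dm [] @ dm)"
    by (rule denotes_eq_iff_diag, (rule denotes_intros m u | simp add: t X)+)
  moreover have "mmul A \<cdot> (muni A \<boxtimes> ident M (mcar A)) = lunit M (mcar A) \<longleftrightarrow>
      diag_eq (leaves (Prod One t)) (leaves t) (within [] du (leaves t) @ dm) []"
    by (rule denotes_eq_iff_diag, (rule denotes_intros m u | simp add: t X)+)
  moreover have "mmul A \<cdot> (ident M (mcar A) \<boxtimes> muni A) = runit M (mcar A) \<longleftrightarrow>
      diag_eq (leaves (Prod t One)) (leaves t) (within (leaves t) du [] @ dm) []"
    by (rule denotes_eq_iff_diag, (rule denotes_intros m u | simp add: t X)+)
  ultimately show ?thesis using h by (simp add: is_monoid_def Let_def)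
qed

lemma is_monoid_D:
  assumes "is_monoid M A"
  shows "mcar A \<in> obj M" "mmul A \<in> hom M (mcar A \<otimes> mcar A) (mcar A)" "muni A \<in> hom M (tunit M) (mcar A)"
  using assms by (simp_all add: is_monoid_def Let_def)

abbreviation mul_cell where
  "mul_cell A \<equiv> cell_of (Prod (Var (mcar A)) (Var (mcar A))) (Var (mcar A)) (mmul A)"

abbreviation uni_cell where
  "uni_cell A \<equiv> cell_of One (Var (mcar A)) (muni A)"

lemma monoid_cells:
  assumes "is_monoid M A"
  shows "denotes (mmul A) (Prod (Var (mcar A)) (Var (mcar A))) (Var (mcar A)) [([], mul_cell A, [])]"
    and "denotes (muni A) One (Var (mcar A)) [([], uni_cell A, [])]"
    and "valid_cell (mul_cell A)" "valid_cell (uni_cell A)"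
  using is_monoid_D[OF assms] by (auto intro!: denotes_cell_of valid_cell_of)

lemma monoid_diags:
  assumes "is_monoid M A"
  shows "diag_eq [mcar A, mcar A, mcar A] [mcar A]
      [([], mul_cell A, [mcar A]), ([], mul_cell A, [])] [([mcar A], mul_cell A, []), ([], mul_cell A, [])]"
    and "diag_eq [mcar A] [mcar A] [([], uni_cell A, [mcar A]), ([], mul_cell A, [])] []"
    and "diag_eq [mcar A] [mcar A] [([mcar A], uni_cell A, []), ([], mul_cell A, [])] []"
  using is_monoid_iff_diag[OF monoid_cells(1,2)[OF assms]] assms by simp_all

section \<open>Equivalence of the monoid axioms and the twisting equations\<close>

context
  fixes K H \<psi>
  assumes K: "is_monoid M K" and H: "is_monoid M H"
    and \<psi>: "\<psi> \<in> hom M (mcar H \<otimes> mcar K) (mcar K \<otimes> mcar H)"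
begin

abbreviation "twist_cell \<equiv> cell_of (Prod (Var (mcar H)) (Var (mcar K))) (Prod (Var (mcar K)) (Var (mcar
  H))) \<psi>"

abbreviation twist_algebra :: "('o, 'm) monoid_data" where
  "twist_algebra \<equiv> \<lparr>mcar = mcar K \<otimes> mcar H, mmul = twist_mul M K H \<psi>, muni = twist_uni M K H\<rparr>"

lemma twist_cell:
  "denotes \<psi> (Prod (Var (mcar H)) (Var (mcar K))) (Prod (Var (mcar K)) (Var (mcar H))) [([], twist_cell, [])]"
  "valid_cell twist_cell"
  using is_monoid_D(1)[OF K] is_monoid_D(1)[OF H] \<psi> by (auto intro!: denotes_cell_of valid_cell_of)

lemmas twist_objs = is_monoid_D(1)[OF K] is_monoid_D(1)[OF H]

lemmas cells_denote = monoid_cells(1,2)[OF K] monoid_cells(1,2)[OF H] twist_cell(1)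

text \<open>The four constraint factors of \<open>twist_mul\<close> leave no trace;
  \<open>m_K\<close> precedes \<open>m_H\<close> by the convention in
  \<open>denotes_tensor\<close>.\<close>

lemma denotes_twist_mul:
  defines "t \<equiv> Prod (Var (mcar K)) (Var (mcar H))"
  shows "denotes (twist_mul M K H \<psi>) (Prod t t) t
    [([mcar K], twist_cell, [mcar H]), ([], mul_cell K, [mcar H, mcar H]), ([mcar K], mul_cell H, [])]"
  unfolding t_def twist_mul_def Let_def
  by (rule denotes_cong, (rule denotes_intros cells_denote | simp add: twist_objs)+)

lemma denotes_twist_uni:
  "denotes (twist_uni M K H) One (Prod (Var (mcar K)) (Var (mcar H)))
    [([], uni_cell K, []), ([mcar K], uni_cell H, [])]"
  unfolding twist_uni_def
  by (rule denotes_cong, (rule denotes_intros cells_denote | simp add: twist_objs)+)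

lemmas is_monoid_twist_iff_diag = is_monoid_iff_diag[where A = twist_algebra, simplified,
  OF denotes_twist_mul denotes_twist_uni, simplified]

lemma twisting_equations_iff_diag:
  "twisting_equations M H K \<psi> \<longleftrightarrow>
    diag_eq [mcar H, mcar H, mcar K] [mcar K, mcar H]
      [([], mul_cell H, [mcar K]), ([], twist_cell, [])]
      [([mcar H], twist_cell, []), ([], twist_cell, [mcar H]), ([mcar K], mul_cell H, [])] \<and>
    diag_eq [mcar K] [mcar K, mcar H]
      [([], uni_cell H, [mcar K]), ([], twist_cell, [])] [([mcar K], uni_cell H, [])] \<and>
    diag_eq [mcar H, mcar K, mcar K] [mcar K, mcar H]
      [([mcar H], mul_cell K, []), ([], twist_cell, [])]
      [([], twist_cell, [mcar K]), ([mcar K], twist_cell, []), ([], mul_cell K, [mcar H])] \<and>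
    diag_eq [mcar H] [mcar K, mcar H]
      [([mcar H], uni_cell K, []), ([], twist_cell, [])] [([], uni_cell K, [mcar H])]"
  (is "_ \<longleftrightarrow> ?mH \<and> ?uH \<and> ?mK \<and> ?uK")
proof -
  let ?X = "mcar K" and ?Y = "mcar H"
  have "\<psi> \<cdot> (mmul H \<boxtimes> ident M ?X)
       = (ident M ?X \<boxtimes> mmul H) \<cdot> associator M ?X ?Y ?Y \<cdot> (\<psi> \<boxtimes> ident M ?Y) \<cdot>
         associator_inv M ?Y ?X ?Y \<cdot> (ident M ?Y \<boxtimes> \<psi>) \<cdot> associator M ?Y ?Y ?X
    \<longleftrightarrow> diag_eq (leaves (Prod (Prod (Var ?Y) (Var ?Y)) (Var ?X))) (leaves (Prod (Var ?X) (Var ?Y)))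
      [([], mul_cell H, [mcar K]), ([], twist_cell, [])]
      [([mcar H], twist_cell, []), ([], twist_cell, [mcar H]), ([mcar K], mul_cell H, [])]"
    by (rule denotes_eq_iff_diag, (rule denotes_intros cells_denote | simp add: twist_objs)+)
  moreover have "\<psi> \<cdot> (muni H \<boxtimes> ident M ?X) \<cdot> lunit_inv M ?X = (ident M ?X \<boxtimes> muni H) \<cdot> runit_inv M ?X
    \<longleftrightarrow> diag_eq (leaves (Var ?X)) (leaves (Prod (Var ?X) (Var ?Y)))
      [([], uni_cell H, [mcar K]), ([], twist_cell, [])] [([mcar K], uni_cell H, [])]"
    by (rule denotes_eq_iff_diag, (rule denotes_intros cells_denote | simp add: twist_objs)+)
  moreover have "\<psi> \<cdot> (ident M ?Y \<boxtimes> mmul K)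
       = (mmul K \<boxtimes> ident M ?Y) \<cdot> associator_inv M ?X ?X ?Y \<cdot> (ident M ?X \<boxtimes> \<psi>) \<cdot>
         associator M ?X ?Y ?X \<cdot> (\<psi> \<boxtimes> ident M ?X) \<cdot> associator_inv M ?Y ?X ?X
    \<longleftrightarrow> diag_eq (leaves (Prod (Var ?Y) (Prod (Var ?X) (Var ?X)))) (leaves (Prod (Var ?X) (Var ?Y)))
      [([mcar H], mul_cell K, []), ([], twist_cell, [])]
      [([], twist_cell, [mcar K]), ([mcar K], twist_cell, []), ([], mul_cell K, [mcar H])]"
    by (rule denotes_eq_iff_diag, (rule denotes_intros cells_denote | simp add: twist_objs)+)
  moreover have "\<psi> \<cdot> (ident M ?Y \<boxtimes> muni K) \<cdot> runit_inv M ?Y = (muni K \<boxtimes> ident M ?Y) \<cdot> lunit_inv M ?Y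
    \<longleftrightarrow> diag_eq (leaves (Var ?Y)) (leaves (Prod (Var ?X) (Var ?Y)))
      [([mcar H], uni_cell K, []), ([], twist_cell, [])] [([], uni_cell K, [mcar H])]"
    by (rule denotes_eq_iff_diag, (rule denotes_intros cells_denote | simp add: twist_objs)+)
  ultimately show ?thesis unfolding twisting_equations_def Let_def by simp
qed

lemmas twist_valid = monoid_cells(3,4)[OF K] monoid_cells(3,4)[OF H] twist_cell(2)

theorem is_monoid_twist_iff: "is_monoid M twist_algebra \<longleftrightarrow> twisting_equations M H K \<psi>"
proof
  assume "twisting_equations M H K \<psi>"
  then show "is_monoid M twist_algebra"
    unfolding is_monoid_twist_iff_diag twisting_equations_iff_diag
    using twisted_assoc[of "mcar K" "mcar H" "mul_cell K" "uni_cell K" "mul_cell H" "uni_cell H" twist_cell]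
      twisted_unit_left[of "mcar K" "mcar H" "mul_cell K" "uni_cell K" "mul_cell H" "uni_cell H" twist_cell]
      twisted_unit_right[of "mcar K" "mcar H" "mul_cell K" "uni_cell K" "mul_cell H" "uni_cell H" twist_cell]
    by (simp add: twist_objs twist_valid monoid_diags[OF K] monoid_diags[OF H])
next
  assume "is_monoid M twist_algebra"
  then show "twisting_equations M H K \<psi>"
    unfolding is_monoid_twist_iff_diag twisting_equations_iff_diag
    using twist_mh[of "mcar K" "mcar H" "mul_cell K" "uni_cell K" "mul_cell H" "uni_cell H" twist_cell]
      twist_uh[of "mcar K" "mcar H" "mul_cell K" "uni_cell K" "mul_cell H" "uni_cell H" twist_cell]
      twist_mk[of "mcar K" "mcar H" "mul_cell K" "uni_cell K" "mul_cell H" "uni_cell H" twist_cell]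
      twist_uk[of "mcar K" "mcar H" "mul_cell K" "uni_cell K" "mul_cell H" "uni_cell H" twist_cell]
    by (simp add: twist_objs twist_valid monoid_diags[OF K] monoid_diags[OF H])
qed

text \<open>Solves the twisted multiplication for \<open>\<psi>\<close>. It is available in any
  monoidal category, hence in \<open>D\<close>, where it can be used before \<open>\<psi>\<close> is
  known to be an arrow of \<open>Comon D\<close>.\<close>

lemma twist_mul_units:
  assumes "is_monoid M twist_algebra"
  shows "twist_mul M K H \<psi> \<cdot>
      (((muni K \<boxtimes> ident M (mcar H)) \<cdot> lunit_inv M (mcar H)) \<boxtimes>
       ((ident M (mcar K) \<boxtimes> muni H) \<cdot> runit_inv M (mcar K))) = \<psi>"
proof -
  let ?X = "mcar K" and ?Y = "mcar H"
  have "twist_mul M K H \<psi> \<cdot> (((muni K \<boxtimes> ident M ?Y) \<cdot> lunit_inv M ?Y) \<boxtimes>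
      ((ident M ?X \<boxtimes> muni H) \<cdot> runit_inv M ?X)) = \<psi> \<longleftrightarrow>
    diag_eq (leaves (Prod (Var ?Y) (Var ?X))) (leaves (Prod (Var ?X) (Var ?Y)))
     [([], uni_cell K, [?Y, ?X]), ([?X, ?Y, ?X], uni_cell H, []), ([?X], twist_cell, [?Y]),
      ([], mul_cell K, [?Y, ?Y]), ([?X], mul_cell H, [])]
     [([], twist_cell, [])]"
    by (rule denotes_eq_iff_diag, (rule denotes_intros cells_denote denotes_twist_mul | simp add:
      twist_objs)+)
  then show ?thesis
    using assms incl_mul[of "mcar K" "mcar H" "mul_cell K" "uni_cell K" "mul_cell H" "uni_cell H" twist_cell]
    unfolding is_monoid_twist_iff_diag
    by (simp add: twist_objs twist_valid monoid_diags[OF K] monoid_diags[OF H])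
qed

end

lemma monoid_hom_D:
  assumes "monoid_hom M A B f"
  shows "is_monoid M A" "is_monoid M B" "f \<in> hom M (mcar A) (mcar B)"
    "f \<cdot> mmul A = mmul B \<cdot> (f \<boxtimes> f)" "f \<cdot> muni A = muni B"
  using assms by (simp_all add: monoid_hom_def)

text \<open>Each axiom for B becomes, after composition with \<open>f\<close>, a consequence of the
  axiom for A, and the invertible \<open>f\<close> can be cancelled.\<close>

lemma is_monoid_transport:
  assumes A: "is_monoid M A" and f: "invertible M (mcar B) (mcar A) f"
    and m: "mmul B \<in> hom M (mcar B \<otimes> mcar B) (mcar B)" and u: "muni B \<in> hom M (tunit M) (mcar B)"
    and fm: "f \<cdot> mmul B = mmul A \<cdot> (f \<boxtimes> f)" and fu: "f \<cdot> muni B = muni A"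
  shows "is_monoid M B"
proof -
  let ?X = "Var (mcar B)" and ?Y = "Var (mcar A)"
  let ?m = "mul_cell B" and ?u = "uni_cell B" and ?f = "cell_of ?X ?Y f"
  note hf = invertible_hom[OF f]
  have o [simp]: "mcar A \<in> obj M" "mcar B \<in> obj M" using hom_objs[OF hf] by auto
  have d: "denotes (mmul B) (Prod ?X ?X) ?X [([], ?m, [])]" "denotes (muni B) One ?X [([], ?u, [])]"
    "denotes f ?X ?Y [([], ?f, [])]"
    and v: "valid_cell ?m" "valid_cell ?u" "valid_cell ?f"
    using m u hf by (auto intro!: denotes_cell_of valid_cell_of)
  note ds = denotes_intros d monoid_cells(1,2)[OF A]
  have "f \<cdot> mmul B = mmul A \<cdot> (f \<boxtimes> f) \<longleftrightarrow> diag_eq (leaves (Prod ?X ?X)) (leaves ?Y)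
      [([], ?m, []), ([], ?f, [])] [([], ?f, [mcar B]), ([mcar A], ?f, []), ([], mul_cell A, [])]"
    by (rule denotes_eq_iff_diag, (rule ds | simp)+)
  moreover have "f \<cdot> muni B = muni A \<longleftrightarrow> diag_eq (leaves One) (leaves ?Y)
      [([], ?u, []), ([], ?f, [])] [([], uni_cell A, [])]"
    by (rule denotes_eq_iff_diag, (rule ds | simp)+)
  ultimately have r: "diag_eq [mcar B, mcar B] [mcar A]
      [([], ?m, []), ([], ?f, [])] [([], ?f, [mcar B]), ([mcar A], ?f, []), ([], mul_cell A, [])]"
    "diag_eq [] [mcar A] [([], ?u, []), ([], ?f, [])] [([], uni_cell A, [])]"
    using fm fu by simp_all
  note tr = o v monoid_cells(3,4)[OF A] monoid_diags[OF A] r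
  have "f \<cdot> mmul B \<cdot> (mmul B \<boxtimes> ident M (mcar B))
      = f \<cdot> mmul B \<cdot> (ident M (mcar B) \<boxtimes> mmul B) \<cdot> associator M (mcar B) (mcar B) (mcar B) \<longleftrightarrow>
    diag_eq (leaves (Prod (Prod ?X ?X) ?X)) (leaves ?Y)
      [([], ?m, [mcar B]), ([], ?m, []), ([], ?f, [])] [([mcar B], ?m, []), ([], ?m, []), ([], ?f, [])]"
    by (rule denotes_eq_iff_diag, (rule ds | simp)+)
  then have 1: "f \<cdot> mmul B \<cdot> (mmul B \<boxtimes> ident M (mcar B))
      = f \<cdot> mmul B \<cdot> (ident M (mcar B) \<boxtimes> mmul B) \<cdot> associator M (mcar B) (mcar B) (mcar B)"
    using transport_assoc[of "mcar A" "mcar B" ?m ?u ?f "mul_cell A" "uni_cell A"] by (simp add: tr)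
  have "f \<cdot> mmul B \<cdot> (muni B \<boxtimes> ident M (mcar B)) = f \<cdot> lunit M (mcar B) \<longleftrightarrow>
    diag_eq (leaves (Prod One ?X)) (leaves ?Y)
      [([], ?u, [mcar B]), ([], ?m, []), ([], ?f, [])] [([], ?f, [])]"
    by (rule denotes_eq_iff_diag, (rule ds | simp)+)
  then have 2: "f \<cdot> mmul B \<cdot> (muni B \<boxtimes> ident M (mcar B)) = f \<cdot> lunit M (mcar B)"
    using transport_unit_left[of "mcar A" "mcar B" ?m ?u ?f "mul_cell A" "uni_cell A"] by (simp add: tr)
  have "f \<cdot> mmul B \<cdot> (ident M (mcar B) \<boxtimes> muni B) = f \<cdot> runit M (mcar B) \<longleftrightarrow>
    diag_eq (leaves (Prod ?X One)) (leaves ?Y)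
      [([mcar B], ?u, []), ([], ?m, []), ([], ?f, [])] [([], ?f, [])]"
    by (rule denotes_eq_iff_diag, (rule ds | simp)+)
  then have 3: "f \<cdot> mmul B \<cdot> (ident M (mcar B) \<boxtimes> muni B) = f \<cdot> runit M (mcar B)"
    using transport_unit_right[of "mcar A" "mcar B" ?m ?u ?f "mul_cell A" "uni_cell A"] by (simp add: tr)
  note hs = homs m u o
  show ?thesis
    unfolding is_monoid_def Let_def
    by (intro conjI m u o invertible_cancel_left[OF f _ _ 1] invertible_cancel_left[OF f _ _ 2]
        invertible_cancel_left[OF f _ _ 3]) (rule hs)+
qed

text \<open>The monoid axioms of the twisted product are pulled back from A along
  \<open>\<phi>\<close>; the twisting equations do not enter.\<close>

theorem monoid_factorization:
  assumes i: "monoid_hom M K A i" and j: "monoid_hom M H A j"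
    and \<phi>: "\<phi> = mmul A \<cdot> (i \<boxtimes> j)" and inv: "invertible M (mcar K \<otimes> mcar H) (mcar A) \<phi>"
    and \<psi>: "\<psi> = inv_arr M (mcar K \<otimes> mcar H) (mcar A) \<phi> \<cdot> mmul A \<cdot> (j \<boxtimes> i)"
  shows "monoid_hom M \<lparr>mcar = mcar K \<otimes> mcar H, mmul = twist_mul M K H \<psi>, muni = twist_uni M K H\<rparr> A \<phi>"
proof -
  note K = monoid_hom_D(1)[OF i] and H = monoid_hom_D(1)[OF j] and A = monoid_hom_D(2)[OF i]
  note hi = monoid_hom_D(3)[OF i] and hj = monoid_hom_D(3)[OF j]
  note o [simp] = is_monoid_D(1)[OF K] is_monoid_D(1)[OF H] is_monoid_D(1)[OF A]
  have h\<psi>: "\<psi> \<in> hom M (mcar H \<otimes> mcar K) (mcar K \<otimes> mcar H)"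
    unfolding \<psi> by (rule homs inv_arr_hom[OF inv] hi hj is_monoid_D(2)[OF A])+
  \<comment> \<open>The only property of \<open>\<psi>\<close> that the diagrams see: crossing and
    then multiplying as \<open>i\<close>, \<open>j\<close> is multiplying as \<open>j\<close>,
    \<open>i\<close>.\<close>
  have \<phi>\<psi>: "(mmul A \<cdot> (i \<boxtimes> j)) \<cdot> \<psi> = mmul A \<cdot> (j \<boxtimes> i)"
    unfolding \<psi> \<phi>[symmetric]
    by (rule inv_arr_right_comp[OF inv]) (rule homs hi hj is_monoid_D(2)[OF A])+
  let ?X = "Var (mcar K)" and ?Y = "Var (mcar H)" and ?Z = "Var (mcar A)"
  let ?i = "cell_of ?X ?Z i" and ?j = "cell_of ?Y ?Z j" and ?a = "mul_cell A" and ?p = "twist_cell K H \<psi>"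
  have d: "denotes i ?X ?Z [([], ?i, [])]" "denotes j ?Y ?Z [([], ?j, [])]"
    and v: "valid_cell ?i" "valid_cell ?j"
    using hi hj by (auto intro!: denotes_cell_of valid_cell_of)
  note ds = denotes_intros d monoid_cells(1,2)[OF A] monoid_cells(1,2)[OF K] monoid_cells(1,2)[OF H]
    twist_cell(1)[OF K H h\<psi>] denotes_twist_mul[OF K H h\<psi>] denotes_twist_uni[OF K H h\<psi>]
  have "i \<cdot> mmul K = mmul A \<cdot> (i \<boxtimes> i) \<longleftrightarrow> diag_eq (leaves (Prod ?X ?X)) (leaves ?Z)
      [([], mul_cell K, []), ([], ?i, [])] [([], ?i, [mcar K]), ([mcar A], ?i, []), ([], ?a, [])]"
    by (rule denotes_eq_iff_diag, (rule ds | simp)+)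
  moreover have "i \<cdot> muni K = muni A \<longleftrightarrow> diag_eq (leaves One) (leaves ?Z)
      [([], uni_cell K, []), ([], ?i, [])] [([], uni_cell A, [])]"
    by (rule denotes_eq_iff_diag, (rule ds | simp)+)
  moreover have "j \<cdot> mmul H = mmul A \<cdot> (j \<boxtimes> j) \<longleftrightarrow> diag_eq (leaves (Prod ?Y ?Y)) (leaves ?Z)
      [([], mul_cell H, []), ([], ?j, [])] [([], ?j, [mcar H]), ([mcar A], ?j, []), ([], ?a, [])]"
    by (rule denotes_eq_iff_diag, (rule ds | simp)+)
  moreover have "j \<cdot> muni H = muni A \<longleftrightarrow> diag_eq (leaves One) (leaves ?Z)
      [([], uni_cell H, []), ([], ?j, [])] [([], uni_cell A, [])]"
    by (rule denotes_eq_iff_diag, (rule ds | simp)+)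
  moreover have "(mmul A \<cdot> (i \<boxtimes> j)) \<cdot> \<psi> = mmul A \<cdot> (j \<boxtimes> i) \<longleftrightarrow>
      diag_eq (leaves (Prod ?Y ?X)) (leaves ?Z)
      [([], ?p, []), ([], ?i, [mcar H]), ([mcar A], ?j, []), ([], ?a, [])]
      [([], ?j, [mcar K]), ([mcar A], ?i, []), ([], ?a, [])]"
    by (rule denotes_eq_iff_diag, (rule ds | simp)+)
  ultimately have r:
    "diag_eq [mcar K, mcar K] [mcar A]
      [([], mul_cell K, []), ([], ?i, [])] [([], ?i, [mcar K]), ([mcar A], ?i, []), ([], ?a, [])]"
    "diag_eq [] [mcar A] [([], uni_cell K, []), ([], ?i, [])] [([], uni_cell A, [])]"
    "diag_eq [mcar H, mcar H] [mcar A]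
      [([], mul_cell H, []), ([], ?j, [])] [([], ?j, [mcar H]), ([mcar A], ?j, []), ([], ?a, [])]"
    "diag_eq [] [mcar A] [([], uni_cell H, []), ([], ?j, [])] [([], uni_cell A, [])]"
    "diag_eq [mcar H, mcar K] [mcar A]
      [([], ?p, []), ([], ?i, [mcar H]), ([mcar A], ?j, []), ([], ?a, [])]
      [([], ?j, [mcar K]), ([mcar A], ?i, []), ([], ?a, [])]"
    using \<phi>\<psi> monoid_hom_D(4,5)[OF i] monoid_hom_D(4,5)[OF j] by simp_all
  note fr = o v monoid_cells(3,4)[OF A] monoid_cells(3,4)[OF K] monoid_cells(3,4)[OF H] twist_cell(2)[OF
    K H h\<psi>]
    monoid_diags[OF A] r
  have "\<phi> \<cdot> twist_mul M K H \<psi> = mmul A \<cdot> (\<phi> \<boxtimes> \<phi>) \<longleftrightarrow>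
      diag_eq (leaves (Prod (Prod ?X ?Y) (Prod ?X ?Y))) (leaves ?Z)
       [([mcar K], ?p, [mcar H]), ([], mul_cell K, [mcar H, mcar H]), ([mcar K], mul_cell H, []),
         ([], ?i, [mcar H]), ([mcar A], ?j, []), ([], ?a, [])]
       [([], ?i, [mcar H, mcar K, mcar H]), ([mcar A], ?j, [mcar K, mcar H]), ([], ?a, [mcar K, mcar H]),
         ([mcar A], ?i, [mcar H]), ([mcar A, mcar A], ?j, []), ([mcar A], ?a, []), ([], ?a, [])]"
    unfolding \<phi> by (rule denotes_eq_iff_diag, (rule ds | simp)+)
  then have m: "\<phi> \<cdot> twist_mul M K H \<psi> = mmul A \<cdot> (\<phi> \<boxtimes> \<phi>)"
    using factorization_mul[of "mcar K" "mcar H" "mcar A" "mul_cell K" "uni_cell K" "mul_cell H"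
      "uni_cell H" ?p ?i ?j ?a "uni_cell A"]
    by (simp add: fr)
  have "\<phi> \<cdot> twist_uni M K H = muni A \<longleftrightarrow>
      diag_eq (leaves One) (leaves ?Z)
       [([], uni_cell K, []), ([mcar K], uni_cell H, []), ([], ?i, [mcar H]), ([mcar A], ?j, []), ([],
         ?a, [])]
       [([], uni_cell A, [])]"
    unfolding \<phi> by (rule denotes_eq_iff_diag, (rule ds | simp)+)
  then have u: "\<phi> \<cdot> twist_uni M K H = muni A"
    using factorization_unit[of "mcar K" "mcar H" "mcar A" "mul_cell K" "uni_cell K" "mul_cell H"
      "uni_cell H" ?p ?i ?j ?a "uni_cell A"]
    by (simp add: fr)
  have "is_monoid M \<lparr>mcar = mcar K \<otimes> mcar H, mmul = twist_mul M K H \<psi>, muni = twist_uni M K H\<rparr>"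
    using is_monoid_transport[OF A, of "\<lparr>mcar = mcar K \<otimes> mcar H, mmul = twist_mul M K H \<psi>, muni =
      twist_uni M K H\<rparr>" \<phi>]
      inv m u denotes_twist_mul[OF K H h\<psi>] denotes_twist_uni[OF K H h\<psi>]
    by (simp add: denotes_def)
  then show ?thesis
    using A m u invertible_hom[OF inv] by (simp add: monoid_hom_def)
qed

end


section \<open>The monoidal category of comonoids\<close>

lemma (in category) comp_extend3:
  assumes eq: "h \<cdot> g \<cdot> f = h' \<cdot> g' \<cdot> f'"
    and f: "f \<in> hom C X Y" and g: "g \<in> hom C Y Z" and h: "h \<in> hom C Z W"
    and f': "f' \<in> hom C X Y'" and g': "g' \<in> hom C Y' Z'" and h': "h' \<in> hom C Z' W"
    and x: "x \<in> hom C V X"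
  shows "h \<cdot> g \<cdot> f \<cdot> x = h' \<cdot> g' \<cdot> f' \<cdot> x"
  using comp_assoc[OF x comp_hom[OF f g] h] comp_assoc[OF x f g]
    comp_assoc[OF x comp_hom[OF f' g'] h'] comp_assoc[OF x f' g'] eq by simp

lemma (in category) comp_extend_triple:
  assumes eq: "h \<cdot> g \<cdot> f = k"
    and f: "f \<in> hom C X Y" and g: "g \<in> hom C Y Z" and h: "h \<in> hom C Z W" and x: "x \<in> hom C V X"
  shows "h \<cdot> g \<cdot> f \<cdot> x = k \<cdot> x"
  using comp_assoc[OF x comp_hom[OF f g] h] comp_assoc[OF x f g] eq by simp

lemma bullet_simps [simp]:
  "obj (bullet D) = obj D" "hom (bullet D) = hom D" "ident (bullet D) = ident D"
  "arrcomp (bullet D) = arrcomp D" "tensor (bullet D) = btensor D" "tensor_arr (bullet D) = btensor_arr D"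
  "tunit (bullet D) = bunit D" "associator (bullet D) = bassociator D"
  "lunit (bullet D) = blunit D" "runit (bullet D) = brunit D"
  by (simp_all add: bullet_def)

section \<open>Tensor products and constraints of comonoids\<close>

context duoidal_category
begin

lemmas bullet_interchange = bullet.interchange[unfolded bullet_simps]
  and bullet_tensor_ident = bullet.tensor_ident[unfolded bullet_simps]
  and bullet_comp_left = bullet.tensor_comp_left[unfolded bullet_simps]
  and bullet_comp_right = bullet.tensor_comp_right[unfolded bullet_simps]

lemma bullet_inverse_arrows [simp]: "inverse_arrows (bullet D) = inverse_arrows D"
  by (intro ext) (simp add: inverse_arrows_def)

lemma bullet_invertible [simp]: "invertible (bullet D) = invertible D"
  by (intro ext) (simp add: invertible_def)

lemmas bullet_homs = bullet.homs[unfolded bullet_simps bullet_invertible]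

lemmas duoidal_homs = homs bullet_homs(2,4-8) zeta_hom

lemma mulJ_hom: "mulJ D \<in> hom D (bunit D \<otimes> bunit D) (bunit D)"
  and iota_hom: "iota D \<in> hom D (tunit D) (bunit D)"
  and mulJ_assoc: "mulJ D \<cdot> (mulJ D \<boxtimes> ident D (bunit D))
    = mulJ D \<cdot> (ident D (bunit D) \<boxtimes> mulJ D) \<cdot> associator D (bunit D) (bunit D) (bunit D)"
  and mulJ_unit_left: "mulJ D \<cdot> (iota D \<boxtimes> ident D (bunit D)) = lunit D (bunit D)"
  and mulJ_unit_right: "mulJ D \<cdot> (ident D (bunit D) \<boxtimes> iota D) = runit D (bunit D)"
  and bunit_obj: "bunit D \<in> obj D"
  using monoid_J by (simp_all add: is_monoid_def Let_def)

lemma comulI_hom: "comulI D \<in> hom D (tunit D) (tunit D \<bullet> tunit D)"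
  using comonoid_I by (simp add: is_comonoid_def Let_def)

lemma is_comonoid_D:
  assumes "is_comonoid (bullet D) A"
  shows "ccar A \<in> obj D" "ccomul A \<in> hom D (ccar A) (ccar A \<bullet> ccar A)" "ccounit A \<in> hom D (ccar A) (bunit D)"
    "bassociator D (ccar A) (ccar A) (ccar A) \<cdot> (ccomul A \<odot> ident D (ccar A)) \<cdot> ccomul A
      = (ident D (ccar A) \<odot> ccomul A) \<cdot> ccomul A"
    "blunit D (ccar A) \<cdot> (ccounit A \<odot> ident D (ccar A)) \<cdot> ccomul A = ident D (ccar A)"
    "brunit D (ccar A) \<cdot> (ident D (ccar A) \<odot> ccounit A) \<cdot> ccomul A = ident D (ccar A)"
  using assms by (simp_all add: is_comonoid_def Let_def)

lemma comonoid_hom_iff: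
  "comonoid_hom (bullet D) A B f \<longleftrightarrow> is_comonoid (bullet D) A \<and> is_comonoid (bullet D) B \<and>
    f \<in> hom D (ccar A) (ccar B) \<and> ccomul B \<cdot> f = (f \<odot> f) \<cdot> ccomul A \<and> ccounit B \<cdot> f = ccounit A"
  by (simp add: comonoid_hom_def)

lemma comonoid_tensor_simps [simp]:
  "ccar (comonoid_tensor D A B) = ccar A \<otimes> ccar B"
  "ccomul (comonoid_tensor D A B) = zeta D (ccar A) (ccar A) (ccar B) (ccar B) \<cdot> (ccomul A \<boxtimes> ccomul B)"
  "ccounit (comonoid_tensor D A B) = mulJ D \<cdot> (ccounit A \<boxtimes> ccounit B)"
  by (simp_all add: comonoid_tensor_def)

text \<open>\<open>zeta\<close> and \<open>mulJ\<close> make \<open>\<otimes>\<close> an opmonoidal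
  functor for \<open>\<bullet>\<close>, and such functors preserve comonoids. Each axiom is the
  tensor product of the axioms for A and B, transported by the matching compatibility of
  \<open>zeta\<close>.\<close>

lemma is_comonoid_tensor:
  assumes A: "is_comonoid (bullet D) A" and B: "is_comonoid (bullet D) B"
  shows "is_comonoid (bullet D) (comonoid_tensor D A B)"
proof -
  let ?X = "ccar A" and ?Y = "ccar B" and ?d = "ccomul A" and ?e = "ccounit A"
    and ?d' = "ccomul B" and ?e' = "ccounit B" and ?J = "bunit D"
  let ?XY = "?X \<otimes> ?Y" and ?z = "zeta D ?X ?X ?Y ?Y"
  note X = is_comonoid_D(1)[OF A] and Y = is_comonoid_D(1)[OF B]
    and d = is_comonoid_D(2)[OF A] and d' = is_comonoid_D(2)[OF B]
    and e = is_comonoid_D(3)[OF A] and e' = is_comonoid_D(3)[OF B]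
  note iX = ident_hom[OF X] and iY = ident_hom[OF Y]
  note hs = duoidal_homs X Y d d' e e' mulJ_hom bunit_obj
  let ?D = "?z \<cdot> (?d \<boxtimes> ?d')" and ?E = "mulJ D \<cdot> (?e \<boxtimes> ?e')"
  have hD: "?D \<in> hom D ?XY (?XY \<bullet> ?XY)" and hE: "?E \<in> hom D ?XY ?J"
    by (rule hs)+
  have dd: "?d \<boxtimes> ?d' \<in> hom D ?XY ((?X \<bullet> ?X) \<otimes> (?Y \<bullet> ?Y))" by (rule hs)+

  have "(?D \<odot> ident D ?XY) \<cdot> ?D
      = (?z \<odot> ident D ?XY) \<cdot> ((?d \<boxtimes> ?d') \<odot> ident D ?XY) \<cdot> ?z \<cdot> (?d \<boxtimes> ?d')"
    by (rule comp_extend[OF bullet_comp_right[symmetric], symmetric]) (rule hs)+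
  \<comment> \<open>Naturality of \<open>zeta\<close>, with the identity of the product read as the
    product of the two identities; \<open>zeta_assoc_bullet\<close> then brings the coassociativity
    laws of A and B side by side.\<close>
  also have "((?d \<boxtimes> ?d') \<odot> ident D ?XY) \<cdot> ?z \<cdot> (?d \<boxtimes> ?d')
     = zeta D (?X \<bullet> ?X) ?X (?Y \<bullet> ?Y) ?Y \<cdot> ((?d \<odot> ident D ?X) \<boxtimes> (?d' \<odot> ident D ?Y)) \<cdot> (?d \<boxtimes> ?d')"
    using zeta_natural[OF d iX d' iY] tensor_ident[OF X Y]
    by (intro comp_extend2) (simp, (rule hs)+)
  finally have "bassociator D ?XY ?XY ?XY \<cdot> (?D \<odot> ident D ?XY) \<cdot> ?D
     = bassociator D ?XY ?XY ?XY \<cdot> (?z \<odot> ident D ?XY) \<cdot> zeta D (?X \<bullet> ?X) ?X (?Y \<bullet> ?Y) ?Y \<cdot>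
         ((?d \<odot> ident D ?X) \<boxtimes> (?d' \<odot> ident D ?Y)) \<cdot> (?d \<boxtimes> ?d')" by simp
  also have "\<dots> = (ident D ?XY \<odot> ?z) \<cdot> zeta D ?X (?X \<bullet> ?X) ?Y (?Y \<bullet> ?Y) \<cdot>
      (bassociator D ?X ?X ?X \<boxtimes> bassociator D ?Y ?Y ?Y) \<cdot>
      ((?d \<odot> ident D ?X) \<boxtimes> (?d' \<odot> ident D ?Y)) \<cdot> (?d \<boxtimes> ?d')"
    by (rule comp_extend3[OF zeta_assoc_bullet[symmetric]]) (rule hs)+
  also have "(bassociator D ?X ?X ?X \<boxtimes> bassociator D ?Y ?Y ?Y) \<cdot>
      ((?d \<odot> ident D ?X) \<boxtimes> (?d' \<odot> ident D ?Y)) \<cdot> (?d \<boxtimes> ?d')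
     = ((ident D ?X \<odot> ?d) \<cdot> ?d) \<boxtimes> ((ident D ?Y \<odot> ?d') \<cdot> ?d')"
    unfolding is_comonoid_D(4)[OF A, symmetric] is_comonoid_D(4)[OF B, symmetric]
    by (subst interchange, (rule hs)+, subst interchange, (rule hs refl)+)
  also have "\<dots> = ((ident D ?X \<odot> ?d) \<boxtimes> (ident D ?Y \<odot> ?d')) \<cdot> (?d \<boxtimes> ?d')"
    by (rule interchange) (rule hs)+
  also have "zeta D ?X (?X \<bullet> ?X) ?Y (?Y \<bullet> ?Y) \<cdot> \<dots> = (ident D ?XY \<odot> (?d \<boxtimes> ?d')) \<cdot> ?D"
    using zeta_natural[OF iX d iY d'] tensor_ident[OF X Y]
    by (intro comp_extend2) (simp, (rule hs)+)
  also have "(ident D ?XY \<odot> ?z) \<cdot> \<dots> = (ident D ?XY \<odot> ?D) \<cdot> ?D"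
    by (rule comp_extend[OF bullet_comp_left[symmetric]]) (rule hs)+
  finally have 1: "bassociator D ?XY ?XY ?XY \<cdot> (?D \<odot> ident D ?XY) \<cdot> ?D = (ident D ?XY \<odot> ?D) \<cdot> ?D" .

  have "(?E \<odot> ident D ?XY) \<cdot> ?D
      = (mulJ D \<odot> ident D ?XY) \<cdot> ((?e \<boxtimes> ?e') \<odot> ident D ?XY) \<cdot> ?z \<cdot> (?d \<boxtimes> ?d')"
    by (rule comp_extend[OF bullet_comp_right[symmetric], symmetric]) (rule hs)+
  also have "((?e \<boxtimes> ?e') \<odot> ident D ?XY) \<cdot> ?z \<cdot> (?d \<boxtimes> ?d')
     = zeta D ?J ?X ?J ?Y \<cdot> ((?e \<odot> ident D ?X) \<boxtimes> (?e' \<odot> ident D ?Y)) \<cdot> (?d \<boxtimes> ?d')"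
    using zeta_natural[OF e iX e' iY] tensor_ident[OF X Y]
    by (intro comp_extend2) (simp, (rule hs)+)
  also have "((?e \<odot> ident D ?X) \<boxtimes> (?e' \<odot> ident D ?Y)) \<cdot> (?d \<boxtimes> ?d')
     = ((?e \<odot> ident D ?X) \<cdot> ?d) \<boxtimes> ((?e' \<odot> ident D ?Y) \<cdot> ?d')" (is "_ = ?w")
    by (rule interchange[symmetric]) (rule hs)+
  finally have "blunit D ?XY \<cdot> (?E \<odot> ident D ?XY) \<cdot> ?D
     = blunit D ?XY \<cdot> (mulJ D \<odot> ident D ?XY) \<cdot> zeta D ?J ?X ?J ?Y \<cdot> ?w" by simp
  also have "\<dots> = (blunit D ?X \<boxtimes> blunit D ?Y) \<cdot> ?w"
    by (rule comp_extend_triple[OF zeta_lunit_bullet]) (rule hs)+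
  also have "\<dots> = (blunit D ?X \<cdot> (?e \<odot> ident D ?X) \<cdot> ?d) \<boxtimes> (blunit D ?Y \<cdot> (?e' \<odot> ident D ?Y) \<cdot> ?d')"
    by (rule interchange[symmetric]) (rule hs)+
  also have "\<dots> = ident D ?XY"
    by (simp only: is_comonoid_D(5)[OF A] is_comonoid_D(5)[OF B] tensor_ident[OF X Y])
  finally have 2: "blunit D ?XY \<cdot> (?E \<odot> ident D ?XY) \<cdot> ?D = ident D ?XY" .

  have "(ident D ?XY \<odot> ?E) \<cdot> ?D
      = (ident D ?XY \<odot> mulJ D) \<cdot> (ident D ?XY \<odot> (?e \<boxtimes> ?e')) \<cdot> ?z \<cdot> (?d \<boxtimes> ?d')"
    by (rule comp_extend[OF bullet_comp_left[symmetric], symmetric]) (rule hs)+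
  also have "(ident D ?XY \<odot> (?e \<boxtimes> ?e')) \<cdot> ?z \<cdot> (?d \<boxtimes> ?d')
     = zeta D ?X ?J ?Y ?J \<cdot> ((ident D ?X \<odot> ?e) \<boxtimes> (ident D ?Y \<odot> ?e')) \<cdot> (?d \<boxtimes> ?d')"
    using zeta_natural[OF iX e iY e'] tensor_ident[OF X Y]
    by (intro comp_extend2) (simp, (rule hs)+)
  also have "((ident D ?X \<odot> ?e) \<boxtimes> (ident D ?Y \<odot> ?e')) \<cdot> (?d \<boxtimes> ?d')
     = ((ident D ?X \<odot> ?e) \<cdot> ?d) \<boxtimes> ((ident D ?Y \<odot> ?e') \<cdot> ?d')" (is "_ = ?w'")
    by (rule interchange[symmetric]) (rule hs)+
  finally have "brunit D ?XY \<cdot> (ident D ?XY \<odot> ?E) \<cdot> ?D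
     = brunit D ?XY \<cdot> (ident D ?XY \<odot> mulJ D) \<cdot> zeta D ?X ?J ?Y ?J \<cdot> ?w'" by simp
  also have "\<dots> = (brunit D ?X \<boxtimes> brunit D ?Y) \<cdot> ?w'"
    by (rule comp_extend_triple[OF zeta_runit_bullet]) (rule hs)+
  also have "\<dots> = (brunit D ?X \<cdot> (ident D ?X \<odot> ?e) \<cdot> ?d) \<boxtimes> (brunit D ?Y \<cdot> (ident D ?Y \<odot> ?e') \<cdot> ?d')"
    by (rule interchange[symmetric]) (rule hs)+
  also have "\<dots> = ident D ?XY"
    by (simp only: is_comonoid_D(6)[OF A] is_comonoid_D(6)[OF B] tensor_ident[OF X Y])
  finally have 3: "brunit D ?XY \<cdot> (ident D ?XY \<odot> ?E) \<cdot> ?D = ident D ?XY" .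

  show ?thesis
    unfolding is_comonoid_def Let_def comonoid_tensor_simps bullet_simps
    by (intro conjI tensor_obj X Y hD hE 1 2 3)
qed

lemma comonoid_hom_D:
  assumes "comonoid_hom (bullet D) A B f"
  shows "is_comonoid (bullet D) A" "is_comonoid (bullet D) B" "f \<in> hom D (ccar A) (ccar B)"
    "ccomul B \<cdot> f = (f \<odot> f) \<cdot> ccomul A" "ccounit B \<cdot> f = ccounit A"
  using assms by (simp_all add: comonoid_hom_iff)

lemma comonoid_hom_ident:
  assumes A: "is_comonoid (bullet D) A"
  shows "comonoid_hom (bullet D) A A (ident D (ccar A))"
proof -
  note a = is_comonoid_D(1-3)[OF A]
  show ?thesis
    using A a comp_ident_right[OF a(2)] comp_ident_right[OF a(3)] comp_ident_left[OF a(2)]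
      bullet_tensor_ident[OF a(1,1)] ident_hom[OF a(1)] by (simp add: comonoid_hom_iff)
qed

lemma comonoid_hom_comp:
  assumes f: "comonoid_hom (bullet D) A B f" and g: "comonoid_hom (bullet D) B E g"
  shows "comonoid_hom (bullet D) A E (g \<cdot> f)"
proof -
  note A = is_comonoid_D(1-3)[OF comonoid_hom_D(1)[OF f]] and B = is_comonoid_D(1-3)[OF
    comonoid_hom_D(2)[OF f]]
    and E = is_comonoid_D(1-3)[OF comonoid_hom_D(2)[OF g]]
    and hf = comonoid_hom_D(3)[OF f] and hg = comonoid_hom_D(3)[OF g]
  note hs = duoidal_homs A B E hf hg
  have "ccomul E \<cdot> g \<cdot> f = (g \<odot> g) \<cdot> ccomul B \<cdot> f"
    by (rule comp_extend2[OF comonoid_hom_D(4)[OF g]]) (rule hs)+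
  also have "\<dots> = (g \<odot> g) \<cdot> (f \<odot> f) \<cdot> ccomul A" by (simp only: comonoid_hom_D(4)[OF f])
  also have "\<dots> = ((g \<cdot> f) \<odot> (g \<cdot> f)) \<cdot> ccomul A"
    by (rule comp_extend[OF bullet_interchange[symmetric]]) (rule hs)+
  finally have 1: "ccomul E \<cdot> g \<cdot> f = ((g \<cdot> f) \<odot> (g \<cdot> f)) \<cdot> ccomul A" .
  have "ccounit E \<cdot> g \<cdot> f = ccounit B \<cdot> f"
    by (rule comp_extend[OF comonoid_hom_D(5)[OF g]]) (rule hs)+
  then show ?thesis
    using 1 comonoid_hom_D[OF f] comonoid_hom_D[OF g] comp_hom[OF hf hg] by (simp add: comonoid_hom_iff)
qed

text \<open>Hence the inclusion of comonoids into \<open>D\<close> reflects isomorphisms. This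
  supplies the inverse constraints of \<open>Comon D\<close> and the inverse of
  \<open>\<phi>\<close> there.\<close>

lemma comonoid_hom_inv:
  assumes f: "comonoid_hom (bullet D) A B f" and inv: "invertible D (ccar A) (ccar B) f"
  shows "comonoid_hom (bullet D) B A (inv_arr D (ccar A) (ccar B) f)" (is "comonoid_hom _ _ _ ?g")
proof -
  note A = is_comonoid_D(1-3)[OF comonoid_hom_D(1)[OF f]] and B = is_comonoid_D(1-3)[OF
    comonoid_hom_D(2)[OF f]]
    and hf = comonoid_hom_D(3)[OF f] and hg = inv_arr_hom[OF inv]
  note hs = duoidal_homs A B hf hg
  have "(?g \<odot> ?g) \<cdot> ccomul B = (?g \<odot> ?g) \<cdot> ccomul B \<cdot> f \<cdot> ?g"
    using comp_ident_right[OF B(2)] by (simp only: inv_arr_right[OF inv])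
  also have "ccomul B \<cdot> f \<cdot> ?g = (f \<odot> f) \<cdot> ccomul A \<cdot> ?g"
    by (rule comp_extend2[OF comonoid_hom_D(4)[OF f]]) (rule hs)+
  also have "(?g \<odot> ?g) \<cdot> \<dots> = ident D (ccar A \<bullet> ccar A) \<cdot> ccomul A \<cdot> ?g"
    by (rule comp_extend, subst bullet_interchange[symmetric])
      (rule hs | simp only: inv_arr_left[OF inv] bullet_tensor_ident A)+
  also have "\<dots> = ccomul A \<cdot> ?g"
    by (rule comp_ident_left) (rule hs)+
  finally have 1: "ccomul A \<cdot> ?g = (?g \<odot> ?g) \<cdot> ccomul B" by simp
  have "ccounit A \<cdot> ?g = ccounit B \<cdot> f \<cdot> ?g"
    by (rule comp_extend[OF comonoid_hom_D(5)[OF f], symmetric]) (rule hs)+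
  also have "\<dots> = ccounit B"
    using comp_ident_right[OF B(3)] by (simp only: inv_arr_right[OF inv])
  finally show ?thesis using 1 hg comonoid_hom_D(1,2)[OF f] by (simp add: comonoid_hom_iff)
qed

lemma comonoid_hom_tensor:
  assumes f: "comonoid_hom (bullet D) A A' f" and g: "comonoid_hom (bullet D) B B' g"
  shows "comonoid_hom (bullet D) (comonoid_tensor D A B) (comonoid_tensor D A' B') (f \<boxtimes> g)"
proof -
  note A = is_comonoid_D(1-3)[OF comonoid_hom_D(1)[OF f]] and A' = is_comonoid_D(1-3)[OF
    comonoid_hom_D(2)[OF f]]
    and B = is_comonoid_D(1-3)[OF comonoid_hom_D(1)[OF g]] and B' = is_comonoid_D(1-3)[OF
      comonoid_hom_D(2)[OF g]]
    and hf = comonoid_hom_D(3)[OF f] and hg = comonoid_hom_D(3)[OF g]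
  note hs = duoidal_homs A B A' B' hf hg bunit_obj mulJ_hom
  let ?z = "zeta D (ccar A) (ccar A) (ccar B) (ccar B)" and ?z' = "zeta D (ccar A') (ccar A') (ccar B')
    (ccar B')"
  have "(?z' \<cdot> (ccomul A' \<boxtimes> ccomul B')) \<cdot> (f \<boxtimes> g) = ?z' \<cdot> (ccomul A' \<boxtimes> ccomul B') \<cdot> (f \<boxtimes> g)"
    by (rule comp_assoc) (rule hs)+
  also have "(ccomul A' \<boxtimes> ccomul B') \<cdot> (f \<boxtimes> g) = ((f \<odot> f) \<cdot> ccomul A) \<boxtimes> ((g \<odot> g) \<cdot> ccomul B)"
    unfolding comonoid_hom_D(4)[OF f, symmetric] comonoid_hom_D(4)[OF g, symmetric]
    by (rule interchange[symmetric]) (rule hs)+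
  also have "\<dots> = ((f \<odot> f) \<boxtimes> (g \<odot> g)) \<cdot> (ccomul A \<boxtimes> ccomul B)"
    by (rule interchange) (rule hs)+
  also have "?z' \<cdot> \<dots> = ((f \<boxtimes> g) \<odot> (f \<boxtimes> g)) \<cdot> ?z \<cdot> (ccomul A \<boxtimes> ccomul B)"
    by (rule comp_extend2[OF zeta_natural]) (rule hs)+
  finally have 1: "(?z' \<cdot> (ccomul A' \<boxtimes> ccomul B')) \<cdot> (f \<boxtimes> g)
      = ((f \<boxtimes> g) \<odot> (f \<boxtimes> g)) \<cdot> ?z \<cdot> (ccomul A \<boxtimes> ccomul B)" .
  have "(mulJ D \<cdot> (ccounit A' \<boxtimes> ccounit B')) \<cdot> (f \<boxtimes> g) = mulJ D \<cdot> (ccounit A' \<boxtimes> ccounit B') \<cdot> (f \<boxtimes> g)"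
    by (rule comp_assoc) (rule hs)+
  also have "(ccounit A' \<boxtimes> ccounit B') \<cdot> (f \<boxtimes> g) = ccounit A \<boxtimes> ccounit B"
    unfolding comonoid_hom_D(5)[OF f, symmetric] comonoid_hom_D(5)[OF g, symmetric]
    by (rule interchange[symmetric]) (rule hs)+
  finally have 2: "(mulJ D \<cdot> (ccounit A' \<boxtimes> ccounit B')) \<cdot> (f \<boxtimes> g) = mulJ D \<cdot> (ccounit A \<boxtimes> ccounit B)" .
  show ?thesis
    using 1 2 tensor_hom[OF hf hg] comonoid_hom_D(1,2)[OF f] comonoid_hom_D(1,2)[OF g]
    by (simp add: comonoid_hom_iff is_comonoid_tensor)
qed

abbreviation unit_comonoid :: "('o, 'm) comonoid_data" where
  "unit_comonoid \<equiv> \<lparr>ccar = tunit D, ccomul = comulI D, ccounit = iota D\<rparr>"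

text \<open>On comultiplications this is \<open>zeta_assoc_circ\<close>, on counits the
  associativity of the monoid J.\<close>

lemma comonoid_hom_associator:
  assumes "is_comonoid (bullet D) A" "is_comonoid (bullet D) B" "is_comonoid (bullet D) E"
  shows "comonoid_hom (bullet D) (comonoid_tensor D (comonoid_tensor D A B) E)
    (comonoid_tensor D A (comonoid_tensor D B E)) (associator D (ccar A) (ccar B) (ccar E))"
proof -
  note A = is_comonoid_D(1-3)[OF assms(1)] and B = is_comonoid_D(1-3)[OF assms(2)]
    and E = is_comonoid_D(1-3)[OF assms(3)]
  note hs = duoidal_homs A B E bunit_obj mulJ_hom
  let ?X = "ccar A" and ?Y = "ccar B" and ?Z = "ccar E" and ?d = "ccomul A" and ?d' = "ccomul B" and ?d''
    = "ccomul E"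
    and ?e = "ccounit A" and ?e' = "ccounit B" and ?e'' = "ccounit E" and ?J = "bunit D"
  let ?a = "associator D ?X ?Y ?Z" and ?z = "zeta D ?X ?X ?Y ?Y" and ?z' = "zeta D ?Y ?Y ?Z ?Z"
    and ?w = "zeta D ?X ?X (?Y \<otimes> ?Z) (?Y \<otimes> ?Z)" and ?w' = "zeta D (?X \<otimes> ?Y) (?X \<otimes> ?Y) ?Z ?Z"
  have "(?w \<cdot> (?d \<boxtimes> (?z' \<cdot> (?d' \<boxtimes> ?d'')))) \<cdot> ?a = ?w \<cdot> (?d \<boxtimes> (?z' \<cdot> (?d' \<boxtimes> ?d''))) \<cdot> ?a"
    by (rule comp_assoc) (rule hs)+
  also have "(?d \<boxtimes> (?z' \<cdot> (?d' \<boxtimes> ?d''))) \<cdot> ?a = (ident D (?X \<bullet> ?X) \<boxtimes> ?z') \<cdot> (?d \<boxtimes> (?d' \<boxtimes> ?d'')) \<cdot> ?a"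
    by (rule comp_extend[symmetric], subst interchange[symmetric])
      (rule hs refl | simp only: comp_ident_left[OF A(2)])+
  also have "(?d \<boxtimes> (?d' \<boxtimes> ?d'')) \<cdot> ?a = associator D (?X \<bullet> ?X) (?Y \<bullet> ?Y) (?Z \<bullet> ?Z) \<cdot> ((?d \<boxtimes> ?d') \<boxtimes> ?d'')"
    by (rule associator_natural[symmetric]) (rule hs)+
  also have "?w \<cdot> (ident D (?X \<bullet> ?X) \<boxtimes> ?z') \<cdot> \<dots> = (?a \<odot> ?a) \<cdot> ?w' \<cdot> (?z \<boxtimes> ident D (?Z \<bullet> ?Z)) \<cdot> ((?d \<boxtimes>
    ?d') \<boxtimes> ?d'')"
    by (rule comp_extend3[OF zeta_assoc_circ]) (rule hs)+
  also have "(?z \<boxtimes> ident D (?Z \<bullet> ?Z)) \<cdot> ((?d \<boxtimes> ?d') \<boxtimes> ?d'') = (?z \<cdot> (?d \<boxtimes> ?d')) \<boxtimes> ?d''"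
    by (subst interchange[symmetric]) (rule hs refl | simp only: comp_ident_left[OF E(2)])+
  finally have 1: "(?w \<cdot> (?d \<boxtimes> (?z' \<cdot> (?d' \<boxtimes> ?d'')))) \<cdot> ?a = (?a \<odot> ?a) \<cdot> ?w' \<cdot> ((?z \<cdot> (?d \<boxtimes> ?d')) \<boxtimes> ?d'')" .
  have "(mulJ D \<cdot> (?e \<boxtimes> (mulJ D \<cdot> (?e' \<boxtimes> ?e'')))) \<cdot> ?a = mulJ D \<cdot> (?e \<boxtimes> (mulJ D \<cdot> (?e' \<boxtimes> ?e''))) \<cdot> ?a"
    by (rule comp_assoc) (rule hs)+
  also have "(?e \<boxtimes> (mulJ D \<cdot> (?e' \<boxtimes> ?e''))) \<cdot> ?a = (ident D ?J \<boxtimes> mulJ D) \<cdot> (?e \<boxtimes> (?e' \<boxtimes> ?e'')) \<cdot> ?a"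
    by (rule comp_extend[symmetric], subst interchange[symmetric])
      (rule hs refl | simp only: comp_ident_left[OF A(3)])+
  also have "(?e \<boxtimes> (?e' \<boxtimes> ?e'')) \<cdot> ?a = associator D ?J ?J ?J \<cdot> ((?e \<boxtimes> ?e') \<boxtimes> ?e'')"
    by (rule associator_natural[symmetric]) (rule hs)+
  also have "mulJ D \<cdot> (ident D ?J \<boxtimes> mulJ D) \<cdot> \<dots> = (mulJ D \<cdot> (mulJ D \<boxtimes> ident D ?J)) \<cdot> ((?e \<boxtimes> ?e') \<boxtimes> ?e'')"
    by (rule comp_extend_triple[OF mulJ_assoc[symmetric]]) (rule hs)+
  also have "\<dots> = mulJ D \<cdot> (mulJ D \<boxtimes> ident D ?J) \<cdot> ((?e \<boxtimes> ?e') \<boxtimes> ?e'')"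
    by (rule comp_assoc) (rule hs)+
  also have "(mulJ D \<boxtimes> ident D ?J) \<cdot> ((?e \<boxtimes> ?e') \<boxtimes> ?e'') = (mulJ D \<cdot> (?e \<boxtimes> ?e')) \<boxtimes> ?e''"
    by (subst interchange[symmetric]) (rule hs refl | simp only: comp_ident_left[OF E(3)])+
  finally have 2: "(mulJ D \<cdot> (?e \<boxtimes> (mulJ D \<cdot> (?e' \<boxtimes> ?e'')))) \<cdot> ?a = mulJ D \<cdot> ((mulJ D \<cdot> (?e \<boxtimes> ?e')) \<boxtimes> ?e'')" .
  show ?thesis
    unfolding comonoid_hom_iff comonoid_tensor_simps
    by (intro conjI 1 2 is_comonoid_tensor assms invertible_hom[OF associator_iso] A B E)
qed

text \<open>On comultiplications this is \<open>zeta_lunit_circ\<close>. On counits it is the unit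
  law of J, as the counit of I and the unit of J are the same arrow \<open>iota\<close>.\<close>

lemma comonoid_hom_lunit:
  assumes "is_comonoid (bullet D) A"
  shows "comonoid_hom (bullet D) (comonoid_tensor D unit_comonoid A) A (lunit D (ccar A))"
proof -
  note A = is_comonoid_D(1-3)[OF assms]
  note hs = duoidal_homs A bunit_obj mulJ_hom comulI_hom iota_hom
  let ?X = "ccar A" and ?I = "tunit D"
  have "ccomul A \<cdot> lunit D ?X = lunit D (?X \<bullet> ?X) \<cdot> (ident D ?I \<boxtimes> ccomul A)"
    using lunit_natural[OF A(2)] by simp
  also have "\<dots> = (lunit D ?X \<odot> lunit D ?X) \<cdot> zeta D ?I ?I ?X ?X \<cdot>
      (comulI D \<boxtimes> ident D (?X \<bullet> ?X)) \<cdot> (ident D ?I \<boxtimes> ccomul A)"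
    by (rule comp_extend_triple[OF zeta_lunit_circ, symmetric]) (rule hs)+
  also have "(comulI D \<boxtimes> ident D (?X \<bullet> ?X)) \<cdot> (ident D ?I \<boxtimes> ccomul A) = comulI D \<boxtimes> ccomul A"
    by (rule tensor_split(2)) (rule hs)+
  finally have 1: "ccomul A \<cdot> lunit D ?X
      = (lunit D ?X \<odot> lunit D ?X) \<cdot> zeta D ?I ?I ?X ?X \<cdot> (comulI D \<boxtimes> ccomul A)" .
  have "ccounit A \<cdot> lunit D ?X = lunit D (bunit D) \<cdot> (ident D ?I \<boxtimes> ccounit A)"
    using lunit_natural[OF A(3)] by simp
  also have "\<dots> = mulJ D \<cdot> (iota D \<boxtimes> ident D (bunit D)) \<cdot> (ident D ?I \<boxtimes> ccounit A)"
    by (rule comp_extend[OF mulJ_unit_left, symmetric]) (rule hs)+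
  also have "(iota D \<boxtimes> ident D (bunit D)) \<cdot> (ident D ?I \<boxtimes> ccounit A) = iota D \<boxtimes> ccounit A"
    by (rule tensor_split(2)) (rule hs)+
  finally have 2: "ccounit A \<cdot> lunit D ?X = mulJ D \<cdot> (iota D \<boxtimes> ccounit A)" .
  show ?thesis
    using 1 2 assms is_comonoid_tensor[OF comonoid_I assms] invertible_hom[OF lunit_iso[OF A(1)]]
    by (simp add: comonoid_hom_iff)
qed

lemma comonoid_hom_runit:
  assumes "is_comonoid (bullet D) A"
  shows "comonoid_hom (bullet D) (comonoid_tensor D A unit_comonoid) A (runit D (ccar A))"
proof -
  note A = is_comonoid_D(1-3)[OF assms]
  note hs = duoidal_homs A bunit_obj mulJ_hom comulI_hom iota_hom
  let ?X = "ccar A" and ?I = "tunit D"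
  have "ccomul A \<cdot> runit D ?X = runit D (?X \<bullet> ?X) \<cdot> (ccomul A \<boxtimes> ident D ?I)"
    using runit_natural[OF A(2)] by simp
  also have "\<dots> = (runit D ?X \<odot> runit D ?X) \<cdot> zeta D ?X ?X ?I ?I \<cdot>
      (ident D (?X \<bullet> ?X) \<boxtimes> comulI D) \<cdot> (ccomul A \<boxtimes> ident D ?I)"
    by (rule comp_extend_triple[OF zeta_runit_circ, symmetric]) (rule hs)+
  also have "(ident D (?X \<bullet> ?X) \<boxtimes> comulI D) \<cdot> (ccomul A \<boxtimes> ident D ?I) = ccomul A \<boxtimes> comulI D"
    by (rule tensor_split(1)) (rule hs)+
  finally have 1: "ccomul A \<cdot> runit D ?X
      = (runit D ?X \<odot> runit D ?X) \<cdot> zeta D ?X ?X ?I ?I \<cdot> (ccomul A \<boxtimes> comulI D)" .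
  have "ccounit A \<cdot> runit D ?X = runit D (bunit D) \<cdot> (ccounit A \<boxtimes> ident D ?I)"
    using runit_natural[OF A(3)] by simp
  also have "\<dots> = mulJ D \<cdot> (ident D (bunit D) \<boxtimes> iota D) \<cdot> (ccounit A \<boxtimes> ident D ?I)"
    by (rule comp_extend[OF mulJ_unit_right, symmetric]) (rule hs)+
  also have "(ident D (bunit D) \<boxtimes> iota D) \<cdot> (ccounit A \<boxtimes> ident D ?I) = ccounit A \<boxtimes> iota D"
    by (rule tensor_split(1)) (rule hs)+
  finally have 2: "ccounit A \<cdot> runit D ?X = mulJ D \<cdot> (ccounit A \<boxtimes> iota D)" .
  show ?thesis
    using 1 2 assms is_comonoid_tensor[OF assms comonoid_I] invertible_hom[OF runit_iso[OF A(1)]]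
    by (simp add: comonoid_hom_iff)
qed

lemma Comon_simps [simp]:
  "obj (Comon D) = {A. is_comonoid (bullet D) A}"
  "hom (Comon D) A B = {f. comonoid_hom (bullet D) A B f}"
  "ident (Comon D) A = ident D (ccar A)" "arrcomp (Comon D) = arrcomp D"
  "tensor (Comon D) = comonoid_tensor D" "tensor_arr (Comon D) = tensor_arr D"
  "tunit (Comon D) = unit_comonoid"
  "associator (Comon D) A B E = associator D (ccar A) (ccar B) (ccar E)"
  "lunit (Comon D) A = lunit D (ccar A)" "runit (Comon D) A = runit D (ccar A)"
  by (simp_all add: Comon_def)

lemma inverse_arrows_Comon:
  assumes "comonoid_hom (bullet D) A B f" "invertible D (ccar A) (ccar B) f"
  shows "inverse_arrows (Comon D) A B f (inv_arr D (ccar A) (ccar B) f)"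
  using assms comonoid_hom_inv[OF assms] inv_arr_left[OF assms(2)] inv_arr_right[OF assms(2)]
  by (simp add: inverse_arrows_def)

lemma invertible_Comon:
  "\<lbrakk>comonoid_hom (bullet D) A B f; invertible D (ccar A) (ccar B) f\<rbrakk> \<Longrightarrow> invertible (Comon D) A B f"
  unfolding invertible_def[of "Comon D"] using inverse_arrows_Comon by blast

lemma category_Comon: "category (Comon D)"
proof
  show "A \<in> obj (Comon D) \<and> B \<in> obj (Comon D)" if "f \<in> hom (Comon D) A B" for f A B
    using that comonoid_hom_D by auto
  show "g \<cdot>\<^bsub>Comon D\<^esub> f \<in> hom (Comon D) A E" if "f \<in> hom (Comon D) A B" "g \<in> hom (Comon D) B E" for f g A B E
    using that comonoid_hom_comp by auto
  show "(h \<cdot>\<^bsub>Comon D\<^esub> g) \<cdot>\<^bsub>Comon D\<^esub> f = h \<cdot>\<^bsub>Comon D\<^esub> (g \<cdot>\<^bsub>Comon D\<^esub> f)"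
    if "f \<in> hom (Comon D) A B" "g \<in> hom (Comon D) B E" "h \<in> hom (Comon D) E F" for f g h A B E F
    using that by (auto dest!: comonoid_hom_D(3) intro: comp_assoc)
qed (auto simp: comonoid_hom_ident dest!: comonoid_hom_D(3) intro: comp_ident_right comp_ident_left)

text \<open>Every equation is literally one in \<open>D\<close>. What needs proof is closure: tensor
  products and constraints, with their inverses, stay among comonoids.\<close>

lemma monoidal_category_Comon: "monoidal_category (Comon D)"
proof -
  interpret Com: category "Comon D" by (rule category_Comon)
  note o = is_comonoid_D(1)
  show ?thesis
  proof
    fix A B E F
    assume A: "A \<in> obj (Comon D)" and B: "B \<in> obj (Comon D)"
    then show "A \<otimes>\<^bsub>Comon D\<^esub> B \<in> obj (Comon D)" by (simp add: is_comonoid_tensor)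
    show "ident (Comon D) A \<boxtimes>\<^bsub>Comon D\<^esub> ident (Comon D) B = ident (Comon D) (A \<otimes>\<^bsub>Comon D\<^esub> B)"
      using A B o by (simp add: tensor_ident)
    show "(ident (Comon D) A \<boxtimes>\<^bsub>Comon D\<^esub> lunit (Comon D) B) \<cdot>\<^bsub>Comon D\<^esub>
        associator (Comon D) A (tunit (Comon D)) B = runit (Comon D) A \<boxtimes>\<^bsub>Comon D\<^esub> ident (Comon D) B"
      using A B o by (simp add: triangle)
    assume E: "E \<in> obj (Comon D)"
    show "invertible (Comon D) ((A \<otimes>\<^bsub>Comon D\<^esub> B) \<otimes>\<^bsub>Comon D\<^esub> E) (A \<otimes>\<^bsub>Comon D\<^esub> (B \<otimes>\<^bsub>Comon D\<^esub> E))
        (associator (Comon D) A B E)"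
      using A B E o by (auto intro!: invertible_Comon comonoid_hom_associator associator_iso)
    assume F: "F \<in> obj (Comon D)"
    show "(ident (Comon D) A \<boxtimes>\<^bsub>Comon D\<^esub> associator (Comon D) B E F) \<cdot>\<^bsub>Comon D\<^esub>
        associator (Comon D) A (B \<otimes>\<^bsub>Comon D\<^esub> E) F \<cdot>\<^bsub>Comon D\<^esub>
        (associator (Comon D) A B E \<boxtimes>\<^bsub>Comon D\<^esub> ident (Comon D) F)
      = associator (Comon D) A B (E \<otimes>\<^bsub>Comon D\<^esub> F) \<cdot>\<^bsub>Comon D\<^esub> associator (Comon D) (A \<otimes>\<^bsub>Comon D\<^esub> B) E F"
      using A B E F o by (simp add: pentagon)
  next
    fix A assume A: "A \<in> obj (Comon D)"
    show "invertible (Comon D) (tunit (Comon D) \<otimes>\<^bsub>Comon D\<^esub> A) A (lunit (Comon D) A)"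
      using A o by (auto intro!: invertible_Comon comonoid_hom_lunit lunit_iso)
    show "invertible (Comon D) (A \<otimes>\<^bsub>Comon D\<^esub> tunit (Comon D)) A (runit (Comon D) A)"
      using A o by (auto intro!: invertible_Comon comonoid_hom_runit runit_iso)
  next
    show "tunit (Comon D) \<in> obj (Comon D)" by (simp add: comonoid_I)
  next
    fix f A A' g B B'
    assume "f \<in> hom (Comon D) A A'" "g \<in> hom (Comon D) B B'"
    then show "f \<boxtimes>\<^bsub>Comon D\<^esub> g \<in> hom (Comon D) (A \<otimes>\<^bsub>Comon D\<^esub> B) (A' \<otimes>\<^bsub>Comon D\<^esub> B')"
      by (simp add: comonoid_hom_tensor)
  next
    fix f A A' A'' f' g B B' B'' g'
    assume "f \<in> hom (Comon D) A A'" "f' \<in> hom (Comon D) A' A''" "g \<in> hom (Comon D) B B'" "g' \<in> hom (Comon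
      D) B' B''"
    then show "(f' \<cdot>\<^bsub>Comon D\<^esub> f) \<boxtimes>\<^bsub>Comon D\<^esub> (g' \<cdot>\<^bsub>Comon D\<^esub> g)
        = (f' \<boxtimes>\<^bsub>Comon D\<^esub> g') \<cdot>\<^bsub>Comon D\<^esub> (f \<boxtimes>\<^bsub>Comon D\<^esub> g)"
      by (auto dest!: comonoid_hom_D(3) intro: interchange)
  next
    fix f A A' g B B' h E E'
    assume "f \<in> hom (Comon D) A A'" "g \<in> hom (Comon D) B B'" "h \<in> hom (Comon D) E E'"
    then show "associator (Comon D) A' B' E' \<cdot>\<^bsub>Comon D\<^esub> ((f \<boxtimes>\<^bsub>Comon D\<^esub> g) \<boxtimes>\<^bsub>Comon D\<^esub> h)
        = (f \<boxtimes>\<^bsub>Comon D\<^esub> (g \<boxtimes>\<^bsub>Comon D\<^esub> h)) \<cdot>\<^bsub>Comon D\<^esub> associator (Comon D) A B E"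
      by (auto dest!: comonoid_hom_D(3) intro: associator_natural)
  next
    fix f A B assume "f \<in> hom (Comon D) A B"
    then show "lunit (Comon D) B \<cdot>\<^bsub>Comon D\<^esub> (ident (Comon D) (tunit (Comon D)) \<boxtimes>\<^bsub>Comon D\<^esub> f)
          = f \<cdot>\<^bsub>Comon D\<^esub> lunit (Comon D) A"
      and "runit (Comon D) B \<cdot>\<^bsub>Comon D\<^esub> (f \<boxtimes>\<^bsub>Comon D\<^esub> ident (Comon D) (tunit (Comon D)))
          = f \<cdot>\<^bsub>Comon D\<^esub> runit (Comon D) A"
      by (auto dest!: comonoid_hom_D(3) intro: lunit_natural runit_natural)
  qed
qed

end


section \<open>Bimonoids\<close>

lemma bimonoid_selectors [simp]:
  "mcar (monoid_of B) = car B" "mmul (monoid_of B) = mul B" "muni (monoid_of B) = uni B"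
  "ccar (comonoid_of B) = car B" "ccomul (comonoid_of B) = comul B" "ccounit (comonoid_of B) = counit B"
  "mcar (comon_monoid_of B) = comonoid_of B" "mmul (comon_monoid_of B) = mul B" "muni (comon_monoid_of B)
    = uni B"
  by (simp_all add: monoid_of_def comonoid_of_def comon_monoid_of_def)

section \<open>Bimonoids as monoids in the category of comonoids\<close>

context duoidal_category
begin

text \<open>The four compatibility conditions of a bimonoid say precisely that \<open>mul\<close>
  and \<open>uni\<close> are comonoid morphisms out of the tensor square and out of I.\<close>

lemma is_bimonoid_iff: "is_bimonoid D B \<longleftrightarrow> is_monoid (Comon D) (comon_monoid_of B)"
  by (auto simp: is_bimonoid_def is_monoid_def Let_def comonoid_hom_iff is_comonoid_tensor comonoid_I
      dest: is_comonoid_D(1))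

lemma bimonoid_hom_iff:
  "bimonoid_hom D A B f \<longleftrightarrow> monoid_hom (Comon D) (comon_monoid_of A) (comon_monoid_of B) f"
  by (auto simp: bimonoid_hom_def monoid_hom_def is_bimonoid_iff[symmetric] comonoid_hom_iff)
    (auto simp: is_bimonoid_def Let_def)

text \<open>\<open>inv_arr\<close> is a unique choice within the category at hand. The choices agree
  because the inverse in \<open>D\<close> is a comonoid morphism; so twisted products and twisting
  equations, which contain inverse constraints, mean the same in both categories.\<close>

lemma inv_arr_Comon:
  "\<lbrakk>comonoid_hom (bullet D) A B f; invertible D (ccar A) (ccar B) f\<rbrakk>
    \<Longrightarrow> inv_arr (Comon D) A B f = inv_arr D (ccar A) (ccar B) f"
  by (rule category.inv_arr_eqI[OF category_Comon inverse_arrows_Comon])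

lemma structure_inv_Comon:
  assumes A: "is_comonoid (bullet D) A" and X: "X = ccar A"
  shows "inv_arr (Comon D) (comonoid_tensor D unit_comonoid A) A (lunit D X) = lunit_inv D X"
    and "inv_arr (Comon D) (comonoid_tensor D A unit_comonoid) A (runit D X) = runit_inv D X"
    and "\<lbrakk>is_comonoid (bullet D) B; is_comonoid (bullet D) E; Y = ccar B; Z = ccar E\<rbrakk> \<Longrightarrow>
      inv_arr (Comon D) (comonoid_tensor D (comonoid_tensor D A B) E)
        (comonoid_tensor D A (comonoid_tensor D B E)) (associator D X Y Z) = associator_inv D X Y Z"
  using inv_arr_Comon[OF comonoid_hom_lunit[OF A]] inv_arr_Comon[OF comonoid_hom_runit[OF A]]
    inv_arr_Comon[OF comonoid_hom_associator[OF A]] lunit_iso runit_iso associator_iso is_comonoid_D(1)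
    A by (auto simp: X)

lemma is_bimonoid_comonoid: "is_bimonoid D B \<Longrightarrow> is_comonoid (bullet D) (comonoid_of B)"
  by (simp add: is_bimonoid_def Let_def)

lemma is_bimonoid_monoid: "is_bimonoid D B \<Longrightarrow> is_monoid D (monoid_of B)"
  by (simp add: is_bimonoid_def Let_def)

lemma comon_monoid_of_twisted:
  assumes "is_bimonoid D K" "is_bimonoid D H"
  shows "comon_monoid_of (twisted_bimonoid D K H \<psi>) =
    \<lparr>mcar = mcar (comon_monoid_of K) \<otimes>\<^bsub>Comon D\<^esub> mcar (comon_monoid_of H),
     mmul = twist_mul (Comon D) (comon_monoid_of K) (comon_monoid_of H) \<psi>,
     muni = twist_uni (Comon D) (comon_monoid_of K) (comon_monoid_of H)\<rparr>"
proof -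
  have "twist_mul (Comon D) (comon_monoid_of K) (comon_monoid_of H) \<psi>
      = twist_mul D (monoid_of K) (monoid_of H) \<psi>"
    using assms[THEN is_bimonoid_comonoid]
    by (simp add: twist_mul_def Let_def structure_inv_Comon is_comonoid_tensor)
  moreover have "twist_uni (Comon D) (comon_monoid_of K) (comon_monoid_of H)
      = twist_uni D (monoid_of K) (monoid_of H)"
    by (simp add: twist_uni_def structure_inv_Comon comonoid_I)
  ultimately show ?thesis
    by (simp add: comon_monoid_of_def comonoid_of_def twisted_bimonoid_def comonoid_tensor_def)
qed

lemma twisting_equations_Comon:
  assumes "is_bimonoid D K" "is_bimonoid D H"
  shows "twisting_equations (Comon D) (comon_monoid_of H) (comon_monoid_of K) \<psi>
    \<longleftrightarrow> twisting_equations D (monoid_of H) (monoid_of K) \<psi>"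
  using assms[THEN is_bimonoid_comonoid]
  by (simp add: twisting_equations_def Let_def structure_inv_Comon)

text \<open>The monoid theorem in \<open>Comon D\<close> presupposes that \<open>\<psi>\<close> is
  an arrow there, so the equivalence is first proved under that condition. The condition is then
  derived from the bimonoid axioms by writing \<open>\<psi>\<close> as a composite of comonoid
  morphisms.\<close>

lemma is_bimonoid_twisted_iff:
  assumes K: "is_bimonoid D K" and H: "is_bimonoid D H"
    and \<psi>: "\<psi> \<in> hom D (car H \<otimes> car K) (car K \<otimes> car H)"
  shows "is_bimonoid D (twisted_bimonoid D K H \<psi>) \<longleftrightarrow>
    twisting_equations D (monoid_of H) (monoid_of K) \<psi> \<and>
    comonoid_hom (bullet D) (comonoid_tensor D (comonoid_of H) (comonoid_of K))
      (comonoid_tensor D (comonoid_of K) (comonoid_of H)) \<psi>"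
proof -
  interpret Com: monoidal_category "Comon D" by (rule monoidal_category_Comon)
  note K' = K[unfolded is_bimonoid_iff] and H' = H[unfolded is_bimonoid_iff]
  let ?T = "twisted_bimonoid D K H \<psi>"
  have iff: "is_bimonoid D ?T \<longleftrightarrow> twisting_equations D (monoid_of H) (monoid_of K) \<psi>"
    if "comonoid_hom (bullet D) (comonoid_tensor D (comonoid_of H) (comonoid_of K))
      (comonoid_tensor D (comonoid_of K) (comonoid_of H)) \<psi>"
    using Com.is_monoid_twist_iff[OF K' H', of \<psi>] that
    by (simp add: is_bimonoid_iff comon_monoid_of_twisted[OF K H] twisting_equations_Comon[OF K H])
  moreover have "comonoid_hom (bullet D) (comonoid_tensor D (comonoid_of H) (comonoid_of K))
      (comonoid_tensor D (comonoid_of K) (comonoid_of H)) \<psi>" if T: "is_bimonoid D ?T"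
  proof -
    let ?K = "comonoid_of K" and ?H = "comonoid_of H"
    let ?m = "twist_mul D (monoid_of K) (monoid_of H) \<psi>"
      and ?j = "(uni K \<boxtimes> ident D (car H)) \<cdot> lunit_inv D (car H)"
      and ?i = "(ident D (car K) \<boxtimes> uni H) \<cdot> runit_inv D (car K)"
    note cK = is_bimonoid_comonoid[OF K] and cH = is_bimonoid_comonoid[OF H]
    note oK = is_comonoid_D(1)[OF cK, simplified] and oH = is_comonoid_D(1)[OF cH, simplified]
    have T': "monoid_of ?T = \<lparr>mcar = mcar (monoid_of K) \<otimes> mcar (monoid_of H), mmul = ?m,
        muni = twist_uni D (monoid_of K) (monoid_of H)\<rparr>"
      by (simp add: monoid_of_def twisted_bimonoid_def)
    \<comment> \<open>This instance is taken in \<open>D\<close>, where \<open>\<psi>\<close> is an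
      arrow by assumption.\<close>
    have \<psi>_eq: "?m \<cdot> (?j \<boxtimes> ?i) = \<psi>"
      using twist_mul_units[OF is_bimonoid_monoid[OF K] is_bimonoid_monoid[OF H], of \<psi>] \<psi>
        is_bimonoid_monoid[OF T] unfolding T' by simp
    have j: "comonoid_hom (bullet D) ?H (comonoid_tensor D ?K ?H) ?j"
      using comonoid_hom_comp[OF comonoid_hom_inv[OF comonoid_hom_lunit[OF cH]] comonoid_hom_tensor[OF _
        comonoid_hom_ident[OF cH]]]
        Com.is_monoid_D(3)[OF K'] lunit_iso[OF oH] by simp
    have i: "comonoid_hom (bullet D) ?K (comonoid_tensor D ?K ?H) ?i"
      using comonoid_hom_comp[OF comonoid_hom_inv[OF comonoid_hom_runit[OF cK]] comonoid_hom_tensor[OF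
        comonoid_hom_ident[OF cK]]]
        Com.is_monoid_D(3)[OF H'] runit_iso[OF oK] by simp
    have m: "comonoid_hom (bullet D) (comonoid_tensor D (comonoid_tensor D ?K ?H) (comonoid_tensor D ?K ?H))
        (comonoid_tensor D ?K ?H) ?m"
      using Com.is_monoid_D(2)[OF T[unfolded is_bimonoid_iff]]
      by (simp add: twisted_bimonoid_def comonoid_tensor_def comonoid_of_def)
    show ?thesis using comonoid_hom_comp[OF comonoid_hom_tensor[OF j i] m] unfolding \<psi>_eq .
  qed
  ultimately show ?thesis by blast
qed

lemma twisted_tensor_product_Comon:
  assumes K: "is_bimonoid D K" and H: "is_bimonoid D H"
    and \<psi>: "\<psi> \<in> hom D (car H \<otimes> car K) (car K \<otimes> car H)"
    and T: "is_bimonoid D (twisted_bimonoid D K H \<psi>)"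
  shows "is_twisted_tensor_product (Comon D) (comon_monoid_of H) (comon_monoid_of K) \<psi>
    (comon_monoid_of (twisted_bimonoid D K H \<psi>))"
  using T[unfolded is_bimonoid_twisted_iff[OF K H \<psi>]] K H comon_monoid_of_twisted[OF K H]
  by (simp add: is_twisted_tensor_product_def monoidal_category_Comon is_bimonoid_iff[symmetric]
      twisting_morphism_def twisting_equations_Comon)

text \<open>The factorization theorem is applied inside \<open>Comon D\<close>. There
  \<open>\<phi>\<close> is invertible because its inverse in \<open>D\<close> is a comonoid
  morphism, and the \<open>\<psi>\<close> formed in either category is the same.\<close>

lemma bimonoid_hom_factorization:
  assumes i: "bimonoid_hom D K A i" and j: "bimonoid_hom D H A j"
    and \<phi>: "\<phi> = mul A \<cdot> (i \<boxtimes> j)" and inv: "invertible D (car K \<otimes> car H) (car A) \<phi>"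
    and \<psi>: "\<psi> = inv_arr D (car K \<otimes> car H) (car A) \<phi> \<cdot> mul A \<cdot> (j \<boxtimes> i)"
  shows "bimonoid_hom D (twisted_bimonoid D K H \<psi>) A \<phi>"
proof -
  interpret Com: monoidal_category "Comon D" by (rule monoidal_category_Comon)
  note i' = i[unfolded bimonoid_hom_iff] and j' = j[unfolded bimonoid_hom_iff]
  have K: "is_bimonoid D K" and H: "is_bimonoid D H" using i j by (simp_all add: bimonoid_hom_def)
  have h\<phi>: "comonoid_hom (bullet D) (comonoid_tensor D (comonoid_of K) (comonoid_of H)) (comonoid_of A) \<phi>"
    unfolding \<phi> using Com.is_monoid_D(2)[OF Com.monoid_hom_D(2)[OF i']]
      Com.monoid_hom_D(3)[OF i'] Com.monoid_hom_D(3)[OF j']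
    by (auto intro: comonoid_hom_comp comonoid_hom_tensor)
  show ?thesis
    unfolding bimonoid_hom_iff comon_monoid_of_twisted[OF K H]
    by (rule Com.monoid_factorization[OF i' j'])
      (use \<phi> \<psi> inv h\<phi> in \<open>simp_all add: invertible_Comon inv_arr_Comon\<close>)
qed

text \<open>\<open>\<phi>\<close> is cancelled to compare multiplications and units,
  \<open>\<phi> \<odot> \<phi>\<close> to compare comultiplications; the counit is already given as
  \<open>counit A \<cdot> \<phi>\<close>.\<close>

lemma bimonoid_hom_unique:
  assumes B: "bimonoid_hom D B A \<phi>" and B': "bimonoid_hom D B' A \<phi>" and car: "car B = car B'"
    and inv: "invertible D (car B) (car A) \<phi>"
  shows "B = (B' :: ('o, 'm) bimonoid_data)"
proof -
  have b: "mul X \<in> hom D (car X \<otimes> car X) (car X)" "uni X \<in> hom D (tunit D) (car X)"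
      "comul X \<in> hom D (car X) (car X \<bullet> car X)" "\<phi> \<cdot> mul X = mul A \<cdot> (\<phi> \<boxtimes> \<phi>)" "\<phi> \<cdot> uni X = uni A"
      "(\<phi> \<odot> \<phi>) \<cdot> comul X = comul A \<cdot> \<phi>" "counit X = counit A \<cdot> \<phi>"
    if "bimonoid_hom D X A \<phi>" for X :: "('o, 'm) bimonoid_data"
    using that monoid_hom_D[of "monoid_of X" "monoid_of A" \<phi>] is_monoid_D[of "monoid_of X"]
      comonoid_hom_D[of "comonoid_of X" "comonoid_of A" \<phi>] is_comonoid_D[of "comonoid_of X"]
    by (simp_all add: bimonoid_hom_def)
  have "mul B = mul B'" "uni B = uni B'"
    using invertible_cancel_left[OF inv] b[OF B] b[OF B'] car by metis+
  moreover have "comul B = comul B'"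
    using invertible_cancel_left[OF bullet.invertible_tensor[unfolded bullet_simps bullet_invertible, OF
      inv inv]]
      b[OF B] b[OF B'] car by metis
  moreover have "counit B = counit B'" using b[OF B] b[OF B'] by simp
  ultimately show ?thesis using car by simp
qed

end

theorem theorem2p32:
  fixes D :: "('o, 'm) duoidal_data" (structure)
  assumes "duoidal_category D"
  shows
    "(\<forall>A H K i j \<phi> \<psi>.
        i \<in> hom (Bimon D) K A \<longrightarrow>
        j \<in> hom (Bimon D) H A \<longrightarrow>
        \<phi> = mul A \<cdot> (i \<boxtimes> j) \<longrightarrow>
        invertible D (car K \<otimes> car H) (car A) \<phi> \<longrightarrow>
        \<psi> = inv_arr D (car K \<otimes> car H) (car A) \<phi> \<cdot> mul A \<cdot> (j \<boxtimes> i) \<longrightarrow>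
        (\<exists>!B. B \<in> obj (Bimon D) \<and> car B = car K \<otimes> car H \<and> \<phi> \<in> hom (Bimon D) B A) \<and>
        twisted_bimonoid D K H \<psi> \<in> obj (Bimon D) \<and>
        \<phi> \<in> hom (Bimon D) (twisted_bimonoid D K H \<psi>) A)
     \<and>
     (\<forall>H K \<psi>.
        H \<in> obj (Bimon D) \<longrightarrow>
        K \<in> obj (Bimon D) \<longrightarrow>
        \<psi> \<in> hom D (car H \<otimes> car K) (car K \<otimes> car H) \<longrightarrow>
        (twisted_bimonoid D K H \<psi> \<in> obj (Bimon D) \<longleftrightarrow>
           twisting_equations D (monoid_of H) (monoid_of K) \<psi> \<and>
           comonoid_hom (bullet D) (comonoid_tensor D (comonoid_of H) (comonoid_of K))
             (comonoid_tensor D (comonoid_of K) (comonoid_of H)) \<psi>) \<and>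
        (twisted_bimonoid D K H \<psi> \<in> obj (Bimon D) \<longrightarrow>
           is_twisted_tensor_product (Comon D) (comon_monoid_of H) (comon_monoid_of K) \<psi>
             (comon_monoid_of (twisted_bimonoid D K H \<psi>))))"
proof -
  interpret duoidal_category D by (rule assms)
  have Bimon_simps: "obj (Bimon D) = {B. is_bimonoid D B}" "hom (Bimon D) A B = {f. bimonoid_hom D A B
    f}" for A B
    by (simp_all add: Bimon_def)
  have factorization: "(\<exists>!B. is_bimonoid D B \<and> car B = car K \<otimes> car H \<and> bimonoid_hom D B A \<phi>) \<and>
      is_bimonoid D (twisted_bimonoid D K H \<psi>) \<and> bimonoid_hom D (twisted_bimonoid D K H \<psi>) A \<phi>"
    if "bimonoid_hom D K A i" "bimonoid_hom D H A j" "\<phi> = mul A \<cdot> (i \<boxtimes> j)"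
      and inv: "invertible D (car K \<otimes> car H) (car A) \<phi>"
      and "\<psi> = inv_arr D (car K \<otimes> car H) (car A) \<phi> \<cdot> mul A \<cdot> (j \<boxtimes> i)" for A H K i j \<phi> \<psi>
  proof -
    let ?T = "twisted_bimonoid D K H \<psi>"
    have T: "bimonoid_hom D ?T A \<phi>" by (rule bimonoid_hom_factorization) (fact that)+
    then have bT: "is_bimonoid D ?T" by (simp add: bimonoid_hom_def)
    have car: "car ?T = car K \<otimes> car H" by (simp add: twisted_bimonoid_def)
    have "\<exists>!B. is_bimonoid D B \<and> car B = car K \<otimes> car H \<and> bimonoid_hom D B A \<phi>"
    proof (rule ex1I)
      show "is_bimonoid D ?T \<and> car ?T = car K \<otimes> car H \<and> bimonoid_hom D ?T A \<phi>" using T bT car by simp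
      fix B assume "is_bimonoid D B \<and> car B = car K \<otimes> car H \<and> bimonoid_hom D B A \<phi>"
      then have B: "bimonoid_hom D B A \<phi>" and carB: "car B = car K \<otimes> car H" by simp_all
      show "B = ?T" by (rule bimonoid_hom_unique[OF B T]) (simp_all add: carB car inv)
    qed
    then show ?thesis using T bT by simp
  qed
  show ?thesis
    unfolding Bimon_simps mem_Collect_eq
    by (intro conjI allI impI)
      (rule factorization[THEN conjunct1] factorization[THEN conjunct2, THEN conjunct1]
        factorization[THEN conjunct2, THEN conjunct2] is_bimonoid_twisted_iff
        twisted_tensor_product_Comon; assumption)+
qed

end
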